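(* Let $\lambda\in\sum_{i\in I_0}\mathbb{Z}_{\ge0}\varpi_i$ be a level-zero dominant integral weight. Let $\mathbb{B}$ be a subset of $\mathbb{P}_{\mathrm{cl,int}}$ satisfying: (a) the set $\mathbb{B}\cup\{\mathbf{0}\}$ is stable under the root operators $f_j$ for all $j\in I$; (b) for each $\eta\in\mathbb{B}$ there exist a sequence $\mu_1,\dots,\mu_s$ of elements of $\mathrm{cl}(W\lambda)=W_0\,\mathrm{cl}(\lambda)$ and rational numbers $0=\sigma_0<\sigma_1<\dots<\sigma_s=1$ such that $\eta(t)=\sum_{l=1}^{k-1}(\sigma_l-\sigma_{l-1})\mu_l+(t-\sigma_{k-1})\mu_k$ for $\sigma_{k-1}\le t\le\sigma_k$, $1\le k\le s$. Then $\mathbb{B}=\mathbb{B}(\lambda)_{\mathrm{cl}}$.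
   Context: Affine data: $\mathfrak{g}$ is an untwisted affine Lie algebra over $\mathbb{C}$ with index set $I$ of simple roots (nodes numbered as in Kac's book), distinguished node $0$, $I_0=I\setminus\{0\}$; simple roots $\alpha_j$, simple coroots $\alpha_j^\vee$, fundamental weights $\Lambda_j$, null root $\delta=\sum a_j\alpha_j$, canonical central element $c=\sum a_j^\vee\alpha_j^\vee$, weight lattice $P=\bigoplus_{j\in I}\mathbb{Z}\Lambda_j\oplus\mathbb{Z}\delta$, Weyl group $W$ generated by simple reflections $r_j$, $r_\beta$ the reflection in a real root $\beta$ with dual root $\beta^\vee$, $W_0=\langle r_j\mid j\in I_0\rangle$, $\theta$ the highest root of the finite root system. Level-zero fundamental weights: $\varpi_i=\Lambda_i-a_i^\vee\Lambda_0$. $\mathrm{cl}:\mathfrak{h}^*\to\mathfrak{h}^*/\mathbb{C}\delta$ is the projection, $P_{\mathrm{cl}}=\mathrm{cl}(P)$, paired with coroots via $\langle\mathrm{cl}(\mu),\alpha_j^\vee\rangle=\langle\mu,\alpha_j^\vee\rangle$, and simple roots are identified with their images in $P_{\mathrm{cl}}$. Paths and root operators: $\mathbb{P}_{\mathrm{cl}}$ is the set of piecewise-linear continuous $\eta:[0,1]\to\mathbb{R}\otimes_{\mathbb{Z}}P_{\mathrm{cl}}$ with $\eta(0)=0$, $\eta(1)\in P_{\mathrm{cl}}$. For $j\in I$ put $H^\eta_j(t)=\langle\eta(t),\alpha_j^\vee\rangle$ and $m^\eta_j=\min_{t\in[0,1]}H^\eta_j(t)$. $\mathbb{P}_{\mathrm{cl,int}}^{(j)}$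 is the set of $\eta\in\mathbb{P}_{\mathrm{cl}}$ all of whose local minima of $H^\eta_j$ are integers, and $\mathbb{P}_{\mathrm{cl,int}}=\bigcap_{j\in I}\mathbb{P}_{\mathrm{cl,int}}^{(j)}$. For $\eta\in\mathbb{P}^{(j)}_{\mathrm{cl,int}}$: if $H^\eta_j(1)-m^\eta_j=0$ then $f_j\eta=\mathbf{0}$ (an extra element); otherwise let $t_0=\max\{t\in[0,1]\mid H^\eta_j(t)=m^\eta_j\}$, $t_1=\min\{t\in[t_0,1]\mid H^\eta_j(t)=m^\eta_j+1\}$ and $(f_j\eta)(t)=\eta(t)$ for $t\le t_0$, $=\eta(t_0)+r_j(\eta(t)-\eta(t_0))$ for $t_0\le t\le t_1$, $=\eta(t)-\alpha_j$ for $t\ge t_1$, where $r_j\mu=\mu-\langle\mu,\alpha_j^\vee\rangle\alpha_j$. Also $f_j\mathbf{0}=\mathbf{0}$. LS paths: for $\mu\in P$ and $\mu',\nu\in W\mu$, write $\mu'\ge\nu$ if there are $\mu'=\mu_0,\dots,\mu_n=\nu$ in $W\mu$ and positive real roots $\beta_k$ with $\mu_k=r_{\beta_k}\mu_{k-1}$, $\langle\mu_{k-1},\beta_k^\vee\rangle<0$; $\mathrm{dist}(\mu',\nu)$ is the maximal such $n$. For $\mu'>\nu$ and rational $0<\sigma<1$, a $\sigma$-chain for $(\mu',\nu)$ is $\mu'=\mu_0>\dots>\mu_n=\nu$ in $W\mu$ with $\mathrm{dist}(\mu_{k-1},\mu_k)=1$ and $\sigma\langle\mu_{k-1},\beta_k^\vee\rangle\in\mathbb{Z}_{<0}$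 where $r_{\beta_k}\mu_{k-1}=\mu_k$, $\beta_k$ positive real. An LS path of shape $\mu$ is $(\nu_1>\dots>\nu_s;\,0=\sigma_0<\dots<\sigma_s=1)$ with $\nu_k\in W\mu$, $\sigma_k\in\mathbb{Q}$, having a $\sigma_k$-chain for $(\nu_k,\nu_{k+1})$ for each $1\le k\le s-1$; identified with $\pi(t)=\sum_{l<k}(\sigma_l-\sigma_{l-1})\nu_l+(t-\sigma_{k-1})\nu_k$ on $[\sigma_{k-1},\sigma_k]$. $\mathbb{B}(\mu)_{\mathrm{cl}}=\{\mathrm{cl}\circ\pi\mid\pi$ an LS path of shape $\mu\}$.
   Formalization: The set $\mathbb{B}$ is assumed to be non-empty; for $\mathbb{B}=\emptyset$ conditions (a) and (b) hold vacuously, but $\mathbb{B}(\lambda)_{\mathrm{cl}}$ contains the straight-line path $t\mapsto t\,\mathrm{cl}(\lambda)$, so the claim fails. *)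

theory Defs
  imports Complex_Main
begin

text \<open>The index set I is a finite type 'i; the distinguished node 0 is i0.
  A i j is the Cartan integer a_ij = <alpha_i^vee, alpha_j>.\<close>

definition GCM :: "('i::finite \<Rightarrow> 'i \<Rightarrow> int) \<Rightarrow> bool" where
  "GCM A \<longleftrightarrow> (\<forall>i. A i i = 2) \<and> (\<forall>i j. i \<noteq> j \<longrightarrow> A i j \<le> 0)
      \<and> (\<forall>i j. A i j = 0 \<longleftrightarrow> A j i = 0)"

definition indecomposable :: "('i::finite \<Rightarrow> 'i \<Rightarrow> int) \<Rightarrow> bool" where
  "indecomposable A \<longleftrightarrow>
     \<not> (\<exists>J. J \<noteq> {} \<and> J \<noteq> UNIV \<and> (\<forall>j\<in>J. \<forall>k\<in>-J. A j k = 0))"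

definition unit_vec :: "'i \<Rightarrow> 'i \<Rightarrow> int" where
  "unit_vec j = (\<lambda>k. if k = j then 1 else 0)"

text \<open>Simple reflection r_j (j in I_0) acting on the finite root lattice
  (coordinates w.r.t. the simple roots alpha_k, k in I_0).\<close>
definition fin_refl :: "('i::finite \<Rightarrow> 'i \<Rightarrow> int) \<Rightarrow> 'i \<Rightarrow> ('i \<Rightarrow> int) \<Rightarrow> ('i \<Rightarrow> int)" where
  "fin_refl A j \<beta> = (\<lambda>k. \<beta> k - (\<Sum>l\<in>UNIV. \<beta> l * A j l) * unit_vec j k)"

inductive_set fin_roots :: "('i::finite \<Rightarrow> 'i \<Rightarrow> int) \<Rightarrow> 'i \<Rightarrow> ('i \<Rightarrow> int) set"
  for A :: "'i \<Rightarrow> 'i \<Rightarrow> int" and i0 :: 'i where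
  simple: "j \<noteq> i0 \<Longrightarrow> unit_vec j \<in> fin_roots A i0"
| refl: "\<beta> \<in> fin_roots A i0 \<Longrightarrow> j \<noteq> i0 \<Longrightarrow> fin_refl A j \<beta> \<in> fin_roots A i0"

text \<open>A is an untwisted affine Cartan matrix with i0 the node 0 in Kac's numbering:
  indecomposable GCM, with a positive integral null vector (a_j) with a_0 = 1
  (so affine type, delta = sum a_j alpha_j), dual labels with a_0^vee = 1,
  and theta = delta - alpha_0 = sum_{j in I_0} a_j alpha_j is the highest root of the
  finite root system.\<close>
definition untwisted_affine :: "('i::finite \<Rightarrow> 'i \<Rightarrow> int) \<Rightarrow> 'i \<Rightarrow> bool" where
  "untwisted_affine A i0 \<longleftrightarrow> GCM A \<and> indecomposable A \<and>
     (\<exists>a::'i \<Rightarrow> int. (\<forall>i. a i > 0) \<and> a i0 = 1 \<and> (\<forall>i. (\<Sum>j\<in>UNIV. A i j * a j) = 0)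
        \<and> (\<lambda>k. if k = i0 then 0 else a k) \<in> fin_roots A i0
        \<and> (\<forall>j. j \<noteq> i0 \<longrightarrow>
              (\<lambda>k. (if k = i0 then 0 else a k) + unit_vec j k) \<notin> fin_roots A i0)) \<and>
     (\<exists>v::'i \<Rightarrow> int. (\<forall>i. v i > 0) \<and> v i0 = 1 \<and> (\<forall>j. (\<Sum>i\<in>UNIV. v i * A i j) = 0))"

text \<open>Dual labels a_i^vee (c = sum a_i^vee alpha_i^vee), normalised by a_0^vee = 1.\<close>
definition avee :: "('i::finite \<Rightarrow> 'i \<Rightarrow> int) \<Rightarrow> 'i \<Rightarrow> 'i \<Rightarrow> int" where
  "avee A i0 = (THE v. v i0 = 1 \<and> (\<forall>j. (\<Sum>i\<in>UNIV. v i * A i j) = 0))"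

text \<open>A weight in P is (coefficients of Lambda_j, coefficient of delta).
  Pairing with alpha_j^vee is the Lambda_j-coefficient.\<close>
type_synonym 'i wt = "('i \<Rightarrow> int) \<times> int"

definition sroot :: "('i::finite \<Rightarrow> 'i \<Rightarrow> int) \<Rightarrow> 'i \<Rightarrow> 'i \<Rightarrow> 'i wt" where
  "sroot A i0 j = ((\<lambda>i. A i j), (if j = i0 then 1 else 0))"

definition sref :: "('i::finite \<Rightarrow> 'i \<Rightarrow> int) \<Rightarrow> 'i \<Rightarrow> 'i \<Rightarrow> 'i wt \<Rightarrow> 'i wt" where
  "sref A i0 j \<mu> = (let p = fst \<mu> j in
      ((\<lambda>i. fst \<mu> i - p * A i j), snd \<mu> - p * (if j = i0 then 1 else 0)))"

definition wact :: "('i::finite \<Rightarrow> 'i \<Rightarrow> int) \<Rightarrow> 'i \<Rightarrow> 'i list \<Rightarrow> 'i wt \<Rightarrow> 'i wt" where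
  "wact A i0 ws \<mu> = foldr (sref A i0) ws \<mu>"

definition Worbit :: "('i::finite \<Rightarrow> 'i \<Rightarrow> int) \<Rightarrow> 'i \<Rightarrow> 'i wt \<Rightarrow> 'i wt set" where
  "Worbit A i0 \<mu> = {wact A i0 ws \<mu> | ws. True}"

definition pos_root :: "('i::finite \<Rightarrow> 'i \<Rightarrow> int) \<Rightarrow> 'i \<Rightarrow> 'i wt \<Rightarrow> bool" where
  "pos_root A i0 \<beta> \<longleftrightarrow> (\<exists>c::'i \<Rightarrow> nat.
      fst \<beta> = (\<lambda>i. \<Sum>j\<in>UNIV. int (c j) * A i j) \<and> snd \<beta> = int (c i0))"

text \<open>refl_data A i0 mu nu p: there is a positive real root beta = w alpha_j with
  nu = r_beta mu and <mu, beta^vee> = p (beta^vee = w alpha_j^vee, r_beta = w r_j w^-1).\<close>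
definition refl_data :: "('i::finite \<Rightarrow> 'i \<Rightarrow> int) \<Rightarrow> 'i \<Rightarrow> 'i wt \<Rightarrow> 'i wt \<Rightarrow> int \<Rightarrow> bool" where
  "refl_data A i0 \<mu> \<nu> p \<longleftrightarrow> (\<exists>ws j.
      pos_root A i0 (wact A i0 ws (sroot A i0 j)) \<and>
      p = fst (wact A i0 (rev ws) \<mu>) j \<and>
      \<nu> = wact A i0 ws (sref A i0 j (wact A i0 (rev ws) \<mu>)))"

definition refl_step :: "('i::finite \<Rightarrow> 'i \<Rightarrow> int) \<Rightarrow> 'i \<Rightarrow> 'i wt \<Rightarrow> 'i wt \<Rightarrow> bool" where
  "refl_step A i0 \<mu> \<nu> \<longleftrightarrow> (\<exists>p<0. refl_data A i0 \<mu> \<nu> p)"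

definition wt_ge :: "('i::finite \<Rightarrow> 'i \<Rightarrow> int) \<Rightarrow> 'i \<Rightarrow> 'i wt \<Rightarrow> 'i wt \<Rightarrow> bool" where
  "wt_ge A i0 \<mu> \<nu> \<longleftrightarrow> (refl_step A i0)\<^sup>*\<^sup>* \<mu> \<nu>"

definition wt_gt :: "('i::finite \<Rightarrow> 'i \<Rightarrow> int) \<Rightarrow> 'i \<Rightarrow> 'i wt \<Rightarrow> 'i wt \<Rightarrow> bool" where
  "wt_gt A i0 \<mu> \<nu> \<longleftrightarrow> wt_ge A i0 \<mu> \<nu> \<and> \<mu> \<noteq> \<nu>"

definition dist_one :: "('i::finite \<Rightarrow> 'i \<Rightarrow> int) \<Rightarrow> 'i \<Rightarrow> 'i wt \<Rightarrow> 'i wt \<Rightarrow> bool" where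
  "dist_one A i0 \<mu> \<nu> \<longleftrightarrow> refl_step A i0 \<mu> \<nu> \<and>
      (\<forall>n. (refl_step A i0 ^^ n) \<mu> \<nu> \<longrightarrow> n \<le> 1)"

definition sigma_step :: "('i::finite \<Rightarrow> 'i \<Rightarrow> int) \<Rightarrow> 'i \<Rightarrow> rat \<Rightarrow> 'i wt \<Rightarrow> 'i wt \<Rightarrow> bool" where
  "sigma_step A i0 \<sigma> \<mu> \<nu> \<longleftrightarrow> wt_gt A i0 \<mu> \<nu> \<and> dist_one A i0 \<mu> \<nu> \<and>
      (\<exists>p. refl_data A i0 \<mu> \<nu> p \<and> (\<exists>m::int. m < 0 \<and> \<sigma> * of_int p = of_int m))"

definition sigma_chain :: "('i::finite \<Rightarrow> 'i \<Rightarrow> int) \<Rightarrow> 'i \<Rightarrow> rat \<Rightarrow> 'i wt \<Rightarrow> 'i wt \<Rightarrow> bool" where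
  "sigma_chain A i0 \<sigma> \<mu> \<nu> \<longleftrightarrow> (sigma_step A i0 \<sigma>)\<^sup>+\<^sup>+ \<mu> \<nu>"

text \<open>LS path of shape lam: nus = [nu_1,...,nu_s], sigmas = [sigma_1,...,sigma_s] (sigma_0 = 0).\<close>
definition is_LS :: "('i::finite \<Rightarrow> 'i \<Rightarrow> int) \<Rightarrow> 'i \<Rightarrow> 'i wt \<Rightarrow> 'i wt list \<Rightarrow> rat list \<Rightarrow> bool" where
  "is_LS A i0 lam nus sigmas \<longleftrightarrow> nus \<noteq> [] \<and> length sigmas = length nus \<and>
      set nus \<subseteq> Worbit A i0 lam \<and> 0 < sigmas ! 0 \<and> last sigmas = 1 \<and>
      (\<forall>k. Suc k < length nus \<longrightarrow>
          wt_gt A i0 (nus ! k) (nus ! Suc k) \<and> sigmas ! k < sigmas ! Suc k \<and>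
          sigma_chain A i0 (sigmas ! k) (nus ! k) (nus ! Suc k))"

text \<open>Elements of R (x) P_cl are functions 'i => real (coefficients of cl(Lambda_j));
  paths are functions real => ('i => real), extended constantly outside [0,1].\<close>
type_synonym 'i path = "real \<Rightarrow> 'i \<Rightarrow> real"

definition clw :: "'i wt \<Rightarrow> 'i \<Rightarrow> real" where
  "clw \<mu> = (\<lambda>i. real_of_int (fst \<mu> i))"

text \<open>The path sum_{l<k} (s_l - s_{l-1}) mu_l + (t - s_{k-1}) mu_k on [s_{k-1}, s_k]
  (with s_0 = 0), written as one formula valid for all t.\<close>
definition lin_path :: "('i \<Rightarrow> real) list \<Rightarrow> real list \<Rightarrow> 'i path" where
  "lin_path mus sigmas t = (\<lambda>i. \<Sum>k<length mus.
      max 0 (min t (sigmas ! k) - (if k = 0 then 0 else sigmas ! (k - 1))) * (mus ! k) i)"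

definition LS_cl :: "('i::finite \<Rightarrow> 'i \<Rightarrow> int) \<Rightarrow> 'i \<Rightarrow> 'i wt \<Rightarrow> 'i path set" where
  "LS_cl A i0 lam = {lin_path (map clw nus) (map of_rat sigmas) | nus sigmas.
       is_LS A i0 lam nus sigmas}"

definition pw_linear :: "'i path \<Rightarrow> bool" where
  "pw_linear \<eta> \<longleftrightarrow> (\<exists>m (ts::nat \<Rightarrow> real). ts 0 = 0 \<and> ts m = 1 \<and>
      (\<forall>k<m. ts k < ts (Suc k) \<and>
         (\<exists>a b :: 'i \<Rightarrow> real. \<forall>s\<in>{ts k..ts (Suc k)}. \<forall>i. \<eta> s i = a i + s * b i)))"

definition P_cl :: "'i path set" where
  "P_cl = {\<eta>. pw_linear \<eta> \<and> \<eta> 0 = (\<lambda>i. 0) \<and> (\<forall>i. \<eta> 1 i \<in> \<int>) \<and>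
             (\<forall>t\<le>0. \<eta> t = \<eta> 0) \<and> (\<forall>t\<ge>1. \<eta> t = \<eta> 1)}"

definition loc_min_int :: "'i path \<Rightarrow> 'i \<Rightarrow> bool" where
  "loc_min_int \<eta> j \<longleftrightarrow> (\<forall>t\<in>{0..1}.
      (\<exists>\<epsilon>>0. \<forall>s\<in>{0..1}. \<bar>s - t\<bar> < \<epsilon> \<longrightarrow> \<eta> t j \<le> \<eta> s j) \<longrightarrow> \<eta> t j \<in> \<int>)"

definition P_cl_int :: "'i path set" where
  "P_cl_int = {\<eta> \<in> P_cl. \<forall>j. loc_min_int \<eta> j}"

definition clroot :: "('i::finite \<Rightarrow> 'i \<Rightarrow> int) \<Rightarrow> 'i \<Rightarrow> 'i \<Rightarrow> real" where
  "clroot A j = (\<lambda>i. real_of_int (A i j))"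

definition refl_cl :: "('i::finite \<Rightarrow> 'i \<Rightarrow> int) \<Rightarrow> 'i \<Rightarrow> ('i \<Rightarrow> real) \<Rightarrow> ('i \<Rightarrow> real)" where
  "refl_cl A j v = (\<lambda>i. v i - v j * clroot A j i)"

text \<open>Root operator f_j; None plays the role of the extra element 0.\<close>
definition root_f :: "('i::finite \<Rightarrow> 'i \<Rightarrow> int) \<Rightarrow> 'i \<Rightarrow> 'i path \<Rightarrow> 'i path option" where
  "root_f A j \<eta> = (let H = (\<lambda>t. \<eta> t j); m = Inf (H ` {0..1}) in
     if H 1 - m = 0 then None else
     (let t0 = Sup {t \<in> {0..1}. H t = m}; t1 = Inf {t \<in> {t0..1}. H t = m + 1} in
       Some (\<lambda>t. if t \<le> t0 then \<eta> t
                 else if t \<le> t1 then (\<lambda>i. \<eta> t0 i + refl_cl A j (\<lambda>k. \<eta> t k - \<eta> t0 k) i)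
                 else (\<lambda>i. \<eta> t i - clroot A j i))))"

definition varpi :: "('i::finite \<Rightarrow> 'i \<Rightarrow> int) \<Rightarrow> 'i \<Rightarrow> 'i \<Rightarrow> 'i wt" where
  "varpi A i0 i = ((\<lambda>k. unit_vec i k - avee A i0 i * unit_vec i0 k), 0)"

definition level_zero_dominant :: "('i::finite \<Rightarrow> 'i \<Rightarrow> int) \<Rightarrow> 'i \<Rightarrow> 'i wt set" where
  "level_zero_dominant A i0 = {((\<lambda>k. \<Sum>i\<in>{i. i \<noteq> i0}. int (c i) * fst (varpi A i0 i) k), 0)
                               | c :: 'i \<Rightarrow> nat. True}"

end

theory Submission
  imports Defs
begin

text \<open>
  The key is a balancing principle: if a finite set of paths of level zero is stable under all \<open>f\<^sub>j\<close>, then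
  summing the endpoint pairings against the dual labels shows that no \<open>f\<^sub>j\<close>-string can enter it from
  outside, so it contains every \<open>f\<^sub>j\<close>-preimage as well. The set of LS paths is finite and stable under
  the \<open>f\<^sub>j\<close>. On the other hand, from any path in \<open>B\<close> one reaches a straight line by applying
  maximal powers \<open>f\<^sub>j\<^sup>m\<^sup>a\<^sup>x\<close>: they act on the last two directions \<open>(\<mu>, \<nu>)\<close> by
  reflections, and can be chosen such that the two directions become equal; integrality of the local minima
  at that moment bounds the denominator of the last turning point, so that the process ends. As straight lines are
  LS paths, going backwards gives \<open>B \<subseteq> LS_cl\<close>; then \<open>B\<close> is itself finite, contains all straight
  lines, and the same argument gives the other inclusion.
\<close>

section \<open>The symmetrizing form\<close>

text \<open>The hypotheses offer only the lowering operators \<open>f_j\<close>, so nothing inside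
  \<open>B\<close> can be traced backwards by definition; balancing replaces the missing inverses.
  It needs finiteness, and here level zero enters twice: it makes the orbit finite modulo \<delta>,
  and it is the vanishing of the endpoint pairing with the central element. \<open>B\<close> itself
  is not known to be finite, since the turning points in (b) have no common denominator; hence the
  detour through straight lines. That two directions can be made equal rests on the order on the
  lifted orbit. Lifts of one classical weight differ by multiples of \<delta>, so both directions
  are lifted into a single orbit of the finite Weyl group, where the order has a greatest and a
  least element. The affine data enter through the Cartan matrix, its two null vectors and the root
  \<theta>. Symmetrizability, the invariant form and the signs of real roots are derived from these
  without the classification of types.\<close>

lemma balanced_forest_symmetric:
  fixes w :: "'a \<Rightarrow> 'a \<Rightarrow> real"
  assumes "finite C"
    and "\<And>D. D \<subseteq> C \<Longrightarrow> D \<noteq> {} \<Longrightarrow> \<exists>i\<in>D. card {j\<in>D. j \<noteq> i \<and> (w i j \<noteq> 0 \<or> w j i \<noteq> 0)} \<le> 1"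
    and "\<And>i. i \<in> C \<Longrightarrow> (\<Sum>j\<in>C. w i j) = (\<Sum>j\<in>C. w j i)"
    and "i \<in> C" "j \<in> C"
  shows "w i j = w j i"
  using assms
proof (induction "card C" arbitrary: C i j rule: less_induct)
  case less
  \<comment> \<open>A vertex of degree at most one has at most one nonzero off-diagonal term on each
    side of its balance equation, so that term is symmetric. Deleting the vertex then preserves the
    balance at all others.\<close>
  obtain l where l: "l \<in> C" and lc: "card {j\<in>C. j \<noteq> l \<and> (w l j \<noteq> 0 \<or> w j l \<noteq> 0)} \<le> 1"
    using less.prems(2)[of C] less.prems(4) by auto
  let ?N = "{j\<in>C. j \<noteq> l \<and> (w l j \<noteq> 0 \<or> w j l \<noteq> 0)}"
  have finN: "finite ?N" using less.prems(1) by simp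
  have leaf: "w l j = w j l" if jC: "j \<in> C" for j
  proof (cases "j \<in> ?N")
    case False then show ?thesis using jC by auto
  next
    case True
    have N: "?N = {j}" using True lc finN by (metis (no_types, lifting) card_le_Suc0_iff_eq One_nat_def is_singletonI' is_singleton_the_elem singletonD empty_iff)
    have "(\<Sum>k\<in>C. w l k) = (\<Sum>k\<in>{l,j}. w l k)"
      by (rule sum.mono_neutral_right) (use less.prems(1) l jC N in auto)
    moreover have "(\<Sum>k\<in>C. w k l) = (\<Sum>k\<in>{l,j}. w k l)"
      by (rule sum.mono_neutral_right) (use less.prems(1) l jC N in auto)
    moreover have "l \<noteq> j" using True by auto
    ultimately show ?thesis using less.prems(3)[OF l] by simp
  qed
  show ?case
  proof (cases "i = l \<or> j = l")
    case True then show ?thesis using leaf less.prems by metis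
  next
    case False
    have sub: "C - {l} \<subseteq> C" by blast
    show ?thesis
    proof (rule less.hyps[of "C - {l}"])
      show "card (C - {l}) < card C" using less.prems(1) l by (meson card_Diff1_less)
      show "finite (C - {l})" using less.prems(1) by simp
      show "\<exists>i\<in>D. card {j\<in>D. j \<noteq> i \<and> (w i j \<noteq> 0 \<or> w j i \<noteq> 0)} \<le> 1"
        if "D \<subseteq> C - {l}" "D \<noteq> {}" for D
        using less.prems(2)[of D] that by blast
      show "(\<Sum>j\<in>C - {l}. w i j) = (\<Sum>j\<in>C - {l}. w j i)" if "i \<in> C - {l}" for i
      proof -
        have "(\<Sum>j\<in>C. w i j) = w i l + (\<Sum>j\<in>C - {l}. w i j)"
          "(\<Sum>j\<in>C. w j i) = w l i + (\<Sum>j\<in>C - {l}. w j i)"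
          using sum.remove[OF less.prems(1) l] by metis+
        then show ?thesis using less.prems(3)[of i] leaf[of i] that by simp
      qed
    qed (use False less.prems in auto)
  qed
qed

lemma sum_weighted_square_diff:
  fixes s :: "'a \<Rightarrow> 'a \<Rightarrow> real"
  assumes "finite C" "\<And>i j. s i j = s j i"
  shows "(\<Sum>i\<in>C. \<Sum>j\<in>C. s i j * (y i - y j)\<^sup>2)
     = 2 * (\<Sum>i\<in>C. (\<Sum>j\<in>C. s i j) * (y i)\<^sup>2) - 2 * (\<Sum>i\<in>C. \<Sum>j\<in>C. s i j * y i * y j)"
proof -
  have "(\<Sum>i\<in>C. \<Sum>j\<in>C. s i j * (y i - y j)\<^sup>2)
      = (\<Sum>i\<in>C. \<Sum>j\<in>C. s i j * (y i)\<^sup>2) + (\<Sum>i\<in>C. \<Sum>j\<in>C. s i j * (y j)\<^sup>2)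
        - 2 * (\<Sum>i\<in>C. \<Sum>j\<in>C. s i j * y i * y j)"
    by (simp add: sum_distrib_left sum.distrib[symmetric] sum_subtractf[symmetric]
        power2_eq_square algebra_simps)
  moreover have "(\<Sum>i\<in>C. \<Sum>j\<in>C. s i j * (y j)\<^sup>2) = (\<Sum>i\<in>C. \<Sum>j\<in>C. s i j * (y i)\<^sup>2)"
    by (subst sum.swap) (simp add: assms(2))
  ultimately show ?thesis by (simp add: sum_distrib_right)
qed

lemma indecomposable_closed_eq_UNIV:
  assumes "GCM A" "indecomposable A" "J \<noteq> {}"
    and "\<And>j k. j \<in> J \<Longrightarrow> A j k \<noteq> 0 \<Longrightarrow> k \<in> J"
  shows "J = UNIV"
  using assms unfolding indecomposable_def by (metis ComplD)

locale affine =
  fixes A :: "'i::finite \<Rightarrow> 'i \<Rightarrow> int" and i0 :: 'i and a v :: "'i \<Rightarrow> int"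
  assumes gcm: "GCM A" and indec: "indecomposable A"
    and a_pos: "\<And>i. a i > 0" and a_i0: "a i0 = 1"
    and A_a: "\<And>i. (\<Sum>j\<in>UNIV. A i j * a j) = 0"
    and v_pos: "\<And>i. v i > 0" and v_i0: "v i0 = 1"
    and v_A: "\<And>j. (\<Sum>i\<in>UNIV. v i * A i j) = 0"
    and theta_root: "(\<lambda>k. if k = i0 then 0 else a k) \<in> fin_roots A i0"
begin

lemma A_diag [simp]: "A i i = 2" and A_nonpos: "i \<noteq> j \<Longrightarrow> A i j \<le> 0"
  and A_zero_iff: "A i j = 0 \<longleftrightarrow> A j i = 0"
  using gcm unfolding GCM_def by blast+

text \<open>Scaling by the dual labels on the left and the labels on the right turns the two
  null-vector equations into equal row and column sums: the off-diagonal part of the Cartan matrix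
  becomes a circulation on the Dynkin diagram.\<close>

definition w :: "'i \<Rightarrow> 'i \<Rightarrow> real" where
  "w i j = (if i = j then 0 else - real_of_int (v i * A i j * a j))"

lemma w_nonneg: "w i j \<ge> 0"
  unfolding w_def using A_nonpos[of i j] v_pos[of i] a_pos[of j]
  by (auto simp: mult_nonneg_nonpos mult_nonpos_nonneg simp flip: of_int_mult)

lemma w_nonzero_iff: "i \<noteq> j \<Longrightarrow> w i j \<noteq> 0 \<longleftrightarrow> A i j \<noteq> 0"
  unfolding w_def using v_pos[of i] a_pos[of j] by auto

lemma w_row: "(\<Sum>j\<in>UNIV. w i j) = 2 * v i * a i"
proof -
  have "(\<Sum>j\<in>UNIV. w i j) = (\<Sum>j\<in>UNIV. (if i = j then 2 * v i * a i else 0) - v i * A i j * a j)"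
    unfolding of_int_sum by (rule sum.cong) (auto simp: w_def)
  also have "(\<Sum>j\<in>UNIV. (if i = j then 2 * v i * a i else 0) - v i * A i j * a j)
      = 2 * v i * a i - v i * (\<Sum>j\<in>UNIV. A i j * a j)"
    by (simp add: sum_subtractf sum_distrib_left mult.assoc)
  finally show ?thesis using A_a by simp
qed

lemma w_col: "(\<Sum>j\<in>UNIV. w j i) = 2 * v i * a i"
proof -
  have "(\<Sum>j\<in>UNIV. w j i) = (\<Sum>j\<in>UNIV. (if j = i then 2 * v i * a i else 0) - v j * A j i * a i)"
    unfolding of_int_sum by (rule sum.cong) (auto simp: w_def)
  also have "(\<Sum>j\<in>UNIV. (if j = i then 2 * v i * a i else 0) - v j * A j i * a i)
      = 2 * v i * a i - (\<Sum>j\<in>UNIV. v j * A j i) * a i"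
    by (simp add: sum_subtractf sum_distrib_right)
  finally show ?thesis using v_A by simp
qed

text \<open>\<open>w\<close> is a circulation. If some vertex set \<open>C\<close> has minimal degree at least 2 in the Dynkin
  diagram, the test vector \<open>y\<close> makes the estimate \<open>w i j * w j i \<ge> (u i * u j)\<^sup>2\<close>, which holds because
  \<open>A i j * A j i \<ge> 1\<close>, an equality; otherwise the diagram is a forest, where every circulation is symmetric.\<close>

lemma w_sym_of_core:
  assumes "C \<noteq> {}" and C: "\<And>i. i \<in> C \<Longrightarrow> card {j\<in>C. j \<noteq> i \<and> A i j \<noteq> 0} \<ge> 2"
  shows "w i j = w j i"
proof -
  define u where "u i = sqrt (v i * a i)" for i
  define s where "s i j = (w i j + w j i) / 2" for i j
  \<comment> \<open>With the value \<open>1 / u i\<close> each edge inside \<open>C\<close>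
    contributes at least one to \<open>s i j * y i * y j\<close>, which reduces the estimate to
    counting edges.\<close>
  define y where "y i = (if i \<in> C then 1 / u i else 0)" for i
  define adj where "adj i j = (if i \<in> C \<and> j \<in> C \<and> j \<noteq> i \<and> A i j \<noteq> 0 then 1 else 0 :: real)" for i j
  have u: "u i > 0" "(u i)\<^sup>2 = v i * a i" for i
    using v_pos[of i] a_pos[of i] by (auto simp: u_def simp flip: of_int_mult)
  have s_sym: "s i j = s j i" for i j by (simp add: s_def)
  have prod: "w i j * w j i \<ge> (u i * u j)\<^sup>2" if "i \<noteq> j" "A i j \<noteq> 0" for i j
  proof -
    have "A i j \<le> -1" "A j i \<le> -1" using that A_nonpos[of i j] A_nonpos[of j i] A_zero_iff[of i j] by auto
    then have "(-A i j) * (-A j i) \<ge> 1" by (smt (verit) mult_le_cancel_left1 mult_left_mono)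
    then have "A i j * A j i \<ge> 1" by simp
    moreover have "0 \<le> (v i * a i) * (v j * a j)" using v_pos a_pos by (simp add: less_imp_le)
    ultimately have "(v i * a i) * (v j * a j) * 1 \<le> (v i * a i) * (v j * a j) * (A i j * A j i)"
      by (rule mult_left_mono)
    then have "real_of_int ((v i * a i) * (v j * a j)) \<le> real_of_int ((v i * a i) * (v j * a j) * (A i j * A j i))"
      by (simp only: of_int_le_iff mult_1_right)
    also have "\<dots> = w i j * w j i" using that(1) by (simp add: w_def)
    finally show ?thesis using u by (simp add: power_mult_distrib)
  qed
  have s_ge: "s i j \<ge> u i * u j" if "i \<noteq> j" "A i j \<noteq> 0" for i j
  proof -
    have "(s i j)\<^sup>2 - w i j * w j i = ((w i j - w j i) / 2)\<^sup>2"
      by (simp add: s_def power2_eq_square field_simps)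
    then have "(u i * u j)\<^sup>2 \<le> (s i j)\<^sup>2" using prod[OF that] by (smt (verit) zero_le_power2)
    moreover have "0 \<le> s i j" using w_nonneg by (simp add: s_def)
    ultimately show ?thesis by (rule power2_le_imp_le)
  qed
  have s_nonneg: "s i j \<ge> 0" for i j using w_nonneg by (simp add: s_def)
  have adj_le: "adj i j \<le> s i j * y i * y j" for i j
    using s_ge[of i j] u(1)[of i] u(1)[of j] s_nonneg[of i j]
    by (auto simp: adj_def y_def divide_simps mult.commute)
  have "2 * real (card C) \<le> (\<Sum>i\<in>C. \<Sum>j\<in>UNIV. adj i j)"
  proof -
    have "2 \<le> (\<Sum>j\<in>UNIV. adj i j)" if i: "i \<in> C" for i
    proof -
      have "(\<Sum>j\<in>UNIV. adj i j) = real (card {j\<in>C. j \<noteq> i \<and> A i j \<noteq> 0})"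
        unfolding card_eq_sum of_nat_sum
        by (rule sum.mono_neutral_cong_right) (use i in \<open>auto simp: adj_def\<close>)
      then show ?thesis using C[OF i] by simp
    qed
    then have "(\<Sum>i\<in>C. 2) \<le> (\<Sum>i\<in>C. \<Sum>j\<in>UNIV. adj i j)" by (rule sum_mono)
    then show ?thesis by (simp add: mult.commute)
  qed
  also have "\<dots> = (\<Sum>i\<in>UNIV. \<Sum>j\<in>UNIV. adj i j)"
    by (rule sum.mono_neutral_left) (auto simp: adj_def)
  finally have lower: "2 * real (card C) \<le> (\<Sum>i\<in>UNIV. \<Sum>j\<in>UNIV. adj i j)" .
  have row: "(\<Sum>j\<in>UNIV. s i j) = 2 * (u i)\<^sup>2" for i
    unfolding s_def using w_row[of i] w_col[of i] u(2)[of i]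
    by (simp add: sum.distrib sum_divide_distrib[symmetric])
  have "(\<Sum>i\<in>UNIV. (\<Sum>j\<in>UNIV. s i j) * (y i)\<^sup>2) = (\<Sum>i\<in>UNIV. if i \<in> C then 2 else 0)"
    by (rule sum.cong) (use u(1) row in \<open>auto simp: y_def power_divide less_imp_neq[symmetric]\<close>)
  also have "\<dots> = 2 * real (card C)" by (simp add: sum.If_cases)
  finally have eq: "(\<Sum>i\<in>UNIV. \<Sum>j\<in>UNIV. s i j * (y i - y j)\<^sup>2)
     = 4 * real (card C) - 2 * (\<Sum>i\<in>UNIV. \<Sum>j\<in>UNIV. s i j * y i * y j)"
    using sum_weighted_square_diff[of UNIV s y, OF _ s_sym] by simp
  have nn: "0 \<le> (\<Sum>i\<in>UNIV. \<Sum>j\<in>UNIV. s i j * (y i - y j)\<^sup>2)"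
    by (intro sum_nonneg mult_nonneg_nonneg s_nonneg) auto
  have mono: "(\<Sum>i\<in>UNIV. \<Sum>j\<in>UNIV. adj i j) \<le> (\<Sum>i\<in>UNIV. \<Sum>j\<in>UNIV. s i j * y i * y j)"
    by (intro sum_mono adj_le)
  \<comment> \<open>The degrees bound the sum from below by \<open>2 * card C\<close>, and
    nonnegativity of the weighted squares bounds it from above by the same number. So every estimate
    is tight: \<open>y\<close> is constant along edges, which forces \<open>C\<close> to be the
    whole diagram, and each \<open>s i j\<close> on an edge attains its lower bound.\<close>
  have z1: "(\<Sum>i\<in>UNIV. \<Sum>j\<in>UNIV. s i j * (y i - y j)\<^sup>2) = 0"
    and z2: "(\<Sum>i\<in>UNIV. \<Sum>j\<in>UNIV. s i j * y i * y j - adj i j) = 0"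
    using lower nn mono eq by (auto simp: sum_subtractf)
  have y_eq: "y i = y j" if "i \<noteq> j" "A i j \<noteq> 0" for i j
  proof -
    have "s i j * (y i - y j)\<^sup>2 = 0"
      using z1 s_nonneg by (simp add: sum_nonneg_eq_0_iff sum_nonneg)
    moreover have "s i j > 0" using s_ge[OF that] u(1) by (meson less_le_trans mult_pos_pos)
    ultimately show ?thesis by simp
  qed
  have "C = UNIV"
  proof (rule indecomposable_closed_eq_UNIV[OF gcm indec \<open>C \<noteq> {}\<close>])
    fix j k assume "j \<in> C" "A j k \<noteq> 0"
    then show "k \<in> C" using y_eq[of j k] u(1)[of j] by (cases "j = k") (auto simp: y_def split: if_splits)
  qed
  show ?thesis
  proof (cases "i = j \<or> A i j = 0")
    case True then show ?thesis using A_zero_iff[of i j] by (auto simp: w_def)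
  next
    case False
    have "s i j * y i * y j - adj i j = 0"
      using z2 adj_le by (simp add: sum_nonneg_eq_0_iff sum_nonneg)
    then have "s i j = u i * u j"
      using False \<open>C = UNIV\<close> u(1)[of i] u(1)[of j] by (auto simp: adj_def y_def field_simps)
    then have "(s i j)\<^sup>2 \<le> w i j * w j i" using prod[of i j] False by simp
    moreover have "(s i j)\<^sup>2 - w i j * w j i = ((w i j - w j i) / 2)\<^sup>2"
      by (simp add: s_def power2_eq_square field_simps)
    ultimately have "((w i j - w j i) / 2)\<^sup>2 \<le> 0" by linarith
    then show ?thesis by simp
  qed
qed

lemma w_sym: "w i j = w j i"
proof (cases "\<exists>C. C \<noteq> {} \<and> (\<forall>i\<in>C. card {j\<in>C. j \<noteq> i \<and> A i j \<noteq> 0} \<ge> 2)")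
  case True then show ?thesis using w_sym_of_core by blast
next
  case False
  show ?thesis
  proof (rule balanced_forest_symmetric[of UNIV w])
    fix D :: "'i set" assume "D \<noteq> {}"
    then obtain i where "i \<in> D" and i: "card {j\<in>D. j \<noteq> i \<and> A i j \<noteq> 0} < 2" using False by (meson not_le)
    have "{j\<in>D. j \<noteq> i \<and> (w i j \<noteq> 0 \<or> w j i \<noteq> 0)} = {j\<in>D. j \<noteq> i \<and> A i j \<noteq> 0}"
      using w_nonzero_iff A_zero_iff by metis
    then show "\<exists>i\<in>D. card {j\<in>D. j \<noteq> i \<and> (w i j \<noteq> 0 \<or> w j i \<noteq> 0)} \<le> 1" using i \<open>i \<in> D\<close> by (metis (no_types, lifting) One_nat_def less_2_cases_iff less_or_eq_imp_le order_refl zero_le)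
  next
    fix i show "(\<Sum>j\<in>UNIV. w i j) = (\<Sum>j\<in>UNIV. w j i)" using w_row w_col by simp
  qed auto
qed

text \<open>Dividing the symmetry of \<open>w\<close> by \<open>a i * a j\<close> shows that this
  diagonal symmetrizes the Cartan matrix. It is normalized by \<open>d i0 = 1\<close>.\<close>

definition d :: "'i \<Rightarrow> real" where "d i = v i / a i"

lemma d_pos: "d i > 0" unfolding d_def using v_pos a_pos by simp

lemma d_sym: "d i * A i j = d j * A j i"
proof (cases "i = j")
  case False
  have "real_of_int (v i * A i j * a j) = real_of_int (v j * A j i * a i)"
    using w_sym[of i j] False by (simp add: w_def)
  then show ?thesis using a_pos[of i] a_pos[of j] unfolding d_def by (simp add: field_simps)
qed simp

end

section \<open>Real roots\<close>

lemma sum_symmetric_even: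
  fixes m :: "'a \<Rightarrow> 'a \<Rightarrow> int"
  assumes "finite C" "\<And>i j. m i j = m j i" "\<And>i. even (m i i)"
  shows "even (\<Sum>i\<in>C. \<Sum>j\<in>C. m i j)"
  using assms(1)
proof (induction C)
  case (insert x F)
  have "(\<Sum>i\<in>F. m i x) = (\<Sum>j\<in>F. m x j)" using assms(2) by (intro sum.cong) auto
  then show ?case using insert assms(3) by (simp add: sum.distrib)
qed simp

lemma foldr_inverse:
  assumes "\<And>j x. f j (f j x) = x"
  shows "foldr f ws (foldr f (rev ws) x) = x" "foldr f (rev ws) (foldr f ws x) = x"
proof -
  have "foldr f ws (foldr f (rev ws) x) = x" for ws x
  proof (induction ws arbitrary: x)
    case (Cons j ws) then show ?case using assms by simp
  qed simp
  from this[of ws x] this[of "rev ws" x]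
  show "foldr f ws (foldr f (rev ws) x) = x" "foldr f (rev ws) (foldr f ws x) = x" by auto
qed

section \<open>The semidefinite invariant form on the root lattice\<close>

context affine
begin

definition bil :: "('i \<Rightarrow> int) \<Rightarrow> ('i \<Rightarrow> int) \<Rightarrow> real" where
  "bil c c' = (\<Sum>k\<in>UNIV. \<Sum>l\<in>UNIV. d k * A k l * c k * c' l)"

lemma bil_eq_pairing: "bil c c' = (\<Sum>k\<in>UNIV. d k * c k * (\<Sum>l\<in>UNIV. A k l * c' l))"
  unfolding bil_def by (simp add: sum_distrib_left mult.assoc mult.left_commute)

lemma bil_sym: "bil c c' = bil c' c"
  unfolding bil_def
  by (subst sum.swap) (simp add: d_sym[of _ _] mult.assoc mult.left_commute mult.commute[of "of_int (c _)"])

lemma bil_diff_left: "bil (\<lambda>k. c k - c'' k) c' = bil c c' - bil c'' c'"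
  unfolding bil_def by (simp add: sum_subtractf[symmetric] algebra_simps)

lemma bil_scale_left: "bil (\<lambda>k. n * c k) c' = n * bil c c'"
  unfolding bil_def by (simp add: sum_distrib_left algebra_simps)

lemma bil_diff_right: "bil c' (\<lambda>k. c k - c'' k) = bil c' c - bil c' c''"
  using bil_diff_left bil_sym by metis

lemma bil_scale_right: "bil c' (\<lambda>k. n * c k) = n * bil c' c"
  using bil_scale_left bil_sym by metis

lemma sum_unit_vec [simp]: "(\<Sum>k\<in>UNIV. f k * unit_vec (j::'i) k) = f j"
  "(\<Sum>k\<in>UNIV. unit_vec (j::'i) k * f k) = f j"
  by (simp_all add: unit_vec_def if_distrib[of "\<lambda>x. _ * x"] if_distrib[of "\<lambda>x. x * _"] cong: if_cong)

lemma bil_unit_left: "bil (unit_vec j) c = d j * (\<Sum>l\<in>UNIV. A j l * c l)"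
proof -
  have "bil (unit_vec j) c = (\<Sum>k\<in>UNIV. if k = j then d j * (\<Sum>l\<in>UNIV. A j l * c l) else 0)"
    unfolding bil_eq_pairing by (rule sum.cong) (auto simp: unit_vec_def)
  then show ?thesis by simp
qed

lemma bil_unit_unit [simp]: "bil (unit_vec j) (unit_vec j) = 2 * d j"
  by (simp add: bil_unit_left)

lemma bil_a [simp]: "bil a c = 0" "bil c a = 0"
  using bil_sym[of a c] by (simp_all add: bil_eq_pairing[of c a] A_a)

text \<open>Since \<open>a\<close> lies in the radical, completing squares in the ratios
  \<open>c k / a k\<close> turns the form into the energy of a weighted graph, from which
  semidefiniteness and the radical can be read off.\<close>

lemma bil_square: "bil c c = (\<Sum>k\<in>UNIV. \<Sum>l\<in>UNIV. w k l * (c k / a k - c l / a l)\<^sup>2) / 2"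
proof -
  let ?y = "\<lambda>k. c k / a k"
  have a0: "real_of_int (a k) \<noteq> 0" for k using a_pos[of k] by simp
  have "(\<Sum>k\<in>UNIV. \<Sum>l\<in>UNIV. w k l * (?y k - ?y l)\<^sup>2) / 2
      = (\<Sum>k\<in>UNIV. (\<Sum>l\<in>UNIV. w k l) * (?y k)\<^sup>2) - (\<Sum>k\<in>UNIV. \<Sum>l\<in>UNIV. w k l * ?y k * ?y l)"
    using sum_weighted_square_diff[of UNIV w ?y] w_sym by simp
  also have "\<dots> = (\<Sum>k\<in>UNIV. \<Sum>l\<in>UNIV. (if k = l then 2 * v k * a k * (?y k)\<^sup>2 else 0) - w k l * ?y k * ?y l)"
    by (simp add: w_row sum_subtractf)
  also have "\<dots> = bil c c"
    unfolding bil_def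
    by (intro sum.cong HOL.refl) (use a_pos a0 in \<open>auto simp: w_def d_def field_simps power2_eq_square\<close>)
  finally show ?thesis by simp
qed

lemma bil_nonneg: "bil c c \<ge> 0"
  unfolding bil_square using w_nonneg by (simp add: sum_nonneg)

text \<open>Zero energy makes the ratios \<open>c k / a k\<close> agree along every edge, hence
  everywhere by indecomposability; \<open>a i0 = 1\<close> identifies the common value.\<close>

lemma bil_zero_imp:
  assumes "bil c c = 0" shows "c k = c i0 * a k"
proof -
  have z: "w k l * (c k / a k - c l / a l)\<^sup>2 = 0" for k l
    using assms w_nonneg unfolding bil_square by (simp add: sum_nonneg_eq_0_iff sum_nonneg)
  have "{k. c k / a k = c i0 / a i0} = UNIV"
  proof (rule indecomposable_closed_eq_UNIV[OF gcm indec])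
    fix j k assume "j \<in> {k. c k / a k = c i0 / a i0}" "A j k \<noteq> 0"
    then show "k \<in> {k. c k / a k = c i0 / a i0}"
      using z[of j k] w_nonzero_iff[of j k] by (cases "j = k") auto
  qed auto
  then have "c k / a k = c i0 / a i0" by blast
  then have "real_of_int (c k) = real_of_int (c i0 * a k)"
    using a_pos[of k] a_i0 by (simp add: field_simps)
  then show ?thesis by linarith
qed

section \<open>Real roots: norms, integrality of coroots, signs\<close>

lemma fin_refl_alt: "fin_refl A j \<beta> = (\<lambda>k. \<beta> k - (\<Sum>l\<in>UNIV. A j l * \<beta> l) * unit_vec j k)"
  by (simp add: fin_refl_def mult.commute)

lemma A_fin_refl: "(\<Sum>l\<in>UNIV. A i l * fin_refl A j \<beta> l)
    = (\<Sum>l\<in>UNIV. A i l * \<beta> l) - (\<Sum>l\<in>UNIV. A j l * \<beta> l) * A i j"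
proof -
  have "(\<Sum>l\<in>UNIV. A i l * fin_refl A j \<beta> l)
     = (\<Sum>l\<in>UNIV. A i l * \<beta> l) - (\<Sum>l\<in>UNIV. (\<Sum>l\<in>UNIV. A j l * \<beta> l) * (A i l * unit_vec j l))"
    by (simp add: fin_refl_alt algebra_simps sum_subtractf)
  then show ?thesis by (simp add: sum_distrib_left[symmetric])
qed

lemma fin_refl_invol [simp]: "fin_refl A j (fin_refl A j \<beta>) = \<beta>"
  using A_fin_refl[of j j \<beta>] unfolding fin_refl_alt[of j "fin_refl A j \<beta>"]
  by (auto simp: fin_refl_alt algebra_simps)

lemma bil_fin_refl: "bil (fin_refl A j c) (fin_refl A j c) = bil c c"
proof -
  let ?p = "\<Sum>l\<in>UNIV. A j l * c l"
  have b: "bil (unit_vec j) c = d j * ?p" by (rule bil_unit_left)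
  have "bil c (unit_vec j) = d j * ?p" using b bil_sym by metis
  then show ?thesis unfolding fin_refl_alt bil_diff_left bil_diff_right bil_scale_left bil_scale_right
    using b by (simp add: algebra_simps)
qed

text \<open>Here \<open>fin_refl\<close> is applied with every index, \<open>i0\<close> included, so
  these are the real roots of the affine algebra in simple-root coordinates.\<close>

definition re_root :: "'i list \<Rightarrow> 'i \<Rightarrow> 'i \<Rightarrow> int" where
  "re_root ws j = foldr (fin_refl A) ws (unit_vec j)"

lemma root_Nil [simp]: "re_root [] j = unit_vec j"
  and root_Cons [simp]: "re_root (i # ws) j = fin_refl A i (re_root ws j)"
  by (simp_all add: re_root_def)

lemma bil_root [simp]: "bil (re_root ws j) (re_root ws j) = 2 * d j"
  by (induction ws) (simp_all add: bil_fin_refl)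

text \<open>The coordinates of the coroot of \<open>re_root ws j\<close>; that they are integers replaces the
  case distinction by root lengths.\<close>

lemma root_coroot_int: "d k * re_root ws j k / d j \<in> \<int>"
proof (induction ws arbitrary: k)
  case Nil
  show ?case using d_pos[of j] by (auto simp: unit_vec_def)
next
  case (Cons i ws)
  have "d i * (\<Sum>l\<in>UNIV. A i l * re_root ws j l) / d j = (\<Sum>l\<in>UNIV. A l i * (d l * re_root ws j l / d j))"
    unfolding of_int_sum sum_distrib_left sum_divide_distrib
  proof (rule sum.cong[OF HOL.refl])
    fix l
    have "d i * real_of_int (A i l * re_root ws j l) / d j = (d i * A i l) * re_root ws j l / d j" by simp
    also have "\<dots> = A l i * (d l * re_root ws j l / d j)" by (simp only: d_sym[of i l]) simp
    finally show "d i * real_of_int (A i l * re_root ws j l) / d j = A l i * (d l * re_root ws j l / d j)" .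
  qed
  also have "\<dots> \<in> \<int>" using Cons by (intro Ints_sum Ints_mult) auto
  finally have i: "d i * (\<Sum>l\<in>UNIV. A i l * re_root ws j l) / d j \<in> \<int>" .
  have "d k * re_root (i # ws) j k / d j = d k * re_root ws j k / d j
     - (if k = i then d i * (\<Sum>l\<in>UNIV. A i l * re_root ws j l) / d j else 0)"
    by (auto simp: fin_refl_alt unit_vec_def algebra_simps diff_divide_distrib)
  then show ?case using Cons i by auto
qed

text \<open>In terms of the integers \<open>e k = d k * c k / d j\<close> the norm is
  \<open>d j\<close> times the sum of the symmetric integer matrix \<open>e k * A k l * c l\<close>.
  Its diagonal is even and its other entries pair up, so the sum is even.\<close>

lemma bil_even_of_coroot_int:
  assumes "\<And>k. d k * c k / d j \<in> \<int>"
  shows "\<exists>n::int. bil c c = 2 * d j * n"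
proof -
  have "\<forall>k. \<exists>n::int. d k * c k / d j = n" using assms by (meson Ints_cases)
  then obtain e :: "'i \<Rightarrow> int" where e: "\<And>k. d k * c k / d j = e k" by metis
  then have e': "d k * c k = d j * e k" for k using d_pos[of j] by (simp add: field_simps)
  have sym: "e k * A k l * c l = e l * A l k * c k" for k l
  proof -
    have "d j * real_of_int (e k * A k l * c l) = (d k * c k) * A k l * c l" by (simp add: e')
    also have "\<dots> = (d l * c l) * A l k * c k" using d_sym[of k l] by (simp add: algebra_simps)
    also have "\<dots> = d j * real_of_int (e l * A l k * c k)" by (simp add: e')
    finally have "real_of_int (e k * A k l * c l) = real_of_int (e l * A l k * c k)"
      using d_pos[of j] by (metis mult_cancel_left order_less_irrefl)
    then show ?thesis by linarith
  qed
  have "even (\<Sum>k\<in>UNIV. \<Sum>l\<in>UNIV. e k * A k l * c l)"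
    by (rule sum_symmetric_even) (use sym in auto)
  then obtain n where n: "(\<Sum>k\<in>UNIV. \<Sum>l\<in>UNIV. e k * A k l * c l) = 2 * n" by (auto elim: evenE)
  have "d k * A k l * c k * c l = d j * real_of_int (e k * A k l * c l)" for k l
  proof -
    have "d k * A k l * c k * c l = (d k * c k) * (A k l * c l)" by simp
    then show ?thesis unfolding e' by simp
  qed
  then have "bil c c = d j * (\<Sum>k\<in>UNIV. \<Sum>l\<in>UNIV. e k * A k l * c l)"
    unfolding bil_def of_int_sum sum_distrib_left by (intro sum.cong HOL.refl)
  then show ?thesis using n by (auto intro!: exI[of _ n])
qed

text \<open>Were both the positive part \<open>P\<close> and the negative part \<open>N\<close> non-isotropic, their norms, each at
  least \<open>2 d\<^sub>j\<close>, would add up to at most the norm \<open>2 d\<^sub>j\<close> of the root.\<close>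

lemma root_sign_coherent: "(\<forall>k. re_root ws j k \<ge> 0) \<or> (\<forall>k. re_root ws j k \<le> 0)"
proof -
  define P N where "P k = max 0 (re_root ws j k)" and "N k = max 0 (- re_root ws j k)" for k
  have int: "d k * P k / d j \<in> \<int>" "d k * N k / d j \<in> \<int>" for k
    using root_coroot_int[of k ws j] by (auto simp: P_def N_def max_def)
  have pn: "bil P N \<le> 0"
  proof -
    have "d k * A k l * P k * N l \<le> 0" for k l
    proof (cases "k = l")
      case True then show ?thesis by (auto simp: P_def N_def max_def)
    next
      case False
      have "d k * A k l \<le> 0" using d_pos[of k] A_nonpos[OF False] by (simp add: mult_nonneg_nonpos)
      moreover have "0 \<le> real_of_int (P k)" "0 \<le> real_of_int (N l)" by (auto simp: P_def N_def)
      ultimately show ?thesis by (simp add: mult_nonpos_nonneg)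
    qed
    then show ?thesis unfolding bil_def by (intro sum_nonpos)
  qed
  have "re_root ws j = (\<lambda>k. P k - N k)" by (auto simp: P_def N_def)
  then have "2 * d j = bil P P + bil N N - 2 * bil P N"
    using bil_root[of ws j] bil_sym[of N P] by (simp only: bil_diff_left bil_diff_right)
  then have le: "bil P P + bil N N \<le> 2 * d j" using pn by simp
  have pos: "bil c c \<ge> 2 * d j" if int: "\<And>k. d k * c k / d j \<in> \<int>" and nz: "bil c c \<noteq> 0" for c
  proof -
    obtain n :: int where n: "bil c c = 2 * d j * n" using bil_even_of_coroot_int[of c j] int by auto
    then have "n > 0" using bil_nonneg[of c] nz d_pos[of j]
      by (smt (verit) mult_eq_0_iff mult_nonneg_nonpos of_int_0_le_iff of_int_le_0_iff zero_less_mult_pos of_int_0_less_iff)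
    then have "2 * d j * 1 \<le> 2 * d j * n" using d_pos[of j] by (intro mult_left_mono) auto
    then show ?thesis using n by simp
  qed
  consider "bil P P = 0" | "bil N N = 0" using pos[of P] pos[of N] int le d_pos[of j] by fastforce
  then show ?thesis
  proof cases
    case 1
    \<comment> \<open>An isotropic part is a multiple of \<open>a\<close>: either zero, so that the
      root has only its other part, or positive in every coordinate, so that this part is the whole
      root.\<close>
    note P = bil_zero_imp[OF 1]
    show ?thesis
    proof (cases "P i0 = 0")
      case True
      then have "P k = 0" for k using P[of k] by simp
      then show ?thesis unfolding P_def by (metis max.absorb_iff1)
    next
      case False
      then have "P i0 > 0" by (simp add: P_def)
      then have "P k > 0" for k using P[of k] a_pos[of k] by simp
      then show ?thesis unfolding P_def by (metis less_max_iff_disj less_imp_le less_irrefl)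
    qed
  next
    case 2
    note P = bil_zero_imp[OF 2]
    show ?thesis
    proof (cases "N i0 = 0")
      case True
      then have "N k = 0" for k using P[of k] by simp
      then show ?thesis unfolding N_def by (metis max.absorb_iff1 neg_le_0_iff_le)
    next
      case False
      then have "N i0 > 0" by (simp add: N_def)
      then have "N k > 0" for k using P[of k] a_pos[of k] by simp
      then show ?thesis unfolding N_def by (metis less_max_iff_disj less_imp_le less_irrefl neg_0_less_iff_less)
    qed
  qed
qed

lemma root_nonzero: "\<exists>k. re_root ws j k \<noteq> 0"
proof (rule ccontr)
  assume "\<nexists>k. re_root ws j k \<noteq> 0"
  then have "bil (re_root ws j) (re_root ws j) = 0" by (simp add: bil_def)
  then show False using d_pos[of j] by simp
qed

text \<open>Comparing norms gives \<open>d i = n * n * d j\<close>, so the coroot has coordinate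
  \<open>1 / n\<close> at \<open>j\<close>; its integrality leaves only a unit.\<close>

lemma root_multiple_simple:
  assumes "re_root ws i = (\<lambda>k. n * unit_vec j k)" "n \<ge> 0"
  shows "n = 1"
proof -
  have "2 * d i = n * (n * (2 * d j))"
    using bil_root[of ws i] unfolding assms(1) bil_scale_left bil_scale_right by simp
  then have di: "d i = n * n * d j" by simp
  have "n \<noteq> 0" using di d_pos[of i] by auto
  have "d j * n / d i \<in> \<int>" using root_coroot_int[of j ws i] by (simp add: assms(1) unit_vec_def)
  moreover have "d j * n / d i = 1 / n" unfolding di using \<open>n \<noteq> 0\<close> d_pos[of j] by (simp add: field_simps)
  ultimately obtain k :: int where "1 / real_of_int n = k" by (metis Ints_cases)
  then have "real_of_int (n * k) = real_of_int 1" using \<open>n \<noteq> 0\<close> by (simp add: field_simps)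
  then have "n * k = 1" by linarith
  then show ?thesis using assms(2) by (simp add: zmult_eq_1_iff)
qed

text \<open>A positive root other than \<alpha>_j has a positive coordinate away from
  \<open>j\<close>, since it is no multiple of \<alpha>_j. The reflection leaves that coordinate
  alone, and sign coherence does the rest.\<close>

lemma pos_root_refl:
  assumes "\<And>k. re_root ws i k \<ge> 0" "re_root ws i \<noteq> unit_vec j"
  shows "fin_refl A j (re_root ws i) k \<ge> 0"
proof -
  have "\<exists>l. l \<noteq> j \<and> re_root ws i l > 0"
  proof (rule ccontr)
    assume "\<nexists>l. l \<noteq> j \<and> re_root ws i l > 0"
    then have "re_root ws i = (\<lambda>k. re_root ws i j * unit_vec j k)"
      using assms(1) by (intro ext) (auto simp: unit_vec_def, meson dual_order.antisym not_le_imp_less)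
    then show False using root_multiple_simple[of ws i "re_root ws i j" j] assms by auto
  qed
  then obtain l where "l \<noteq> j" "re_root ws i l > 0" by blast
  then have "re_root (j # ws) i l > 0" by (simp add: fin_refl_alt unit_vec_def)
  then show ?thesis using root_sign_coherent[of "j # ws" i] by (metis root_Cons not_le)
qed

end

section \<open>The Bruhat-type order on weights\<close>

context affine
begin

section \<open>Weights, coroot pairings and conjugation of reflection steps\<close>

abbreviation "sr \<equiv> sref A i0"
abbreviation "rstep \<equiv> refl_step A i0"

text \<open>Translation by a root-lattice element. The second component keeps it faithful: the
  kernel of \<open>A\<close> is spanned by \<open>a\<close>, that is by \<delta>, and only the
  \<delta>-coordinate sees it.\<close>

definition tr :: "'i wt \<Rightarrow> ('i \<Rightarrow> int) \<Rightarrow> 'i wt" where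
  "tr \<mu> c = ((\<lambda>i. fst \<mu> i + (\<Sum>j\<in>UNIV. A i j * c j)), snd \<mu> + c i0)"

lemma fst_tr: "fst (tr \<mu> c) i = fst \<mu> i + (\<Sum>j\<in>UNIV. A i j * c j)"
  by (simp add: tr_def)

lemma tr_tr: "tr (tr \<mu> c) c' = tr \<mu> (\<lambda>k. c k + c' k)"
  by (auto simp: tr_def sum.distrib algebra_simps)

lemma tr_zero [simp]: "tr \<mu> (\<lambda>k. 0) = \<mu>"
  by (auto simp: tr_def)

lemma kernel_A: assumes "\<And>i. (\<Sum>j\<in>UNIV. A i j * c j) = 0" shows "c k = c i0 * a k"
  by (rule bil_zero_imp) (simp add: bil_eq_pairing assms)

lemma tr_inject [simp]: "tr \<mu> c = tr \<mu> c' \<longleftrightarrow> c = c'"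
proof
  assume eq: "tr \<mu> c = tr \<mu> c'"
  then have 0: "c i0 = c' i0" by (simp add: tr_def)
  have "(\<Sum>j\<in>UNIV. A i j * (c j - c' j)) = 0" for i
    using fst_tr[of \<mu> c i] fst_tr[of \<mu> c' i] eq by (simp add: algebra_simps sum_subtractf)
  then have "c k - c' k = (c i0 - c' i0) * a k" for k by (rule kernel_A[of "\<lambda>k. c k - c' k"])
  then show "c = c'" using 0 by auto
qed simp

lemma sr_eq_tr: "sr j \<mu> = tr \<mu> (\<lambda>k. - fst \<mu> j * unit_vec j k)"
proof -
  have "(\<Sum>l\<in>UNIV. A i l * (- fst \<mu> j * unit_vec j l)) = - fst \<mu> j * A i j" for i
  proof -
    have "(\<Sum>l\<in>UNIV. A i l * (- fst \<mu> j * unit_vec j l)) = (\<Sum>l\<in>UNIV. (A i l * - fst \<mu> j) * unit_vec j l)"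
      by (simp only: mult.assoc)
    then show ?thesis unfolding sum_unit_vec by simp
  qed
  then show ?thesis by (auto simp: sref_def tr_def Let_def unit_vec_def)
qed

lemma fst_sr: "fst (sr j \<mu>) i = fst \<mu> i - fst \<mu> j * A i j"
  by (simp add: sref_def Let_def)

lemma fst_sr_same [simp]: "fst (sr j \<mu>) j = - fst \<mu> j"
  by (simp add: fst_sr)

lemma sr_sr [simp]: "sr j (sr j \<mu>) = \<mu>"
  by (auto simp: sref_def Let_def)

lemma sr_fixed: "fst \<mu> j = 0 \<Longrightarrow> sr j \<mu> = \<mu>"
  by (simp add: sref_def Let_def)

lemma sr_tr: "sr j (tr \<mu> c) = tr (sr j \<mu>) (fin_refl A j c)"
  unfolding sr_eq_tr tr_tr tr_inject by (auto simp: fst_tr fin_refl_alt algebra_simps)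

lemma wact_Nil [simp]: "wact A i0 [] \<mu> = \<mu>"
  and wact_Cons [simp]: "wact A i0 (j # ws) \<mu> = sr j (wact A i0 ws \<mu>)"
  and wact_append: "wact A i0 (ws @ ws') \<mu> = wact A i0 ws (wact A i0 ws' \<mu>)"
  by (simp_all add: wact_def)

lemma wact_rev [simp]: "wact A i0 ws (wact A i0 (rev ws) \<mu>) = \<mu>" "wact A i0 (rev ws) (wact A i0 ws \<mu>) = \<mu>"
  unfolding wact_def by (rule foldr_inverse, simp)+

lemma wact_tr: "wact A i0 ws (tr \<mu> c) = tr (wact A i0 ws \<mu>) (foldr (fin_refl A) ws c)"
  by (induction ws) (simp_all add: sr_tr)

lemma foldr_fin_refl_scale: "foldr (fin_refl A) ws (\<lambda>k. n * c k) = (\<lambda>k. n * foldr (fin_refl A) ws c k)"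
  by (induction ws) (auto simp: fin_refl_def sum_distrib_left algebra_simps)

lemma wact_sroot: "wact A i0 ws (sroot A i0 j) = tr ((\<lambda>i. 0), 0) (re_root ws j)"
proof -
  have "sroot A i0 j = tr ((\<lambda>i. 0), 0) (unit_vec j)"
    by (auto simp: sroot_def tr_def unit_vec_def if_distrib[of "\<lambda>x. _ * x"] cong: if_cong)
  moreover have "wact A i0 ws ((\<lambda>i. 0), 0) = ((\<lambda>i. 0), 0)"
    by (induction ws) (auto simp: sr_fixed)
  ultimately show ?thesis by (simp add: wact_tr re_root_def)
qed

lemma pos_root_iff: "pos_root A i0 (tr ((\<lambda>i. 0), 0) c) \<longleftrightarrow> (\<forall>k. c k \<ge> 0)"
proof
  assume "pos_root A i0 (tr ((\<lambda>i. 0), 0) c)"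
  then obtain e :: "'i \<Rightarrow> nat" where "tr ((\<lambda>i. 0), 0) c = tr ((\<lambda>i. 0), 0) (\<lambda>k. int (e k))"
    unfolding pos_root_def by (auto simp: tr_def mult.commute)
  then show "\<forall>k. c k \<ge> 0" by simp
next
  assume "\<forall>k. c k \<ge> 0"
  then show "pos_root A i0 (tr ((\<lambda>i. 0), 0) c)"
    unfolding pos_root_def by (intro exI[of _ "\<lambda>k. nat (c k)"]) (auto simp: tr_def mult.commute)
qed

text \<open>The coroot of \<open>re_root ws i\<close> has the coordinates
  \<open>d k * re_root ws i k / d i\<close>. As \<open>d i\<close> is half the norm of the root, the
  pairing depends on the root alone and not on the word and index that represent it.\<close>

lemma root_pairing:
  "d i * fst (wact A i0 (rev ws) \<mu>) i = (\<Sum>k\<in>UNIV. d k * re_root ws i k * fst \<mu> k)"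
proof (induction ws arbitrary: \<mu>)
  case Nil
  have "d i * fst \<mu> i = (\<Sum>k\<in>UNIV. if k = i then d i * fst \<mu> i else 0)" by simp
  also have "\<dots> = (\<Sum>k\<in>UNIV. d k * unit_vec i k * fst \<mu> k)"
    by (rule sum.cong) (auto simp: unit_vec_def)
  finally show ?case by simp
next
  case (Cons j ws)
  let ?c = "re_root ws i"
  have col: "(\<Sum>k\<in>UNIV. d k * ?c k * A k j) = d j * (\<Sum>k\<in>UNIV. A j k * ?c k)"
    by (simp add: sum_distrib_left) (intro sum.cong HOL.refl, use d_sym in \<open>simp add: algebra_simps\<close>)
  have unit: "(\<Sum>k\<in>UNIV. d k * (n * unit_vec j k) * fst \<mu> k) = d j * n * fst \<mu> j" for n :: int
  proof -
    have "(\<Sum>k\<in>UNIV. d k * (n * unit_vec j k) * fst \<mu> k) = (\<Sum>k\<in>UNIV. if k = j then d j * n * fst \<mu> j else 0)"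
      by (rule sum.cong) (auto simp: unit_vec_def)
    then show ?thesis by simp
  qed
  have "(\<Sum>k\<in>UNIV. d k * fin_refl A j ?c k * fst \<mu> k) = (\<Sum>k\<in>UNIV. d k * ?c k * fst \<mu> k)
      - (\<Sum>k\<in>UNIV. d k * ((\<Sum>l\<in>UNIV. A j l * ?c l) * unit_vec j k) * fst \<mu> k)"
    by (simp add: fin_refl_alt algebra_simps sum_subtractf)
  moreover have "(\<Sum>k\<in>UNIV. d k * ?c k * fst (sr j \<mu>) k) = (\<Sum>k\<in>UNIV. d k * ?c k * fst \<mu> k)
      - fst \<mu> j * (\<Sum>k\<in>UNIV. d k * ?c k * A k j)"
    by (simp add: fst_sr algebra_simps sum_subtractf sum_distrib_left)
  ultimately show ?case
    using Cons[of "sr j \<mu>"] unit[of "\<Sum>l\<in>UNIV. A j l * ?c l"] col by (simp add: wact_append)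
qed

lemma wact_refl: "wact A i0 ws (sr j (wact A i0 (rev ws) \<mu>))
    = tr \<mu> (\<lambda>k. - fst (wact A i0 (rev ws) \<mu>) j * re_root ws j k)"
  by (simp add: sr_eq_tr wact_tr foldr_fin_refl_scale re_root_def del: mult_minus_left)

lemma refl_data_iff:
  "refl_data A i0 \<mu> \<nu> p \<longleftrightarrow> (\<exists>ws j. (\<forall>k. re_root ws j k \<ge> 0) \<and>
     p = fst (wact A i0 (rev ws) \<mu>) j \<and> \<nu> = tr \<mu> (\<lambda>k. - p * re_root ws j k))"
  unfolding refl_data_def wact_sroot pos_root_iff wact_refl by metis

lemma refl_data_simple: "refl_data A i0 \<mu> (sr j \<mu>) (fst \<mu> j)"
  unfolding refl_data_iff
  by (rule exI[of _ "[]"], rule exI[of _ j]) (simp add: sr_eq_tr unit_vec_def)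

text \<open>Conjugation by \<open>r_j\<close> keeps the root positive unless it is \<alpha>_j
  itself. In that exceptional case \<open>root_pairing\<close> identifies \<open>p\<close>.\<close>

lemma refl_data_conj:
  assumes "refl_data A i0 \<mu> \<nu> p"
  shows "(p = fst \<mu> j \<and> \<nu> = sr j \<mu>) \<or> refl_data A i0 (sr j \<mu>) (sr j \<nu>) p"
proof -
  obtain ws i where pos: "\<And>k. re_root ws i k \<ge> 0" and p: "p = fst (wact A i0 (rev ws) \<mu>) i"
    and \<nu>: "\<nu> = tr \<mu> (\<lambda>k. - p * re_root ws i k)"
    using assms unfolding refl_data_iff by blast
  show ?thesis
  proof (cases "re_root ws i = unit_vec j")
    case True
    have "d i = d j" using bil_root[of ws i] True by simp
    moreover have "d i * p = d j * fst \<mu> j"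
      using root_pairing[of i ws \<mu>] root_pairing[of j "[]" \<mu>] True p by simp
    ultimately have "real_of_int p = fst \<mu> j" using d_pos[of j] by simp
    then have "p = fst \<mu> j" by linarith
    then show ?thesis using \<nu> True by (simp add: sr_eq_tr)
  next
    case False
    have "sr j \<nu> = tr (sr j \<mu>) (\<lambda>k. - p * re_root (j # ws) i k)"
      using foldr_fin_refl_scale[of "[j]" "-p"] by (simp add: \<nu> sr_tr)
    moreover have "p = fst (wact A i0 (rev (j # ws)) (sr j \<mu>)) i" by (simp add: p wact_append)
    moreover have "\<forall>k. re_root (j # ws) i k \<ge> 0" using pos_root_refl[OF pos False] by simp
    ultimately show ?thesis unfolding refl_data_iff by blast
  qed
qed

lemma rstep_simple:
  assumes "fst \<mu> j < 0" shows "rstep \<mu> (sr j \<mu>)"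
  unfolding refl_step_def using assms refl_data_simple[of \<mu> j] by (intro exI[of _ "fst \<mu> j"] conjI)

lemma rstep_simple':
  assumes "fst \<mu> j > 0" shows "rstep (sr j \<mu>) \<mu>"
proof -
  have "rstep (sr j \<mu>) (sr j (sr j \<mu>))" by (rule rstep_simple) (simp add: assms)
  then show ?thesis by (simp only: sr_sr)
qed

lemma rstep_conj:
  assumes "rstep \<mu> \<nu>" shows "(fst \<mu> j < 0 \<and> \<nu> = sr j \<mu>) \<or> rstep (sr j \<mu>) (sr j \<nu>)"
proof -
  obtain p where p: "p < 0" "refl_data A i0 \<mu> \<nu> p" using assms unfolding refl_step_def by (elim exE conjE)
  from refl_data_conj[OF p(2), of j] show ?thesis
  proof
    assume "p = fst \<mu> j \<and> \<nu> = sr j \<mu>"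
    with p(1) show ?thesis by simp
  next
    assume "refl_data A i0 (sr j \<mu>) (sr j \<nu>) p"
    with p(1) have "rstep (sr j \<mu>) (sr j \<nu>)" unfolding refl_step_def by (intro exI[of _ p] conjI)
    then show ?thesis ..
  qed
qed

text \<open>As \<open>p < 0\<close>, a step adds a positive multiple of a positive root, so heights
  strictly increase. This excludes cycles although the orbit may be infinite.\<close>

lemma rstep_tr:
  assumes "rstep \<mu> \<nu>"
  shows "\<exists>q. (\<forall>k. q k \<ge> 0) \<and> (\<Sum>k\<in>UNIV. q k) \<ge> 1 \<and> \<nu> = tr \<mu> q"
proof -
  obtain p ws i where pos: "\<And>k. re_root ws i k \<ge> 0" and p: "p < 0"
    and \<nu>: "\<nu> = tr \<mu> (\<lambda>k. - p * re_root ws i k)"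
    using assms unfolding refl_step_def refl_data_iff by blast
  let ?q = "\<lambda>k. - p * re_root ws i k"
  have nn: "?q k \<ge> 0" for k using pos[of k] p by (simp add: mult_nonpos_nonneg)
  obtain k where "re_root ws i k \<noteq> 0" using root_nonzero by blast
  then have "?q k \<noteq> 0" using p by simp
  then have "?q k > 0" using nn[of k] by linarith
  then have "(\<Sum>k\<in>UNIV. ?q k) > 0" using nn by (intro sum_pos2[of UNIV k]) auto
  then show ?thesis using nn \<nu> by (intro exI[of _ ?q]) auto
qed

lemma relpow_rstep_tr:
  assumes "(rstep ^^ n) \<mu> \<nu>"
  shows "\<exists>q. (\<forall>k. q k \<ge> 0) \<and> (\<Sum>k\<in>UNIV. q k) \<ge> int n \<and> \<nu> = tr \<mu> q"
  using assms
proof (induction n arbitrary: \<nu>)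
  case 0 then show ?case by (intro exI[of _ "\<lambda>_. 0"]) simp
next
  case (Suc n)
  then obtain \<kappa> where "(rstep ^^ n) \<mu> \<kappa>" and s: "rstep \<kappa> \<nu>" by auto
  from Suc.IH[OF this(1)] obtain q where q: "\<forall>k. q k \<ge> 0" "(\<Sum>k\<in>UNIV. q k) \<ge> int n" "\<kappa> = tr \<mu> q" by blast
  obtain q' where q': "\<forall>k. q' k \<ge> 0" "(\<Sum>k\<in>UNIV. q' k) \<ge> 1" "\<nu> = tr \<kappa> q'" using rstep_tr[OF s] by blast
  show ?case using q q' by (intro exI[of _ "\<lambda>k. q k + q' k"]) (auto simp: tr_tr sum.distrib)
qed

lemma relpow_rstep_refl: "(rstep ^^ n) \<mu> \<mu> \<Longrightarrow> n = 0"
proof -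
  assume "(rstep ^^ n) \<mu> \<mu>"
  then obtain q where q: "(\<Sum>k\<in>UNIV. q k) \<ge> int n" "\<mu> = tr \<mu> q" using relpow_rstep_tr by metis
  then have "tr \<mu> (\<lambda>_. 0) = tr \<mu> q" by simp
  then have "q = (\<lambda>_. 0)" unfolding tr_inject by simp
  then show "n = 0" using q(1) by simp
qed

lemma rstep_acyclic: "\<not> rstep\<^sup>+\<^sup>+ \<mu> \<mu>"
proof
  assume "rstep\<^sup>+\<^sup>+ \<mu> \<mu>"
  then obtain n where "n > 0" "(rstep ^^ n) \<mu> \<mu>" unfolding tranclp_power by blast
  then show False using relpow_rstep_refl[of n \<mu>] by simp
qed

lemma rstep_antisym: "rstep\<^sup>*\<^sup>* \<mu> \<nu> \<Longrightarrow> rstep\<^sup>*\<^sup>* \<nu> \<mu> \<Longrightarrow> \<mu> = \<nu>"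
  using rstep_acyclic by (metis rtranclpD rtranclp_tranclp_tranclp)

text \<open>The smaller and the larger of a weight and its image under \<open>r_j\<close>: a simple
  step leads from negative to positive pairing.\<close>

definition dn :: "'i \<Rightarrow> 'i wt \<Rightarrow> 'i wt" where "dn j \<mu> = (if fst \<mu> j < 0 then sr j \<mu> else \<mu>)"
definition up :: "'i \<Rightarrow> 'i wt \<Rightarrow> 'i wt" where "up j \<mu> = (if fst \<mu> j > 0 then sr j \<mu> else \<mu>)"

text \<open>Littelmann's comparison of chains from \<open>x\<close> to \<open>y\<close> with chains between their images under
  \<open>r\<^sub>j\<close>: a reflection step other than \<open>r\<^sub>j\<close> itself can be conjugated by \<open>r\<^sub>j\<close>.\<close>

lemma rstep_dn:
  assumes "rstep x y"
  shows "\<exists>m. (rstep ^^ m) (dn j x) (dn j y) \<and>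
     int m \<ge> 1 - of_bool (fst x j < 0) + of_bool (fst y j < 0)"
proof -
  have two: "(rstep ^^ 2) p r" if "rstep p q" "rstep q r" for p q r
    using that by (auto simp: numeral_2_eq_2)
  have one: "(rstep ^^ 1) p r" if "rstep p r" for p r using that by (metis relpowp_1)
  consider (s) "fst x j < 0" "y = sr j x" | (c) "rstep (sr j x) (sr j y)" using rstep_conj[OF assms] by blast
  then show ?thesis
  proof cases
    case s
    then show ?thesis by (intro exI[of _ 0]) (simp add: dn_def)
  next
    case c
    consider "fst x j < 0" "fst y j \<le> 0" | "fst x j < 0" "fst y j > 0"
      | "fst x j \<ge> 0" "fst y j < 0" | "fst x j \<ge> 0" "fst y j \<ge> 0" by linarith
    then show ?thesis
    proof cases
      case 1
      then show ?thesis using one[OF c] sr_fixed[of y j] by (intro exI[of _ 1]) (auto simp: dn_def)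
    next
      case 2
      then show ?thesis using two[OF c rstep_simple'] by (intro exI[of _ 2]) (simp add: dn_def)
    next
      case 3
      then show ?thesis using two[OF assms rstep_simple] by (intro exI[of _ 2]) (simp add: dn_def)
    next
      case 4
      then show ?thesis using one[OF assms] by (intro exI[of _ 1]) (simp add: dn_def)
    qed
  qed
qed

text \<open>The corrections in \<open>rstep_dn\<close> telescope, so the loss of length depends only
  on the signs at the two ends. This precision is what controls \<open>dist_one\<close>.\<close>

lemma relpow_dn:
  assumes "(rstep ^^ n) x y"
  shows "\<exists>m. (rstep ^^ m) (dn j x) (dn j y) \<and>
     int m \<ge> int n - of_bool (fst x j < 0) + of_bool (fst y j < 0)"
  using assms
proof (induction n arbitrary: y)
  case 0 then show ?case by (intro exI[of _ 0]) simp
next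
  case (Suc n)
  then obtain z where z: "(rstep ^^ n) x z" "rstep z y" by auto
  obtain m where m: "(rstep ^^ m) (dn j x) (dn j z)"
     "int m \<ge> int n - of_bool (fst x j < 0) + of_bool (fst z j < 0)" using Suc.IH[OF z(1)] by blast
  obtain m' where m': "(rstep ^^ m') (dn j z) (dn j y)"
     "int m' \<ge> 1 - of_bool (fst z j < 0) + of_bool (fst y j < 0)" using rstep_dn[OF z(2)] by blast
  have "(rstep ^^ (m + m')) (dn j x) (dn j y)" using m(1) m'(1) by (auto simp: relpowp_add)
  then show ?case using m(2) m'(2) by (intro exI[of _ "m + m'"]) auto
qed

lemma rtranclp_dn: "rstep\<^sup>*\<^sup>* x y \<Longrightarrow> rstep\<^sup>*\<^sup>* (dn j x) (dn j y)"
  using relpow_dn by (metis rtranclp_power)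

lemma rstep_up:
  assumes "rstep x y" shows "rstep\<^sup>*\<^sup>* (up j x) (up j y)"
proof -
  consider (s) "fst x j < 0" "y = sr j x" | (c) "rstep (sr j x) (sr j y)" using rstep_conj[OF assms] by blast
  then show ?thesis
  proof cases
    case s
    then show ?thesis by (simp add: up_def)
  next
    case c
    consider "fst x j > 0" "fst y j > 0" | "fst x j > 0" "fst y j \<le> 0"
      | "fst x j < 0" "fst y j > 0" | "fst x j = 0" "fst y j > 0" | "fst x j \<le> 0" "fst y j \<le> 0" by linarith
    then show ?thesis
    proof cases
      case 1 then show ?thesis using c by (simp add: up_def)
    next
      case 2 then show ?thesis using rstep_simple'[of x j] assms
        by (simp add: up_def converse_rtranclp_into_rtranclp)
    next
      case 3 then show ?thesis using rstep_simple[of x j] c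
        by (simp add: up_def converse_rtranclp_into_rtranclp)
    next
      case 4 then show ?thesis using c sr_fixed[of x j] by (simp add: up_def r_into_rtranclp)
    next
      case 5 then show ?thesis using assms by (simp add: up_def)
    qed
  qed
qed

lemma rtranclp_up: "rstep\<^sup>*\<^sup>* x y \<Longrightarrow> rstep\<^sup>*\<^sup>* (up j x) (up j y)"
  by (induction rule: rtranclp_induct) (auto intro: rstep_up rtranclp_trans)

text \<open>Lowering a chain of length \<open>n\<close> from \<open>x\<close> to
  \<open>r_j x\<close> gives a closed chain at \<open>r_j x\<close> of length at least
  \<open>n - 1\<close>, which must be empty.\<close>

lemma dist_one_simple:
  assumes "fst x j < 0" shows "dist_one A i0 x (sr j x)"
  unfolding dist_one_def
proof (intro conjI allI impI)
  show "rstep x (sr j x)" using assms by (rule rstep_simple)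
  fix n assume "(rstep ^^ n) x (sr j x)"
  then obtain m where "(rstep ^^ m) (sr j x) (sr j x)" "int m \<ge> int n - 1"
    using relpow_dn[of n x "sr j x" j] assms by (auto simp: dn_def)
  then show "n \<le> 1" using relpow_rstep_refl[of m "sr j x"] by simp
qed

text \<open>Any chain between the reflected weights is lowered back to one from \<open>x\<close> to
  \<open>y\<close>. Both ends are negative there, so the two corrections cancel and no length is
  lost.\<close>

lemma dist_one_conj:
  assumes "dist_one A i0 x y" "fst x j > 0" "fst y j > 0"
  shows "dist_one A i0 (sr j x) (sr j y)"
  unfolding dist_one_def
proof (intro conjI allI impI)
  show "rstep (sr j x) (sr j y)" using rstep_conj[of x y j] assms by (auto simp: dist_one_def)
  fix n assume "(rstep ^^ n) (sr j x) (sr j y)"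
  then obtain m where "(rstep ^^ m) x y" "int m \<ge> int n"
    using relpow_dn[of n "sr j x" "sr j y" j] assms by (auto simp: dn_def)
  then show "n \<le> 1" using assms(1) unfolding dist_one_def by fastforce
qed

text \<open>If the step were not \<open>r_j\<close> itself, its conjugate would give the detour
  \<open>x\<close>, \<open>r_j x\<close>, \<open>r_j y\<close>, \<open>y\<close>. Even if the first
  step is void because the pairing is zero, this is too long for distance one.\<close>

lemma dist_one_cross:
  assumes "dist_one A i0 x y" "fst x j \<le> 0" "fst y j > 0"
  shows "y = sr j x \<and> fst x j < 0"
proof (rule ccontr)
  assume neg: "\<not> ?thesis"
  have le: "(rstep ^^ n) x y \<Longrightarrow> n \<le> 1" for n using assms(1) by (simp add: dist_one_def)
  have st: "rstep x y" using assms(1) by (simp add: dist_one_def)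
  have c: "rstep (sr j x) (sr j y)" using rstep_conj[OF st, of j] neg by blast
  have l: "rstep (sr j y) y" using assms(3) by (rule rstep_simple')
  show False
  proof (cases "fst x j = 0")
    case True
    then have "(rstep ^^ 2) x y" using c l sr_fixed[of x j] by (auto simp: numeral_2_eq_2)
    then show False using le by fastforce
  next
    case False
    then have "rstep x (sr j x)" using assms(2) by (intro rstep_simple) auto
    then have "(rstep ^^ 3) x y" using c l by (auto simp: numeral_3_eq_3)
    then show False using le by fastforce
  qed
qed

section \<open>Sigma-chains under a simple reflection\<close>

lemma sigma_step_iff:
  "sigma_step A i0 \<sigma> x y \<longleftrightarrow> dist_one A i0 x y \<and>
     (\<exists>p. refl_data A i0 x y p \<and> (\<exists>m::int. m < 0 \<and> \<sigma> * of_int p = of_int m))"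
proof -
  have "wt_gt A i0 x y" if "rstep x y"
    using that rstep_acyclic unfolding wt_gt_def wt_ge_def by blast
  then show ?thesis unfolding sigma_step_def dist_one_def by blast
qed

lemma sigma_step_simple:
  assumes "fst x j < 0" "\<sigma> > 0" "\<sigma> * of_int (fst x j) \<in> \<int>"
  shows "sigma_step A i0 \<sigma> x (sr j x)"
proof -
  obtain m :: int where m: "\<sigma> * of_int (fst x j) = of_int m" using assms(3) by (rule Ints_cases)
  have "\<sigma> * of_int (fst x j) < 0" using assms by (intro mult_pos_neg) auto
  then have "m < 0" using m by simp
  then show ?thesis unfolding sigma_step_iff using dist_one_simple[OF assms(1)] refl_data_simple m by blast
qed

lemma sigma_step_conj:
  assumes "sigma_step A i0 \<sigma> x y" "fst x j > 0" "fst y j > 0"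
  shows "sigma_step A i0 \<sigma> (sr j x) (sr j y)"
proof -
  have "refl_data A i0 (sr j x) (sr j y) p" if "refl_data A i0 x y p" for p
    using refl_data_conj[OF that, of j] assms by auto
  then show ?thesis using assms dist_one_conj unfolding sigma_step_iff by blast
qed

text \<open>The integrality condition of a step speaks of some root that realizes it. Here that root
  is proportional to \<alpha>_j, hence equal to it, so that the condition becomes one on the pairing
  with \<open>j\<close>.\<close>

lemma sigma_step_cross:
  assumes "sigma_step A i0 \<sigma> x y" "fst x j \<le> 0" "fst y j > 0"
  shows "y = sr j x" "fst x j < 0" "\<sigma> * of_int (fst x j) \<in> \<int>"
proof -
  obtain p where p: "refl_data A i0 x y p" "\<sigma> * of_int p \<in> \<int>" and d1: "dist_one A i0 x y"
    using assms(1) unfolding sigma_step_iff by (metis Ints_of_int)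
  show y: "y = sr j x" and x: "fst x j < 0" using dist_one_cross[OF d1 assms(2,3)] by auto
  obtain ws i where \<beta>: "\<And>k. re_root ws i k \<ge> 0" and yp: "y = tr x (\<lambda>k. - p * re_root ws i k)"
    using p(1) unfolding refl_data_iff by blast
  have "(\<lambda>k. p * re_root ws i k) = (\<lambda>k. fst x j * unit_vec j k)"
    using yp unfolding y sr_eq_tr tr_inject by (metis minus_equation_iff mult_minus_left)
  then have eq: "p * re_root ws i k = fst x j * unit_vec j k" for k by meson
  have "p \<noteq> 0" using eq[of j] x by (auto simp: unit_vec_def)
  then have "re_root ws i = (\<lambda>k. re_root ws i j * unit_vec j k)"
    using eq by (intro ext) (metis (no_types, lifting) mult_cancel_left mult.commute mult_1 mult_zero_left unit_vec_def)
  then have "re_root ws i j = 1" using root_multiple_simple \<beta> by blast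
  then have "p = fst x j" using eq[of j] by (simp add: unit_vec_def)
  then show "\<sigma> * of_int (fst x j) \<in> \<int>" using p(2) by simp
qed

text \<open>Each step changes the weight by \<open>p\<close> times an integral vector, and
  \<open>\<sigma> * p\<close> is an integer. Consequently heights of a path modulo integers are not
  affected by its turns.\<close>

lemma sigma_step_diff_int:
  assumes "(sigma_step A i0 \<sigma>)\<^sup>*\<^sup>* x y"
  shows "\<sigma> * of_int (fst x k) - \<sigma> * of_int (fst y k) \<in> \<int>"
  using assms
proof (induction rule: rtranclp_induct)
  case (step y z)
  obtain p :: int and ws i where p: "\<sigma> * of_int p \<in> \<int>" and z: "z = tr y (\<lambda>k. - p * re_root ws i k)"
    using step(2) unfolding sigma_step_iff refl_data_iff by (metis Ints_of_int)
  have "(\<Sum>l\<in>UNIV. A k l * (- p * re_root ws i l)) = - p * (\<Sum>l\<in>UNIV. A k l * re_root ws i l)"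
    unfolding sum_distrib_left by (rule sum.cong) auto
  then have "\<sigma> * of_int (fst y k) - \<sigma> * of_int (fst z k)
     = (\<sigma> * of_int p) * of_int (\<Sum>l\<in>UNIV. A k l * re_root ws i l)"
    by (simp add: z fst_tr algebra_simps)
  also have "\<dots> \<in> \<int>" by (rule Ints_mult[OF p Ints_of_int])
  finally have "\<sigma> * of_int (fst y k) - \<sigma> * of_int (fst z k) \<in> \<int>" .
  from Ints_add[OF step(3) this] show ?case by simp
qed simp

text \<open>As long as the pairing with \<open>j\<close> stays positive, the chain can be reflected
  step by step. At the last place where it becomes positive the step is \<open>r_j\<close> itself;
  dropping this step joins the part before it to the reflected part after it.\<close>

lemma sigma_chain_cross:
  assumes "(sigma_step A i0 \<sigma>)\<^sup>*\<^sup>* x y" "fst y j > 0"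
  shows "(fst x j > 0 \<and> (sigma_step A i0 \<sigma>)\<^sup>*\<^sup>* (sr j x) (sr j y)) \<or>
     ((sigma_step A i0 \<sigma>)\<^sup>*\<^sup>* x (sr j y) \<and>
      (\<exists>z. (sigma_step A i0 \<sigma>)\<^sup>*\<^sup>* x z \<and> \<sigma> * of_int (fst z j) \<in> \<int>))"
  using assms
proof (induction rule: converse_rtranclp_induct)
  case (step x x')
  show ?case
  proof (cases "(\<exists>z. (sigma_step A i0 \<sigma>)\<^sup>*\<^sup>* x' z \<and> \<sigma> * of_int (fst z j) \<in> \<int>) \<and> (sigma_step A i0 \<sigma>)\<^sup>*\<^sup>* x' (sr j y)")
    case True
    then show ?thesis using step(1) by (meson converse_rtranclp_into_rtranclp)
  next
    case False
    then have x': "fst x' j > 0" "(sigma_step A i0 \<sigma>)\<^sup>*\<^sup>* (sr j x') (sr j y)" using step by blast+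
    show ?thesis
    proof (cases "fst x j > 0")
      case True
      then show ?thesis using sigma_step_conj[OF step(1) True x'(1)] x'(2)
        by (meson converse_rtranclp_into_rtranclp)
    next
      case False
      then have "x' = sr j x" "\<sigma> * of_int (fst x j) \<in> \<int>" using sigma_step_cross[OF step(1) _ x'(1)] by auto
      moreover from this have "(sigma_step A i0 \<sigma>)\<^sup>*\<^sup>* x (sr j y)" using x'(2) by simp
      ultimately show ?thesis by blast
    qed
  qed
qed simp

end

section \<open>Level-zero orbits\<close>

text \<open>A finite set closed under partial injective moves \<open>F j\<close>, whose outgoing weights \<open>g j\<close> equal the
  incoming weights \<open>h j\<close>, carries a circulation; so nothing can enter it from outside.\<close>

lemma balanced_closed_backward:
  fixes g h :: "'i::finite \<Rightarrow> 'b \<Rightarrow> int" and v :: "'i \<Rightarrow> int"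
  assumes fin: "finite R" and v: "\<And>j. v j > 0"
    and closed: "\<And>j b. b \<in> R \<Longrightarrow> g j b > 0 \<Longrightarrow> F j b \<in> R \<and> h j (F j b) = g j b"
    and inj: "\<And>j. inj_on (F j) {b\<in>R. g j b > 0}"
    and nn: "\<And>j b. b \<in> R \<Longrightarrow> g j b \<ge> 0" "\<And>j b. b \<in> R \<Longrightarrow> h j b \<ge> 0"
    and bal: "\<And>b. b \<in> R \<Longrightarrow> (\<Sum>j\<in>UNIV. v j * (g j b - h j b)) = 0"
    and b: "b \<in> R" "h j b > 0"
  shows "\<exists>b'\<in>R. g j b' > 0 \<and> F j b' = b"
proof -
  let ?P = "\<lambda>j. {b\<in>R. g j b > 0}"
  have img: "F j ` ?P j \<subseteq> R" for j using closed by auto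
  have "(\<Sum>b\<in>R. g j b) = (\<Sum>b\<in>F j ` ?P j. h j b)" for j
  proof -
    have "(\<Sum>b\<in>R. g j b) = (\<Sum>b\<in>?P j. g j b)"
      by (rule sum.mono_neutral_right) (use fin nn in \<open>auto simp: order_le_less\<close>)
    also have "\<dots> = (\<Sum>b\<in>?P j. h j (F j b))" using closed by (intro sum.cong) auto
    also have "\<dots> = (\<Sum>b\<in>F j ` ?P j. h j b)" using inj by (simp add: sum.reindex)
    finally show ?thesis .
  qed
  moreover have "(\<Sum>b\<in>R. h j b) = (\<Sum>b\<in>R - F j ` ?P j. h j b) + (\<Sum>b\<in>F j ` ?P j. h j b)" for j
    using sum.subset_diff[OF img fin] by blast
  \<comment> \<open>By injectivity the outgoing weight cancels exactly the incoming weight on the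
    image of \<open>F j\<close>. What remains is the weight that enters from outside; it is
    nonnegative, and with the positive factors \<open>v j\<close> its total is zero.\<close>
  ultimately have D: "(\<Sum>b\<in>R. g j b - h j b) = - (\<Sum>b\<in>R - F j ` ?P j. h j b)" for j
    by (simp add: sum_subtractf)
  have D0: "(\<Sum>b\<in>R - F j ` ?P j. h j b) \<ge> 0" for j using nn by (intro sum_nonneg) auto
  have "(\<Sum>j\<in>UNIV. v j * (\<Sum>b\<in>R. g j b - h j b)) = (\<Sum>b\<in>R. \<Sum>j\<in>UNIV. v j * (g j b - h j b))"
    unfolding sum_distrib_left by (rule sum.swap)
  also have "\<dots> = 0" using bal by simp
  finally have "(\<Sum>j\<in>UNIV. v j * (\<Sum>b\<in>R - F j ` ?P j. h j b)) = 0" unfolding D by (simp add: sum_negf)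
  then have "v j * (\<Sum>b\<in>R - F j ` ?P j. h j b) = 0"
    using D0 v by (subst (asm) sum_nonneg_eq_0_iff) (auto intro: mult_nonneg_nonneg less_imp_le)
  then have "(\<Sum>b\<in>R - F j ` ?P j. h j b) = 0" using v[of j] by simp
  then have "\<forall>b\<in>R - F j ` ?P j. h j b = 0" using fin nn by (subst (asm) sum_nonneg_eq_0_iff) auto
  then show ?thesis using b by force
qed

lemma finite_bounded_funs: "finite {c :: 'i::finite \<Rightarrow> int. \<forall>k. \<bar>c k\<bar> \<le> M k}"
proof -
  have "c k \<in> {- Max (range M)..Max (range M)}" if "\<forall>k. \<bar>c k\<bar> \<le> M k" for c k
    using that Max_ge[of "range M" "M k"] by (smt (verit) atLeastAtMost_iff finite_code finite_imageI rangeI)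
  then have "{c :: 'i \<Rightarrow> int. \<forall>k. \<bar>c k\<bar> \<le> M k}
     \<subseteq> {c. \<forall>k. (k \<in> UNIV \<longrightarrow> c k \<in> {- Max (range M)..Max (range M)}) \<and> (k \<notin> UNIV \<longrightarrow> c k = 0)}" by auto
  then show ?thesis using finite_set_of_finite_funs[of "UNIV :: 'i set" "{- Max (range M)..Max (range M)}" 0]
    by (meson finite_UNIV finite_atLeastAtMost_int finite_subset)
qed

section \<open>Finiteness of level-zero orbits modulo \<delta>\<close>

context affine
begin

text \<open>\<open>cs\<close> and \<open>ucs\<close> are \<open>r_j\<close> and \<open>up j\<close>
  after the \<delta>-coordinate is dropped, that is, on the classical weight lattice.\<close>

definition cs :: "'i \<Rightarrow> ('i \<Rightarrow> int) \<Rightarrow> 'i \<Rightarrow> int" where "cs j f = (\<lambda>i. f i - f j * A i j)"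
definition ucs :: "'i \<Rightarrow> ('i \<Rightarrow> int) \<Rightarrow> 'i \<Rightarrow> int" where "ucs j f = (if f j > 0 then cs j f else f)"

lemma fst_sr_cs: "fst (sr j \<mu>) = cs j (fst \<mu>)" by (auto simp: cs_def fst_sr)
lemma fst_up: "fst (up j \<mu>) = ucs j (fst \<mu>)" by (simp add: up_def ucs_def fst_sr_cs)
lemma cs_same [simp]: "cs j f j = - f j" by (simp add: cs_def)
lemma cs_cs [simp]: "cs j (cs j f) = f" by (auto simp: cs_def)

lemma level_cs: "(\<Sum>i\<in>UNIV. v i * cs j f i) = (\<Sum>i\<in>UNIV. v i * f i)"
proof -
  have "(\<Sum>i\<in>UNIV. v i * cs j f i) = (\<Sum>i\<in>UNIV. v i * f i) - f j * (\<Sum>i\<in>UNIV. v i * A i j)"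
    by (simp add: cs_def algebra_simps sum_subtractf sum_distrib_left)
  then show ?thesis by (simp add: v_A)
qed

text \<open>A diameter argument: every edge has integral weight at least one, so the energy bounds
  the jump of \<open>c k / a k\<close> across an edge by \<open>sqrt (2 * L * Y)\<close>. Starting
  from the value 0 at \<open>i0\<close>, every vertex is reached in at most \<open>n\<close> jumps,
  where \<open>n\<close> is the number of vertices. Thus
  \<open>Y \<le> n * sqrt (2 * L * Y)\<close>, and squaring gives the constant.\<close>

lemma bounded_of_bil:
  assumes "c i0 = 0" "bil c c \<le> L * Y" "L \<ge> 0" "Y \<ge> 0" "\<And>k. \<bar>c k / a k\<bar> \<le> Y" "\<bar>c k0 / a k0\<bar> = Y"
  shows "Y \<le> 2 * L * (real (card (UNIV :: 'i set)))\<^sup>2"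
proof -
  define y where "y k = c k / a k" for k
  define s where "s = sqrt (2 * (L * Y))"
  have s0: "s \<ge> 0" using assms by (simp add: s_def)
  have adj: "\<bar>y k - y l\<bar> \<le> s" if "A k l \<noteq> 0" for k l
  proof (cases "k = l")
    case False
    have "w k l \<ge> 1"
    proof -
      define n where "n = - (v k * A k l * a l)"
      have n: "w k l = real_of_int n" using False by (simp add: w_def n_def)
      moreover have "w k l > 0" using w_nonneg[of k l] w_nonzero_iff[OF False] that by linarith
      ultimately have "n > 0" by simp
      then show ?thesis unfolding n by simp
    qed
    then have "(y k - y l)\<^sup>2 \<le> w k l * (y k - y l)\<^sup>2" by (simp add: mult_le_cancel_right1)
    also have "\<dots> \<le> (\<Sum>l\<in>UNIV. w k l * (y k - y l)\<^sup>2)"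
      by (rule member_le_sum) (auto simp: w_nonneg)
    also have "\<dots> \<le> (\<Sum>k\<in>UNIV. \<Sum>l\<in>UNIV. w k l * (y k - y l)\<^sup>2)"
      by (rule member_le_sum[of k UNIV "\<lambda>k. \<Sum>l\<in>UNIV. w k l * (y k - y l)\<^sup>2"]) (auto simp: w_nonneg sum_nonneg)
    also have "\<dots> = 2 * bil c c" by (simp add: bil_square y_def)
    also have "\<dots> \<le> 2 * (L * Y)" using assms(2) by simp
    finally have "sqrt ((y k - y l)\<^sup>2) \<le> s" unfolding s_def by (rule real_sqrt_le_mono)
    then show ?thesis by simp
  qed (simp add: s0)
  define J where "J r = {k. \<bar>y k\<bar> \<le> real r * s}" for r
  have J: "J r = UNIV \<or> card (J r) \<ge> Suc r" for r
  proof (induction r)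
    case 0
    have "i0 \<in> J 0" using assms(1) by (simp add: J_def y_def)
    then show ?case by (metis card_gt_0_iff Suc_leI empty_iff finite_code)
  next
    case (Suc r)
    have mono: "J r \<subseteq> J (Suc r)" using s0 by (auto simp: J_def algebra_simps)
    show ?case
    proof (cases "J r = UNIV")
      case True then show ?thesis using mono by auto
    next
      case False
      have "i0 \<in> J r" using assms(1) s0 by (simp add: J_def y_def)
      then obtain j k where jk: "j \<in> J r" "A j k \<noteq> 0" "k \<notin> J r"
        using indecomposable_closed_eq_UNIV[OF gcm indec, of "J r"] False by blast
      have "\<bar>y k\<bar> \<le> \<bar>y j\<bar> + s" using adj[OF jk(2)] by linarith
      then have "k \<in> J (Suc r)" using jk(1) by (simp add: J_def algebra_simps)
      then have "J r \<subset> J (Suc r)" using mono jk(3) by blast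
      then have "card (J r) < card (J (Suc r))" by (meson finite_code psubset_card_mono)
      then show ?thesis using Suc False by simp
    qed
  qed
  let ?n = "(card (UNIV :: 'i set))"
  have "J ?n = UNIV" using J[of ?n] card_mono[of UNIV "J ?n"] by (metis Suc_n_not_le_n finite_code subset_UNIV le_trans)
  then have "k0 \<in> J ?n" by simp
  then have Y: "Y \<le> real ?n * s" using assms(6) by (simp add: J_def y_def)
  have "Y * Y \<le> (real ?n * s) * (real ?n * s)" using Y assms(4) by (intro mult_mono) (auto simp: s0)
  also have "\<dots> = (real ?n)\<^sup>2 * s\<^sup>2" by (simp add: power2_eq_square)
  also have "s\<^sup>2 = 2 * (L * Y)" using assms by (simp add: s_def)
  finally have "Y * Y \<le> Y * (2 * L * (real ?n)\<^sup>2)" by (simp add: algebra_simps)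
  moreover have "0 \<le> 2 * L * (real ?n)\<^sup>2" using assms(3) by simp
  ultimately show ?thesis using assms(4) by (cases "Y = 0") (auto simp: mult_le_cancel_left)
qed

text \<open>On \<open>c i0 = 0\<close> the form is definite, and a definite quadratic form can equal
  a linear one only in a bounded region. \<open>L\<close> bounds the linear form in terms of the
  largest ratio \<open>c k / a k\<close> in absolute value, and \<open>M\<close> is the resulting
  bound for that ratio.\<close>

lemma finite_bil_linear:
  fixes b :: "'i \<Rightarrow> real"
  shows "finite {c. c i0 = 0 \<and> bil c c = (\<Sum>k\<in>UNIV. b k * c k)}"
proof -
  define L where "L = (\<Sum>k\<in>UNIV. \<bar>b k\<bar> * a k)"
  define M where "M = 2 * L * (real (card (UNIV :: 'i set)))\<^sup>2"
  have a0: "real_of_int (a k) > 0" for k using a_pos[of k] by simp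
  have L0: "L \<ge> 0" unfolding L_def using a0 by (intro sum_nonneg mult_nonneg_nonneg) (auto simp: less_imp_le)
  have "\<bar>c k\<bar> \<le> \<lceil>M * a k\<rceil>" if c: "c i0 = 0" "bil c c = (\<Sum>k\<in>UNIV. b k * c k)" for c k
  proof -
    define Y where "Y = Max (range (\<lambda>k. \<bar>c k / a k\<bar>))"
    have Y: "\<bar>c k / a k\<bar> \<le> Y" for k unfolding Y_def by (rule Max_ge) auto
    have "Y \<in> range (\<lambda>k. \<bar>c k / a k\<bar>)" unfolding Y_def by (rule Max_in) auto
    then obtain k0 where k0: "\<bar>c k0 / a k0\<bar> = Y" by auto
    have Y0: "Y \<ge> 0" using k0 by auto
    have "b k * c k \<le> \<bar>b k\<bar> * a k * Y" for k
    proof -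
      have "b k * c k \<le> \<bar>b k\<bar> * \<bar>real_of_int (c k)\<bar>" by (metis abs_ge_self abs_mult)
      also have "\<bar>real_of_int (c k)\<bar> \<le> a k * Y" using Y[of k] a0[of k] by (simp add: abs_divide field_simps)
      finally show ?thesis by (simp add: mult_left_mono mult.assoc)
    qed
    then have "bil c c \<le> L * Y" unfolding c(2) L_def sum_distrib_right by (rule sum_mono)
    then have "Y \<le> M" unfolding M_def using bounded_of_bil[of c L Y k0] c(1) L0 Y0 Y k0 by simp
    then have "\<bar>c k / a k\<bar> \<le> M" using Y[of k] by linarith
    then have "\<bar>real_of_int (c k)\<bar> \<le> M * a k" using a0[of k] by (simp add: abs_divide field_simps)
    then show ?thesis by linarith
  qed
  then have "{c. c i0 = 0 \<and> bil c c = (\<Sum>k\<in>UNIV. b k * c k)} \<subseteq> {c. \<forall>k. \<bar>c k\<bar> \<le> \<lceil>M * a k\<rceil>}" by blast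
  then show ?thesis by (rule finite_subset[OF _ finite_bounded_funs])
qed

lemma theta_re_root: "\<exists>ws j. i0 \<notin> set ws \<and> j \<noteq> i0 \<and> (\<lambda>k. if k = i0 then 0 else a k) = re_root ws j"
  using theta_root
proof (induction rule: fin_roots.induct)
  case (simple j)
  then show ?case by (intro exI[of _ "[]"] exI[of _ j]) simp
next
  case (refl \<beta> j)
  then obtain ws i where "i0 \<notin> set ws" "i \<noteq> i0" "\<beta> = re_root ws i" by blast
  then show ?case using refl by (intro exI[of _ "j # ws"] exI[of _ i]) simp
qed

end

locale level_zero_orbit = affine A i0 a v
  for A :: "'i::finite \<Rightarrow> 'i \<Rightarrow> int" and i0 :: 'i and a v :: "'i \<Rightarrow> int" +
  fixes lam :: "'i wt"
  assumes level_lam: "(\<Sum>i\<in>UNIV. v i * fst lam i) = 0"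
begin

abbreviation "Orb \<equiv> Worbit A i0 lam"
abbreviation "cO \<equiv> fst ` Orb"

lemma lam_Orb: "lam \<in> Orb"
  unfolding Worbit_def by (rule CollectI, rule exI[of _ "[]"]) simp

lemma sr_Orb: "x \<in> Orb \<Longrightarrow> sr j x \<in> Orb"
  unfolding Worbit_def by clarify (metis wact_Cons)

lemma wact_Orb: "x \<in> Orb \<Longrightarrow> wact A i0 ws x \<in> Orb"
  by (induction ws) (simp_all add: sr_Orb)

lemma Orb_induct [consumes 1, case_names base step]:
  assumes "x \<in> Orb" "P lam" "\<And>x j. x \<in> Orb \<Longrightarrow> P x \<Longrightarrow> P (sr j x)"
  shows "P x"
proof -
  obtain ws where "x = wact A i0 ws lam" using assms(1) unfolding Worbit_def by blast
  moreover have "P (wact A i0 ws lam)"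
    by (induction ws) (auto intro: assms(2,3) wact_Orb lam_Orb)
  ultimately show ?thesis by simp
qed

lemma cs_cO: assumes "f \<in> cO" shows "cs j f \<in> cO"
proof -
  obtain x where x: "x \<in> Orb" "f = fst x" using assms by (rule imageE)
  show ?thesis unfolding x(2) fst_sr_cs[symmetric] by (intro imageI sr_Orb x(1))
qed

lemma ucs_cO: "f \<in> cO \<Longrightarrow> ucs j f \<in> cO"
  using cs_cO by (simp add: ucs_def)

lemma level_zero: "f \<in> cO \<Longrightarrow> (\<Sum>i\<in>UNIV. v i * f i) = 0"
proof -
  have "(\<Sum>i\<in>UNIV. v i * fst x i) = 0" if "x \<in> Orb" for x
    using that by (induction rule: Orb_induct) (simp_all only: level_lam fst_sr_cs level_cs)
  then show "f \<in> cO \<Longrightarrow> (\<Sum>i\<in>UNIV. v i * f i) = 0" by auto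
qed

text \<open>The norm of a weight is constant on the orbit; written in terms of \<open>c = x - lam\<close> this needs no
  preimage of \<open>lam\<close> under the Cartan matrix.\<close>

lemma Orb_norm: "x \<in> Orb \<Longrightarrow> \<exists>c. x = tr lam c \<and> bil c c = (\<Sum>k\<in>UNIV. (-2 * d k * fst lam k) * c k)"
proof (induction rule: Orb_induct)
  case base
  show ?case by (rule exI[of _ "\<lambda>_. 0"]) (simp add: bil_def)
next
  case (step x j)
  then obtain c where c: "x = tr lam c" "bil c c = (\<Sum>k\<in>UNIV. (-2 * d k * fst lam k) * c k)" by blast
  define m where "m = fst lam j + (\<Sum>l\<in>UNIV. A j l * c l)"
  let ?c = "\<lambda>k. c k - m * unit_vec j k"
  have m: "fst x j = m" by (simp add: c fst_tr m_def)
  have "sr j x = tr lam ?c" unfolding sr_eq_tr m unfolding c(1) tr_tr by simp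
  moreover have "bil ?c ?c = (\<Sum>k\<in>UNIV. (-2 * d k * fst lam k) * ?c k)"
  proof -
    have b: "bil (unit_vec j) c = d j * (\<Sum>l\<in>UNIV. A j l * c l)" by (rule bil_unit_left)
    then have b': "bil c (unit_vec j) = d j * (\<Sum>l\<in>UNIV. A j l * c l)" using bil_sym by metis
    have "bil ?c ?c = bil c c + 2 * m * d j * (m - (\<Sum>l\<in>UNIV. A j l * c l))"
      unfolding bil_diff_left bil_diff_right bil_scale_left bil_scale_right b b' bil_unit_unit
      by (simp add: algebra_simps)
    also have "m - (\<Sum>l\<in>UNIV. A j l * c l) = fst lam j" by (simp add: m_def)
    finally have 1: "bil ?c ?c = bil c c + 2 * m * d j * fst lam j" .
    have "(\<Sum>k\<in>UNIV. (-2 * d k * fst lam k) * ?c k)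
      = (\<Sum>k\<in>UNIV. (-2 * d k * fst lam k) * c k) - (\<Sum>k\<in>UNIV. (-2 * d k * fst lam k) * (m * unit_vec j k))"
      unfolding sum_subtractf[symmetric] by (simp add: algebra_simps)
    also have "(\<Sum>k\<in>UNIV. (-2 * d k * fst lam k) * (m * unit_vec j k))
      = (\<Sum>k\<in>UNIV. if k = j then -2 * d j * fst lam j * m else 0)"
      by (rule sum.cong) (auto simp: unit_vec_def)
    finally show ?thesis using 1 c(2) by simp
  qed
  ultimately show ?case by blast
qed

text \<open>Subtracting \<open>c i0\<close> times \<open>a\<close> changes neither the classical
  weight nor the norm, and by level zero it does not change the linear form either. So
  \<open>c i0 = 0\<close> can be arranged.\<close>

lemma finite_cO: "finite cO"
proof -
  let ?E = "{c. c i0 = 0 \<and> bil c c = (\<Sum>k\<in>UNIV. (-2 * d k * fst lam k) * c k)}"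
  have "cO \<subseteq> (\<lambda>c i. fst lam i + (\<Sum>j\<in>UNIV. A i j * c j)) ` ?E"
  proof
    fix f assume "f \<in> cO"
    then obtain x where x: "x \<in> Orb" "f = fst x" by blast
    obtain c where c: "x = tr lam c" "bil c c = (\<Sum>k\<in>UNIV. (-2 * d k * fst lam k) * c k)"
      using Orb_norm[OF x(1)] by blast
    let ?c = "\<lambda>k. c k - c i0 * a k"
    have "(\<Sum>k\<in>UNIV. d k * fst lam k * a k) = real_of_int (\<Sum>k\<in>UNIV. v k * fst lam k)"
      unfolding of_int_sum using a_pos by (intro sum.cong) (auto simp: d_def less_imp_neq[symmetric])
    then have 0: "(\<Sum>k\<in>UNIV. d k * fst lam k * a k) = 0" using level_lam by simp
    have "(\<Sum>k\<in>UNIV. (-2 * d k * fst lam k) * ?c k)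
       = (\<Sum>k\<in>UNIV. (-2 * d k * fst lam k) * c k) + 2 * c i0 * (\<Sum>k\<in>UNIV. d k * fst lam k * a k)"
      unfolding sum_distrib_left sum.distrib[symmetric] by (rule sum.cong) (auto simp: algebra_simps)
    moreover have "bil ?c ?c = bil c c"
      unfolding bil_diff_left bil_diff_right bil_scale_left bil_scale_right by simp
    ultimately have "?c \<in> ?E" using 0 c(2) a_i0 by simp
    moreover have "f = (\<lambda>i. fst lam i + (\<Sum>j\<in>UNIV. A i j * ?c j))"
    proof
      fix i
      have "(\<Sum>j\<in>UNIV. A i j * ?c j) = (\<Sum>j\<in>UNIV. A i j * c j) - c i0 * (\<Sum>j\<in>UNIV. A i j * a j)"
        by (simp add: algebra_simps sum_subtractf sum_distrib_left)
      then show "f i = fst lam i + (\<Sum>j\<in>UNIV. A i j * ?c j)" using x(2) c(1) by (simp add: fst_tr A_a)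
    qed
    ultimately show "f \<in> (\<lambda>c i. fst lam i + (\<Sum>j\<in>UNIV. A i j * c j)) ` ?E"
      using image_eqI[of f "\<lambda>c i. fst lam i + (\<Sum>j\<in>UNIV. A i j * c j)" ?c ?E] by simp
  qed
  then show ?thesis by (rule finite_subset) (intro finite_imageI finite_bil_linear)
qed

lemma cO_subset_of_cs_closed:
  assumes "x \<in> Orb" "fst x \<in> S" "\<And>f j. f \<in> S \<Longrightarrow> cs j f \<in> S"
  shows "cO \<subseteq> S"
proof -
  have cs_iff: "cs j f \<in> S \<longleftrightarrow> f \<in> S" for j f using assms(3)[of f j] assms(3)[of "cs j f" j] by auto
  have iff: "fst (wact A i0 ws y) \<in> S \<longleftrightarrow> fst y \<in> S" for ws y
    by (induction ws) (simp_all add: fst_sr_cs cs_iff)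
  obtain ws where "x = wact A i0 ws lam" using assms(1) unfolding Worbit_def by blast
  then have "fst lam \<in> S" using assms(2) iff by blast
  show ?thesis
  proof
    fix f assume "f \<in> cO"
    then obtain ws where "f = fst (wact A i0 ws lam)" unfolding Worbit_def by blast
    then show "f \<in> S" using iff \<open>fst lam \<in> S\<close> by simp
  qed
qed

section \<open>Connectedness of the classical orbit under descending moves\<close>

definition pmv :: "('i \<Rightarrow> int) \<Rightarrow> ('i \<Rightarrow> int) \<Rightarrow> bool" where
  "pmv f g \<longleftrightarrow> (\<exists>j. f j > 0 \<and> g = cs j f)"

lemma pmv_rtranclp_cO:
  assumes "pmv\<^sup>*\<^sup>* f g" "f \<in> cO" shows "g \<in> cO"
  using assms(1)
proof (induction rule: rtranclp_induct)
  case (step g g')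
  then show ?case unfolding pmv_def using cs_cO by metis
qed (rule assms(2))

text \<open>Moves are allowed only from positive to negative pairing. Their inverses come from
  balancing the set of reachable weights, with the positive and negative parts of the pairings as
  outgoing and incoming weights; the balance condition is level zero.\<close>

lemma pmv_connected:
  assumes "f \<in> cO" "g \<in> cO" shows "pmv\<^sup>*\<^sup>* f g"
proof -
  let ?R = "{g. pmv\<^sup>*\<^sup>* f g}"
  have sub: "?R \<subseteq> cO" using pmv_rtranclp_cO assms(1) by blast
  have fwd: "cs j b \<in> ?R" if "b \<in> ?R" "b j > 0" for j b
    using that unfolding pmv_def by (metis (mono_tags, lifting) mem_Collect_eq rtranclp.rtrancl_into_rtrancl)
  have "cs j b \<in> ?R" if b: "b \<in> ?R" for j b
  proof -
    consider "b j > 0" | "b j = 0" | "b j < 0" by linarith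
    then show ?thesis
    proof cases
      case 1 then show ?thesis using fwd b by blast
    next
      case 2 then show ?thesis using b by (simp add: cs_def)
    next
      case 3
      have "\<exists>b'\<in>?R. max 0 (b' j) > 0 \<and> cs j b' = b"
      proof (rule balanced_closed_backward[where v=v and g="\<lambda>j b. max 0 (b j)" and h="\<lambda>j b. max 0 (- b j)"])
        show "finite ?R" using sub finite_cO by (rule finite_subset)
        show "inj_on (cs j) {b \<in> ?R. max 0 (b j) > 0}" for j by (rule inj_onI) (metis cs_cs)
        show "(\<Sum>j\<in>UNIV. v j * (max 0 (b j) - max 0 (- b j))) = 0" if "b \<in> ?R" for b
        proof -
          have "max 0 (b j) - max 0 (- b j) = b j" for j by simp
          then show ?thesis using level_zero[of b] sub that by auto
        qed
        show "cs j b \<in> ?R \<and> max 0 (- cs j b j) = max 0 (b j)" if "b \<in> ?R" "max 0 (b j) > 0" for j b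
          using fwd[of b j] that by (simp add: max_def split: if_splits)
      qed (use b 3 v_pos in auto)
      then show ?thesis using cs_cs by (metis (no_types, lifting))
    qed
  qed
  moreover obtain x where "x \<in> Orb" "f = fst x" using assms(1) by blast
  ultimately have "cO \<subseteq> ?R" by (intro cO_subset_of_cs_closed) auto
  then show ?thesis using assms(2) by blast
qed

section \<open>Orbits of the finite Weyl group as lifts of classical weights\<close>

definition O0 :: "'i wt \<Rightarrow> 'i wt set" where
  "O0 y = {wact A i0 ws y | ws. i0 \<notin> set ws}"

lemma O0_refl: "y \<in> O0 y"
  unfolding O0_def by (rule CollectI, rule exI[of _ "[]"]) simp

lemma O0_wact: assumes "x \<in> O0 y" "i0 \<notin> set ws" shows "wact A i0 ws x \<in> O0 y"
proof -
  obtain ws' where "x = wact A i0 ws' y" "i0 \<notin> set ws'" using assms(1) unfolding O0_def by blast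
  then show ?thesis using assms(2) unfolding O0_def
    by (intro CollectI exI[of _ "ws @ ws'"]) (simp add: wact_append)
qed

lemma O0_sr: "x \<in> O0 y \<Longrightarrow> j \<noteq> i0 \<Longrightarrow> sr j x \<in> O0 y"
  using O0_wact[of x y "[j]"] by simp

lemma O0_up: "x \<in> O0 y \<Longrightarrow> j \<noteq> i0 \<Longrightarrow> up j x \<in> O0 y"
  using O0_sr by (simp add: up_def)

lemma O0_sym: assumes "x \<in> O0 y" shows "y \<in> O0 x"
proof -
  obtain ws where "x = wact A i0 ws y" "i0 \<notin> set ws" using assms unfolding O0_def by blast
  then show ?thesis unfolding O0_def by (intro CollectI exI[of _ "rev ws"]) simp
qed

lemma O0_trans: assumes "x \<in> O0 y" "y \<in> O0 z" shows "x \<in> O0 z"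
proof -
  obtain ws where "x = wact A i0 ws y" "i0 \<notin> set ws" using assms(1) unfolding O0_def by blast
  then show ?thesis using O0_wact[OF assms(2)] by simp
qed

lemma O0_Orb: "x \<in> O0 y \<Longrightarrow> y \<in> Orb \<Longrightarrow> x \<in> Orb"
  unfolding O0_def by (auto intro: wact_Orb)

lemma snd_O0: "x \<in> O0 y \<Longrightarrow> snd x = snd y"
proof -
  have "snd (wact A i0 ws y) = snd y" if "i0 \<notin> set ws" for ws
    using that by (induction ws) (auto simp: sref_def Let_def)
  then show "x \<in> O0 y \<Longrightarrow> snd x = snd y" unfolding O0_def by auto
qed

lemma finite_O0: "y \<in> Orb \<Longrightarrow> finite (O0 y)"
proof -
  assume "y \<in> Orb"
  then have "O0 y \<subseteq> cO \<times> {snd y}"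
    by (intro subsetI) (simp add: mem_Times_iff snd_O0 imageI[OF O0_Orb])
  then show ?thesis using finite_cO by (meson finite.emptyI finite_SigmaI finite_insert finite_subset)
qed

lemma O0_induct [consumes 1, case_names base step]:
  assumes "x \<in> O0 y" "P y" "\<And>x j. j \<noteq> i0 \<Longrightarrow> P x \<Longrightarrow> P (sr j x)"
  shows "P x"
proof -
  obtain ws where "x = wact A i0 ws y" "i0 \<notin> set ws" using assms(1) unfolding O0_def by blast
  moreover have "i0 \<notin> set ws \<Longrightarrow> P (wact A i0 ws y)"
    by (induction ws) (auto intro: assms(2,3))
  ultimately show ?thesis by simp
qed

text \<open>On level-zero weights modulo \<open>\<delta>\<close> the reflection \<open>r\<^sub>0\<close> is the reflection in \<open>\<theta> = \<delta> - \<alpha>\<^sub>0\<close>.\<close>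

lemma cs_i0_O0:
  assumes "y \<in> Orb" shows "\<exists>x\<in>O0 y. fst x = cs i0 (fst y)"
proof -
  let ?th = "\<lambda>k. if k = i0 then 0 else a k"
  obtain ws j where ws: "i0 \<notin> set ws" "j \<noteq> i0" and th: "?th = re_root ws j"
    using theta_re_root by blast
  define x where "x = wact A i0 ws (sr j (wact A i0 (rev ws) y))"
  define p where "p = fst (wact A i0 (rev ws) y) j"
  have "x = wact A i0 (ws @ j # rev ws) y" by (simp add: x_def wact_append)
  then have "x \<in> O0 y" using ws unfolding O0_def by (intro CollectI exI[of _ "ws @ j # rev ws"]) auto
  have x: "x = tr y (\<lambda>k. - p * ?th k)" unfolding x_def p_def fun_cong[OF th] by (rule wact_refl)
  \<comment> \<open>\<theta> differs from \<open>- \<alpha>_0\<close> by the isotropic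
    \<open>a\<close>, so it has the norm of \<alpha>_0 and \<open>d j = 1\<close>. Level zero then
    makes its coroot pair with \<open>y\<close> to minus the pairing at \<open>i0\<close>.\<close>
  have th': "?th = (\<lambda>k. a k - unit_vec i0 k)" by (auto simp: unit_vec_def a_i0)
  have "bil ?th ?th = 2 * d i0" unfolding th' bil_diff_left bil_diff_right by simp
  then have "2 * d j = 2 * d i0" using bil_root[of ws j] unfolding th by (simp only:)
  then have dj: "d j = 1" by (simp add: d_def[of i0] a_i0 v_i0)
  have "(\<Sum>k\<in>UNIV. d k * ?th k * fst y k) = (\<Sum>k\<in>UNIV. real_of_int (v k * fst y k) - (if k = i0 then real_of_int (fst y i0) else 0))"
    by (rule sum.cong) (use a_pos v_i0 in \<open>auto simp: d_def less_imp_neq[symmetric]\<close>)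
  also have "\<dots> = real_of_int (\<Sum>k\<in>UNIV. v k * fst y k) - fst y i0" by (simp add: sum_subtractf)
  finally have "real_of_int p = - fst y i0"
    using root_pairing[of j ws y] level_zero[OF imageI[OF assms]] dj unfolding th[symmetric]
    by (simp add: p_def)
  then have p: "p = - fst y i0" by linarith
  have "fst x i = cs i0 (fst y) i" for i
  proof -
    have "(\<Sum>k\<in>UNIV. A i k * (- p * ?th k)) = - p * ((\<Sum>k\<in>UNIV. A i k * a k) - (\<Sum>k\<in>UNIV. A i k * unit_vec i0 k))"
      unfolding sum_subtractf[symmetric] sum_distrib_left
      by (rule sum.cong) (auto simp: algebra_simps unit_vec_def a_i0)
    also have "\<dots> = p * A i i0" by (simp add: A_a)
    finally show ?thesis by (simp add: x fst_tr p cs_def)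
  qed
  then show ?thesis using \<open>x \<in> O0 y\<close> by blast
qed

text \<open>Although its \<delta>-coordinate is fixed, one finite orbit already covers all classical
  weights. Any two of them therefore have lifts in one finite set on which the order is well
  founded.\<close>

lemma cO_subset_O0: assumes "y \<in> Orb" shows "cO \<subseteq> fst ` O0 y"
proof (rule cO_subset_of_cs_closed[OF assms])
  show "fst y \<in> fst ` O0 y" using O0_refl by blast
  fix f j assume "f \<in> fst ` O0 y"
  then obtain x where x: "x \<in> O0 y" "f = fst x" by blast
  show "cs j f \<in> fst ` O0 y"
  proof (cases "j = i0")
    case True
    then show ?thesis using cs_i0_O0[of x] O0_Orb[OF x(1) assms] O0_trans x by (metis (no_types, lifting) imageI)
  next
    case False
    then show ?thesis using O0_sr[OF x(1)] x(2) fst_sr_cs by (metis imageI)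
  qed
qed

lemma wf_rstep_finite:
  assumes "finite F"
  shows "wf {(x, y). x \<in> F \<and> y \<in> F \<and> rstep x y}" "wf ({(x, y). x \<in> F \<and> y \<in> F \<and> rstep x y}\<inverse>)"
proof -
  let ?r = "{(x, y). x \<in> F \<and> y \<in> F \<and> rstep x y}"
  have "finite ?r" by (rule finite_subset[of _ "F \<times> F"]) (use assms in auto)
  moreover have "acyclic ?r"
  proof (rule acyclicI, intro allI notI)
    fix x assume "(x, x) \<in> ?r\<^sup>+"
    moreover have "(x, y) \<in> ?r\<^sup>+ \<Longrightarrow> rstep\<^sup>+\<^sup>+ x y" for x y
      by (induction rule: trancl_induct) (auto intro: tranclp.intros)
    ultimately show False using rstep_acyclic by blast
  qed
  ultimately show "wf ?r" "wf (?r\<inverse>)" using finite_acyclic_wf finite_acyclic_wf_converse by blast+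
qed

lemma exists_dominant: "\<exists>y\<in>Orb. \<forall>j. j \<noteq> i0 \<longrightarrow> fst y j \<ge> 0"
proof -
  let ?F = "O0 lam"
  have "lam \<in> ?F" by (rule O0_refl)
  then obtain y where y: "y \<in> ?F" and max: "\<And>z. (z, y) \<in> {(x, y). x \<in> ?F \<and> y \<in> ?F \<and> rstep x y}\<inverse> \<Longrightarrow> z \<notin> ?F"
    using wfE_min[OF wf_rstep_finite(2)[OF finite_O0[OF lam_Orb]], of lam ?F] by blast
  have "fst y j \<ge> 0" if "j \<noteq> i0" for j
  proof (rule ccontr)
    assume "\<not> fst y j \<ge> 0"
    then have "rstep y (sr j y)" by (intro rstep_simple) simp
    then show False using max[of "sr j y"] O0_sr[OF y that] y by auto
  qed
  then show ?thesis using O0_Orb[OF y lam_Orb] by blast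
qed

text \<open>A dominant \<open>y\<close> is fixed by every \<open>dn j\<close> with \<open>j\<close>
  different from \<open>i0\<close>, so lowering the upper end keeps it above \<open>y\<close>;
  raising it does so anyway.\<close>

lemma dominant_least:
  assumes "x \<in> O0 y" "\<And>j. j \<noteq> i0 \<Longrightarrow> fst y j \<ge> 0"
  shows "rstep\<^sup>*\<^sup>* x y"
  using assms(1)
proof (induction rule: O0_induct)
  case (step x j)
  consider "fst x j < 0" | "fst x j = 0" | "fst x j > 0" by linarith
  then show ?case
  proof cases
    case 1 then show ?thesis using rtranclp_dn[OF step(2), of j] assms(2)[OF step(1)] by (simp add: dn_def)
  next
    case 2 then show ?thesis using step sr_fixed by simp
  next
    case 3 then show ?thesis using rstep_simple' step(2) by (meson converse_rtranclp_into_rtranclp)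
  qed
qed simp

lemma antidominant_greatest:
  assumes "x \<in> O0 y" "\<And>j. j \<noteq> i0 \<Longrightarrow> fst y j \<le> 0"
  shows "rstep\<^sup>*\<^sup>* y x"
  using assms(1)
proof (induction rule: O0_induct)
  case (step x j)
  consider "fst x j > 0" | "fst x j = 0" | "fst x j < 0" by linarith
  then show ?case
  proof cases
    case 1 then show ?thesis using rtranclp_up[OF step(2), of j] assms(2)[OF step(1)] by (auto simp: up_def split: if_splits)
  next
    case 2 then show ?thesis using step sr_fixed by simp
  next
    case 3 then show ?thesis using rstep_simple step(2) by (meson rtranclp.rtrancl_into_rtrancl)
  qed
qed simp

text \<open>\<open>mv\<close> describes the effect of a maximal power of \<open>f\<^sub>j\<close> on the last two directions of a path.\<close>

definition mv :: "('i \<Rightarrow> int) \<times> ('i \<Rightarrow> int) \<Rightarrow> ('i \<Rightarrow> int) \<times> ('i \<Rightarrow> int) \<Rightarrow> bool" where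
  "mv s s' \<longleftrightarrow> (\<exists>j. snd s j > 0 \<and> s' = (ucs j (fst s), cs j (snd s)))"

lemma mv_cO: "mv\<^sup>*\<^sup>* s s' \<Longrightarrow> fst s \<in> cO \<Longrightarrow> snd s \<in> cO \<Longrightarrow> fst s' \<in> cO \<and> snd s' \<in> cO"
proof (induction rule: rtranclp_induct)
  case (step s1 s2)
  then obtain j where "s2 = (ucs j (fst s1), cs j (snd s1))" unfolding mv_def by blast
  then show ?case using step cs_cO ucs_cO by simp
qed simp

lemma mv_of_pmv: "pmv\<^sup>*\<^sup>* g g' \<Longrightarrow> \<exists>f'. mv\<^sup>*\<^sup>* (f, g) (f', g')"
proof (induction rule: rtranclp_induct)
  case (step g' g'')
  then obtain f' j where "mv\<^sup>*\<^sup>* (f, g) (f', g')" "g' j > 0" "g'' = cs j g'" unfolding pmv_def by blast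
  moreover from this have "mv (f', g') (ucs j f', g'')" unfolding mv_def by auto
  ultimately show ?case by (meson rtranclp.rtrancl_into_rtrancl)
qed blast

text \<open>The lifts \<open>x \<ge> y\<close> stay comparable while \<open>y\<close> is moved to the greatest element of its orbit
  under the finite Weyl group, where \<open>x\<close> has to coincide with it.\<close>

lemma mv_merge_lifts:
  assumes "y0 \<in> Orb" "y \<in> O0 y0" "x \<in> O0 y0" "rstep\<^sup>*\<^sup>* x y"
  shows "\<exists>f. mv\<^sup>*\<^sup>* (fst x, fst y) (f, f)"
  using assms(2-)
proof (induction y arbitrary: x rule: wf_induct_rule[OF wf_rstep_finite(1)[OF finite_O0[OF assms(1)]]])
  case (1 y)
  show ?case
  proof (cases "\<exists>j. j \<noteq> i0 \<and> fst y j > 0")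
    case True
    then obtain j where j: "j \<noteq> i0" "fst y j > 0" by blast
    have "rstep (sr j y) y" using j(2) by (rule rstep_simple')
    moreover have "rstep\<^sup>*\<^sup>* (up j x) (sr j y)" using rtranclp_up[OF 1(4), of j] j(2) by (simp add: up_def)
    ultimately obtain f where "mv\<^sup>*\<^sup>* (fst (up j x), fst (sr j y)) (f, f)"
      using 1(1)[of "sr j y" "up j x"] 1(2,3) O0_sr O0_up j(1) by blast
    moreover have "mv (fst x, fst y) (fst (up j x), fst (sr j y))"
      unfolding mv_def fst_up fst_sr_cs using j(2) by auto
    ultimately show ?thesis by (meson converse_rtranclp_into_rtranclp)
  next
    case False
    have "x \<in> O0 y" using 1(2,3) O0_sym O0_trans by blast
    then have "rstep\<^sup>*\<^sup>* y x" using False by (intro antidominant_greatest) (auto simp: not_less)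
    then have "x = y" using 1(4) rstep_antisym by blast
    then show ?thesis by blast
  qed
qed

text \<open>The second direction is driven to a dominant weight without regard to the first. Its
  dominant lift is the least element of its finite orbit, so every lift of the first direction in
  that orbit is comparable to it, as \<open>mv_merge_lifts\<close> demands.\<close>

lemma mv_merge:
  assumes "f \<in> cO" "g \<in> cO"
  shows "\<exists>h\<in>cO. mv\<^sup>*\<^sup>* (f, g) (h, h)"
proof -
  obtain y where y: "y \<in> Orb" "\<And>j. j \<noteq> i0 \<Longrightarrow> fst y j \<ge> 0" using exists_dominant by blast
  have "pmv\<^sup>*\<^sup>* g (fst y)" using pmv_connected assms(2) y(1) by blast
  then obtain f' where f': "mv\<^sup>*\<^sup>* (f, g) (f', fst y)" using mv_of_pmv by blast
  then have "f' \<in> cO" using mv_cO[OF f'] assms by simp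
  then obtain x where x: "x \<in> O0 y" "f' = fst x" using cO_subset_O0[OF y(1)] by blast
  have "rstep\<^sup>*\<^sup>* x y" using x(1) y(2) by (rule dominant_least)
  then obtain h where "mv\<^sup>*\<^sup>* (fst x, fst y) (h, h)" using mv_merge_lifts[OF y(1) O0_refl x(1)] by blast
  then have h: "mv\<^sup>*\<^sup>* (f, g) (h, h)" using f' x(2) by simp
  have "h \<in> cO" using mv_cO[OF h] assms by simp
  then show ?thesis using h by blast
qed

end

section \<open>One-variable Pitman transforms\<close>

text \<open>\<open>kmin H t\<close> is the minimum of \<open>H\<close> on \<open>[t, 1]\<close>. With it the root operators become Pitman
  transforms: \<open>f\<^sub>j\<^sup>n \<eta> = \<eta> - min n (kmin H - m) \<alpha>\<^sub>j\<close>, where \<open>H = H\<^sub>j\<close> and \<open>m = m\<^sub>j\<close>.\<close>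

definition kmin :: "(real \<Rightarrow> real) \<Rightarrow> real \<Rightarrow> real" where
  "kmin H t = Inf (H ` {max 0 (min t 1)..1})"

lemma kmin_eqI:
  assumes "t \<in> {0..1}" "s \<in> {t..1}" "H s = x" "\<And>u. u \<in> {t..1} \<Longrightarrow> x \<le> H u"
  shows "kmin H t = x"
  unfolding kmin_def by (rule cInf_eq_minimum) (use assms in auto)

lemma kmin_clamp: "t \<le> 0 \<Longrightarrow> kmin H t = kmin H 0" "t \<ge> 1 \<Longrightarrow> kmin H t = kmin H 1"
  by (simp_all add: kmin_def)

lemma kmin_one [simp]: "kmin H 1 = H 1"
  by (simp add: kmin_def)

lemma kmin_zero: "kmin H 0 = Inf (H ` {0..1})"
  by (simp add: kmin_def)

locale cont_fun =
  fixes H :: "real \<Rightarrow> real"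
  assumes cont: "continuous_on {0..1} H"
begin

lemma cont_sub: "0 \<le> p \<Longrightarrow> q \<le> 1 \<Longrightarrow> continuous_on {p..q} H"
  using cont by (rule continuous_on_subset) auto

lemma compact_sublevel:
  assumes "0 \<le> p" "q \<le> 1"
  shows "compact {u\<in>{p..q}. H u \<le> x}" "compact {u\<in>{p..q}. x \<le> H u}"
proof -
  have "compact (H -` B \<inter> {p..q})" if "closed B" for B
    
    using compact_Int_closed[OF compact_Icc[of p q] closed_vimage_Int[OF that cont_sub[OF assms] closed_real_atLeastAtMost]]
    by (simp add: Int_commute Int_left_commute)
  from this[of "{..x}"] this[of "{x..}"]
  show "compact {u\<in>{p..q}. H u \<le> x}" "compact {u\<in>{p..q}. x \<le> H u}"
    by (simp_all add: vimage_def Int_def conj_commute)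
qed

lemma kmin_attained:
  assumes "t \<in> {0..1}"
  shows "\<exists>s\<in>{t..1}. H s = kmin H t \<and> (\<forall>u\<in>{t..1}. kmin H t \<le> H u)"
proof -
  have "\<exists>s\<in>{t..1}. \<forall>u\<in>{t..1}. H s \<le> H u"
    using assms cont_sub by (intro continuous_attains_inf) auto
  then obtain s where s: "s \<in> {t..1}" "\<And>u. u \<in> {t..1} \<Longrightarrow> H s \<le> H u" by blast
  have "kmin H t = H s" by (rule kmin_eqI[OF assms s(1)]) (use s in auto)
  then show ?thesis using s by auto
qed

lemma kmin_le: "0 \<le> t \<Longrightarrow> t \<le> u \<Longrightarrow> u \<le> 1 \<Longrightarrow> kmin H t \<le> H u"
  using kmin_attained[of t] by auto

lemma kmin_mono: "0 \<le> t \<Longrightarrow> t \<le> u \<Longrightarrow> u \<le> 1 \<Longrightarrow> kmin H t \<le> kmin H u"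
proof -
  assume a: "0 \<le> t" "t \<le> u" "u \<le> 1"
  then obtain s where "s \<in> {u..1}" "H s = kmin H u" using kmin_attained[of u] by auto
  then show ?thesis using kmin_le[of t s] a by auto
qed

text \<open>The last point of \<open>{p..q}\<close> at which \<open>H\<close> is at most
  \<open>x\<close> serves as witness: by continuity the value there is \<open>x\<close>, and
  afterwards \<open>H\<close> never falls below \<open>x\<close>.\<close>

lemma last_hit:
  assumes "0 \<le> p" "q \<le> 1" "u0 \<in> {p..q}" "H u0 \<le> x" "H q \<ge> x" "\<And>u. u \<in> {q..1} \<Longrightarrow> x \<le> H u"
  shows "\<exists>s\<in>{p..q}. H s = x \<and> kmin H s = x"
proof -
  let ?S = "{u\<in>{p..q}. H u \<le> x}"
  have "compact ?S" using assms(1,2) by (rule compact_sublevel)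
  moreover have "?S \<noteq> {}" using assms by auto
  ultimately obtain s where s: "s \<in> ?S" "\<And>u. u \<in> ?S \<Longrightarrow> u \<le> s" using compact_attains_sup[of ?S] by blast
  obtain u where u: "s \<le> u" "u \<le> q" "H u = x"
    using IVT'[of H s x q] s(1) assms(1,2,5) cont_sub[of s q] by auto
  have "u = s" using s(2)[of u] u s(1) by auto
  then have "H s = x" using u by simp
  moreover have "kmin H s = x"
  proof (rule kmin_eqI)
    fix r assume r: "r \<in> {s..1}"
    show "x \<le> H r"
    proof (rule ccontr)
      assume "\<not> x \<le> H r"
      then have "r \<noteq> s" "r < q" using assms(6)[of r] r \<open>H s = x\<close> by force+
      then show False using s(2)[of r] r s(1) \<open>\<not> x \<le> H r\<close> by auto
    qed
  qed (use s(1) assms \<open>H s = x\<close> in auto)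
  ultimately show ?thesis using s(1) by blast
qed

section \<open>The Pitman transform, its future minimum and its inverse\<close>

definition pit :: "real \<Rightarrow> real \<Rightarrow> real" where
  "pit n t = H t - 2 * min n (kmin H t - kmin H 0)"

text \<open>Replace \<open>H s\<close> by its future minimum and use
  \<open>x - 2 * min n x = \<bar>x - n\<bar> - n\<close>.\<close>

lemma pit_ge:
  assumes "s \<in> {0..1}"
  shows "pit n s \<ge> kmin H 0 - n + \<bar>kmin H s - kmin H 0 - n\<bar>"
  using kmin_le[of s s] assms by (auto simp: pit_def min_def)

text \<open>The transform uses up the first \<open>n\<close> units of the rise of the future
  minimum. This is what lets transforms for \<open>n\<close> and for 1 compose to the one for
  \<open>n + 1\<close>.\<close>

lemma kmin_pit:
  assumes "0 \<le> n" "n \<le> H 1 - kmin H 0" "t \<in> {0..1}"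
  shows "kmin (pit n) t = kmin H 0 - n + max 0 (kmin H t - kmin H 0 - n)"
proof -
  have lower: "kmin H 0 - n + max 0 (kmin H t - kmin H 0 - n) \<le> pit n u" if "u \<in> {t..1}" for u
    using pit_ge[of u n] kmin_mono[of t u] that assms(3) by (auto simp: max_def abs_if split: if_splits)
  have "\<exists>s\<in>{t..1}. pit n s = kmin H 0 - n + max 0 (kmin H t - kmin H 0 - n)"
  proof (cases "kmin H t - kmin H 0 \<ge> n")
    case True
    obtain s where s: "s \<in> {t..1}" "H s = kmin H t" using kmin_attained[OF assms(3)] by auto
    then have "kmin H s = kmin H t" using kmin_mono[of t s] kmin_le[of s s] assms(3) by auto
    then show ?thesis using s True by (intro bexI[of _ s]) (auto simp: pit_def)
  next
    case False
    obtain u where "u \<in> {t..1}" "H u = kmin H t" using kmin_attained[OF assms(3)] by blast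
    \<comment> \<open>By the bound on \<open>n\<close> the function still has to climb to
      \<open>kmin H 0 + n\<close> after \<open>t\<close>. At the last time it has this height, the
      transform takes it to \<open>kmin H 0 - n\<close>.\<close>
    then have "\<exists>s\<in>{t..1}. H s = kmin H 0 + n \<and> kmin H s = kmin H 0 + n"
      using assms False by (intro last_hit[of t 1 u]) auto
    then obtain s where s: "s \<in> {t..1}" "H s = kmin H 0 + n" "kmin H s = kmin H 0 + n" by blast
    then have "pit n s = kmin H 0 - n" by (simp add: pit_def)
    then show ?thesis using False s(1) by auto
  qed
  then obtain s where "s \<in> {t..1}" "pit n s = kmin H 0 - n + max 0 (kmin H t - kmin H 0 - n)" by blast
  then show ?thesis by (rule kmin_eqI[OF assms(3)]) (rule lower)
qed

text \<open>The amount subtracted is defined by the future of \<open>H\<close> but can be recovered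
  from the past of the transform, given \<open>kmin H 0\<close>. This is the source of injectivity
  of the root operators.\<close>

lemma pit_amount:
  assumes "0 \<le> n" "t \<in> {0..1}"
  shows "min n (kmin H t - kmin H 0) = max 0 (kmin H 0 - Inf (pit n ` {0..t}))"
proof -
  let ?T = "min n (kmin H t - kmin H 0)"
  have T0: "?T \<ge> 0" using kmin_mono[of 0 t] assms by simp
  have low: "kmin H 0 - ?T \<le> pit n s" if "s \<in> {0..t}" for s
    using pit_ge[of s n] kmin_mono[of s t] kmin_mono[of 0 s] that assms
    by (auto simp: min_def abs_if split: if_splits)
  then have "kmin H 0 - ?T \<le> Inf (pit n ` {0..t})" using assms by (intro cInf_greatest) auto
  moreover have "Inf (pit n ` {0..t}) \<le> kmin H 0 - ?T" if "?T > 0"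
  proof -
    obtain u where u: "u \<in> {0..1}" "H u = kmin H 0" using kmin_attained[of 0] by auto
    have "u \<le> t" using kmin_le[of t u] u that assms by force
    have "\<exists>s\<in>{0..t}. H s = kmin H 0 + ?T \<and> kmin H s = kmin H 0 + ?T"
    proof (rule last_hit[of 0 t u])
      have le: "kmin H 0 + ?T \<le> kmin H t" by simp
      show "kmin H 0 + ?T \<le> H r" if "r \<in> {t..1}" for r
        by (rule order_trans[OF le kmin_le]) (use that assms in auto)
      then show "kmin H 0 + ?T \<le> H t" using assms by auto
      show "H u \<le> kmin H 0 + ?T" using u(2) T0 by simp
    qed (use u assms \<open>u \<le> t\<close> in auto)
    then obtain s where s: "s \<in> {0..t}" "H s = kmin H 0 + ?T" "kmin H s = kmin H 0 + ?T" by blast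
    have "pit n s = kmin H 0 - ?T" using s(2,3) by (auto simp: pit_def)
    moreover have "bdd_below (pit n ` {0..t})" using low by (intro bdd_belowI2)
    ultimately show ?thesis using s(1) by (metis cInf_lower imageI)
  qed
  ultimately show ?thesis using T0 by linarith
qed

section \<open>Integral local minima and the turning points of \<open>f_j\<close>\<close>

definition lmi :: bool where
  "lmi \<longleftrightarrow> (\<forall>t\<in>{0..1}. (\<exists>\<epsilon>>0. \<forall>s\<in>{0..1}. \<bar>s - t\<bar> < \<epsilon> \<longrightarrow> H t \<le> H s) \<longrightarrow> H t \<in> \<int>)"

lemma kmin_zero_int: "lmi \<Longrightarrow> kmin H 0 \<in> \<int>"
proof -
  assume l: lmi
  obtain s where "s \<in> {0..1}" "H s = kmin H 0" "\<forall>u\<in>{0..1}. H s \<le> H u" using kmin_attained[of 0] by auto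
  then show ?thesis using l unfolding lmi_def by (metis zero_less_one)
qed

text \<open>The point where \<open>H\<close> attains its minimum over \<open>[t, 1]\<close> is, unless it is \<open>t\<close>, a local minimum.\<close>

lemma kmin_int_or_eq:
  assumes lmi "t \<in> {0..1}" "kmin H t \<noteq> H t"
  shows "kmin H t \<in> \<int>"
proof -
  obtain s where s: "s \<in> {t..1}" "H s = kmin H t" "\<And>u. u \<in> {t..1} \<Longrightarrow> H s \<le> H u"
    using kmin_attained[OF assms(2)] by auto
  have "s > t" using s assms(3) by (metis atLeastAtMost_iff order_le_less)
  then have "\<exists>\<epsilon>>0. \<forall>u\<in>{0..1}. \<bar>u - s\<bar> < \<epsilon> \<longrightarrow> H s \<le> H u"
    using s(3) by (intro exI[of _ "s - t"]) (auto simp: abs_if split: if_splits)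
  moreover have "s \<in> {0..1}" using s(1) assms(2) by auto
  ultimately have "H s \<in> \<int>" using assms(1) unfolding lmi_def by blast
  then show ?thesis using s(2) by simp
qed

lemma int_gt: "x \<in> \<int> \<Longrightarrow> y \<in> \<int> \<Longrightarrow> x < y \<Longrightarrow> x + 1 \<le> (y::real)"
  by (elim Ints_cases) auto

definition "t0 = Sup {t\<in>{0..1}. H t = kmin H 0}"
definition "t1 = Inf {t\<in>{t0..1}. H t = kmin H 0 + 1}"

lemma turning_points:
  assumes lmi "H 1 \<in> \<int>" "H 1 \<noteq> kmin H 0"
  shows "0 \<le> t0" "t0 < t1" "t1 \<le> 1" "H t0 = kmin H 0" "H t1 = kmin H 0 + 1"
    and "\<And>t. t0 < t \<Longrightarrow> t \<le> 1 \<Longrightarrow> kmin H 0 < H t"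
    and "\<And>t. t0 \<le> t \<Longrightarrow> t < t1 \<Longrightarrow> H t < kmin H 0 + 1"
    and "\<And>t s. t0 \<le> t \<Longrightarrow> t \<le> t1 \<Longrightarrow> t \<le> s \<Longrightarrow> s \<le> 1 \<Longrightarrow> H t \<le> H s"
    and "kmin H 0 + 1 \<le> H 1"
proof -
  let ?m = "kmin H 0"
  let ?S = "{t\<in>{0..1}. H t = ?m}"
  have "?S = {t\<in>{0..1}. H t \<le> ?m}" using kmin_le[of 0] by force
  then have "compact ?S" using compact_sublevel(1)[of 0 1 ?m] by simp
  moreover have "?S \<noteq> {}" using kmin_attained[of 0] by auto
  ultimately obtain s where s: "s \<in> ?S" "\<And>u. u \<in> ?S \<Longrightarrow> u \<le> s" using compact_attains_sup[of ?S] by blast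
  have t0: "t0 = s" unfolding t0_def by (rule cSup_eq_maximum) (use s in auto)
  show t0_0: "0 \<le> t0" and Ht0: "H t0 = ?m" using s(1) t0 by auto
  show gt: "?m < H t" if "t0 < t" "t \<le> 1" for t
    using s(2)[of t] that t0 t0_0 kmin_le[of 0 t] by force
  have t0_1: "t0 < 1" using Ht0 assms(3) s(1) t0 by (metis (no_types, lifting) atLeastAtMost_iff mem_Collect_eq order_le_less)
  show H1: "?m + 1 \<le> H 1" using gt[of 1] t0_1 assms(2) kmin_zero_int[OF assms(1)] int_gt by simp
  let ?U = "{t\<in>{t0..1}. H t = ?m + 1}"
  have "?U = {t\<in>{t0..1}. H t \<le> ?m + 1} \<inter> {t\<in>{t0..1}. ?m + 1 \<le> H t}" by auto
  then have "compact ?U" using compact_sublevel[of t0 1 "?m + 1"] t0_0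
    by (simp add: compact_Int_closed compact_imp_closed)
  moreover have "?U \<noteq> {}" using IVT'[of H t0 "?m + 1" 1] Ht0 H1 t0_1 t0_0 cont_sub[of t0 1] by auto
  ultimately obtain u where u: "u \<in> ?U" "\<And>r. r \<in> ?U \<Longrightarrow> u \<le> r" using compact_attains_inf[of ?U] by blast
  have t1: "t1 = u" unfolding t1_def by (rule cInf_eq_minimum) (use u in auto)
  show Ht1: "H t1 = ?m + 1" and t1_1: "t1 \<le> 1" using u(1) t1 by auto
  show t01: "t0 < t1" using u(1) t1 Ht0 Ht1 by (metis (no_types, lifting) add_0_right add_left_cancel atLeastAtMost_iff mem_Collect_eq order_le_less zero_neq_one)
  show lt: "H t < ?m + 1" if t: "t0 \<le> t" "t < t1" for t
  proof (rule ccontr)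
    assume "\<not> H t < ?m + 1"
    then obtain r where "t0 \<le> r" "r \<le> t" "H r = ?m + 1"
      using IVT'[of H t0 "?m + 1" t] Ht0 t t0_0 t1_1 cont_sub[of t0 t] by auto
    then show False using u(2)[of r] t t1 t1_1 by simp
  qed
  show "H t \<le> H s" if t: "t0 \<le> t" "t \<le> t1" "t \<le> s" "s \<le> 1" for t s
  proof (rule ccontr)
    \<comment> \<open>A later, lower value would make the future minimum at \<open>t\<close> an
      integer strictly below \<open>H t\<close>, which is at most \<open>m + 1\<close> for the
      global minimum \<open>m\<close>. It would thus be at most \<open>m\<close> and be attained at
      \<open>t0\<close> or earlier, hence at \<open>t\<close> itself.\<close>
    assume "\<not> H t \<le> H s"
    have t': "t \<in> {0..1}" using t t0_0 t1_1 by auto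
    have lt': "kmin H t < H t" using kmin_le[of t s] t t' \<open>\<not> H t \<le> H s\<close> by auto
    then have int: "kmin H t \<in> \<int>" using kmin_int_or_eq[OF assms(1) t'] by auto
    have "H t \<le> ?m + 1" using lt[OF t(1)] t(2) Ht1 by (cases "t = t1") auto
    then have "kmin H t \<le> ?m" using int_gt[OF kmin_zero_int[OF assms(1)] int] lt' by linarith
    moreover obtain r where r: "r \<in> {t..1}" "H r = kmin H t" using kmin_attained[OF t'] by blast
    ultimately have "r = t0" using gt[of r] t(1) by (metis atLeastAtMost_iff order_le_less order_trans not_le)
    then show False using r t(1) lt' by auto
  qed
qed

text \<open>Translates the three cases in the definition of \<open>root_f\<close>: the future
  minimum is still the global one up to \<open>t0\<close>, it is \<open>H\<close> itself between
  \<open>t0\<close> and \<open>t1\<close>, and it exceeds the global one by at least 1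
  afterwards.\<close>

lemma amount_eq:
  assumes lmi "H 1 \<in> \<int>" "H 1 \<noteq> kmin H 0"
  shows "min 1 (kmin H t - kmin H 0) = (if t \<le> t0 then 0 else if t \<le> t1 then H t - kmin H 0 else 1)"
proof -
  note tp = turning_points[OF assms]
  consider "t \<le> 0" | "0 \<le> t" "t \<le> t0" | "t0 < t" "t \<le> t1" | "t1 < t" "t \<le> 1" | "t > 1" by linarith
  then show ?thesis
  proof cases
    case 1 then show ?thesis using kmin_clamp(1)[of t] tp(1) by simp
  next
    case 2
    have "kmin H t = kmin H 0"
      by (rule kmin_eqI[of _ t0]) (use 2 tp(1-4) kmin_le[of 0] in auto)
    then show ?thesis using 2 by simp
  next
    case 3
    have "kmin H t = H t"
      by (rule kmin_eqI[of _ t]) (use 3 tp(1-3) tp(8)[of t] in auto)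
    moreover have "H t \<le> kmin H 0 + 1" using 3 tp(7)[of t] tp(5) by (cases "t = t1") auto
    ultimately show ?thesis using 3 by simp
  next
    case 4
    obtain s where "s \<in> {t..1}" "H s = kmin H t" using kmin_attained[of t] 4 tp(1,2) by auto
    then have "kmin H 0 + 1 \<le> kmin H t" using 4 tp(2,5) tp(8)[of t1 s] by auto
    then show ?thesis using 4 tp(2) by simp
  next
    case 5 then show ?thesis using kmin_clamp(2)[of t] tp(2,3,9) by simp
  qed
qed

end

section \<open>Root operators\<close>

context affine
begin

definition cpath :: "'i path \<Rightarrow> bool" where
  "cpath \<eta> \<longleftrightarrow> \<eta> \<in> P_cl_int \<and> (\<forall>j. continuous_on {0..1} (\<lambda>t. \<eta> t j))"

abbreviation hmin :: "'i path \<Rightarrow> 'i \<Rightarrow> real" where "hmin \<eta> j \<equiv> kmin (\<lambda>t. \<eta> t j) 0"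

definition pitp :: "real \<Rightarrow> 'i \<Rightarrow> 'i path \<Rightarrow> 'i path" where
  "pitp n j \<eta> = (\<lambda>t i. \<eta> t i - min n (kmin (\<lambda>t. \<eta> t j) t - hmin \<eta> j) * clroot A j i)"

definition fstep :: "'i path \<Rightarrow> 'i path \<Rightarrow> bool" where
  "fstep \<eta> \<eta>' \<longleftrightarrow> (\<exists>j. root_f A j \<eta> = Some \<eta>')"

lemma cpath_cont: "cpath \<eta> \<Longrightarrow> cont_fun (\<lambda>t. \<eta> t j)"
  by (simp add: cpath_def cont_fun_def)

lemma cpath_zero: assumes "cpath \<eta>" shows "\<eta> 0 j = 0"
proof -
  have "\<eta> 0 = (\<lambda>i. 0)" using assms unfolding cpath_def P_cl_int_def P_cl_def by blast
  then show ?thesis by simp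
qed

lemma cpath_one: "cpath \<eta> \<Longrightarrow> \<eta> 1 j \<in> \<int>"
  unfolding cpath_def P_cl_int_def P_cl_def by blast

lemma cpath_lmi: assumes "cpath \<eta>" shows "cont_fun.lmi (\<lambda>t. \<eta> t j)"
  unfolding cont_fun.lmi_def[OF cpath_cont[OF assms, of j]]
  using assms by (simp add: cpath_def P_cl_int_def loc_min_int_def)

lemma hmin_int: assumes "cpath \<eta>" shows "hmin \<eta> j \<in> \<int>"
  using cont_fun.kmin_zero_int[OF cpath_cont[OF assms, of j] cpath_lmi[OF assms, of j]] .

lemma hmin_le: "cpath \<eta> \<Longrightarrow> t \<in> {0..1} \<Longrightarrow> hmin \<eta> j \<le> \<eta> t j"
  using cont_fun.kmin_le[OF cpath_cont[of \<eta> j], of 0 t] by simp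

lemma hmin_nonpos: "cpath \<eta> \<Longrightarrow> hmin \<eta> j \<le> 0"
  using hmin_le[of \<eta> 0 j] cpath_zero[of \<eta> j] by simp

lemma root_f_None_iff: "root_f A j \<eta> = None \<longleftrightarrow> \<eta> 1 j = hmin \<eta> j"
  by (simp add: root_f_def Let_def kmin_zero)

lemma root_f_eq:
  assumes "cpath \<eta>" "\<eta> 1 j \<noteq> hmin \<eta> j"
  shows "root_f A j \<eta> = Some (pitp 1 j \<eta>)"
proof -
  interpret cont_fun "\<lambda>t. \<eta> t j" using cpath_cont[OF assms(1)] .
  note tp = turning_points[OF cpath_lmi[OF assms(1)] cpath_one[OF assms(1)] assms(2)]
  note amt = amount_eq[OF cpath_lmi[OF assms(1)] cpath_one[OF assms(1)] assms(2)]
  have "root_f A j \<eta> = Some (\<lambda>t. if t \<le> t0 then \<eta> t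
                 else if t \<le> t1 then (\<lambda>i. \<eta> t0 i + refl_cl A j (\<lambda>k. \<eta> t k - \<eta> t0 k) i)
                 else (\<lambda>i. \<eta> t i - clroot A j i))"
    using assms(2) unfolding root_f_def Let_def kmin_zero t1_def t0_def by simp
  also have "\<dots> = Some (pitp 1 j \<eta>)"
    unfolding pitp_def amt using tp(4) by (auto simp: fun_eq_iff refl_cl_def algebra_simps)
  finally show ?thesis .
qed

lemma pitp_same: assumes "cpath \<eta>" shows "pitp n j \<eta> t j = cont_fun.pit (\<lambda>t. \<eta> t j) n t"
  unfolding cont_fun.pit_def[OF cpath_cont[OF assms, of j]] by (simp add: pitp_def clroot_def)

lemma kmin_pitp:
  assumes "cpath \<eta>" "0 \<le> n" "n \<le> \<eta> 1 j - hmin \<eta> j" "t \<in> {0..1}"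
  shows "kmin (\<lambda>t. pitp n j \<eta> t j) t = hmin \<eta> j - n + max 0 (kmin (\<lambda>t. \<eta> t j) t - hmin \<eta> j - n)"
  unfolding pitp_same[OF assms(1)] 
  by (rule cont_fun.kmin_pit[of "\<lambda>t. \<eta> t j" n t, OF cpath_cont[OF assms(1)] assms(2-4)])

lemma hmin_pitp:
  assumes "cpath \<eta>" "0 \<le> n" "n \<le> \<eta> 1 j - hmin \<eta> j"
  shows "hmin (pitp n j \<eta>) j = hmin \<eta> j - n"
  using kmin_pitp[OF assms, of 0] assms(2) by simp

lemma pitp_one: "n \<le> \<eta> 1 j - hmin \<eta> j \<Longrightarrow> pitp n j \<eta> 1 i = \<eta> 1 i - n * clroot A j i"
  by (simp add: pitp_def)

lemma kmin_clamp_obtain: "\<exists>t'\<in>{0..1}. \<forall>H. kmin H t = kmin H t'"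
proof -
  consider "t \<le> 0" | "t \<in> {0..1}" | "t \<ge> 1" by force
  then show ?thesis
  proof cases
    case 1 show ?thesis by (rule bexI[of _ 0]) (simp_all add: kmin_clamp(1)[OF 1])
  next
    case 3 show ?thesis by (rule bexI[of _ 1]) (simp_all add: kmin_clamp(2)[OF 3] del: kmin_one)
  qed auto
qed

lemma pitp_Suc:
  assumes "cpath \<eta>" "0 \<le> n" "n + 1 \<le> \<eta> 1 j - hmin \<eta> j"
  shows "pitp 1 j (pitp n j \<eta>) = pitp (n + 1) j \<eta>"
proof (intro ext)
  fix t i
  obtain t' where t': "t' \<in> {0..1}" "\<And>H. kmin H t = kmin H t'" using kmin_clamp_obtain by blast
  let ?x = "kmin (\<lambda>t. \<eta> t j) t' - hmin \<eta> j"
  have n: "n \<le> \<eta> 1 j - hmin \<eta> j" using assms(3) by simp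
  have "?x \<ge> 0" using cont_fun.kmin_mono[OF cpath_cont[OF assms(1)], of 0 t' j] t'(1) by simp
  then have "min n ?x + min 1 (max 0 (?x - n)) = min (n + 1) ?x" using assms(2) by auto
  moreover have "pitp 1 j (pitp n j \<eta>) t i = \<eta> t i - (min n ?x + min 1 (max 0 (?x - n))) * clroot A j i"
    unfolding pitp_def[of 1] hmin_pitp[OF assms(1,2) n] t'(2) kmin_pitp[OF assms(1,2) n t'(1)]
    by (simp add: pitp_def t'(2) algebra_simps)
  ultimately show "pitp 1 j (pitp n j \<eta>) t i = pitp (n + 1) j \<eta> t i" by (simp add: pitp_def t'(2))
qed

text \<open>The images determine the minima, then by \<open>pit_amount\<close> the subtracted
  multiples of the simple root, and hence the paths.\<close>

lemma pitp_inject: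
  assumes "cpath \<eta>" "cpath \<eta>'" "1 \<le> \<eta> 1 j - hmin \<eta> j" "1 \<le> \<eta>' 1 j - hmin \<eta>' j"
    and eq: "pitp 1 j \<eta> = pitp 1 j \<eta>'"
  shows "\<eta> = \<eta>'"
proof (intro ext)
  fix t i
  obtain t' where t': "t' \<in> {0..1}" "\<And>H. kmin H t = kmin H t'" using kmin_clamp_obtain by blast
  have m: "hmin \<eta> j = hmin \<eta>' j"
    using hmin_pitp[OF assms(1) _ assms(3)] hmin_pitp[OF assms(2) _ assms(4)] eq by simp
  have pit: "cont_fun.pit (\<lambda>t. \<eta> t j) 1 s = cont_fun.pit (\<lambda>t. \<eta>' t j) 1 s" for s
    using pitp_same[OF assms(1), of 1 j s] pitp_same[OF assms(2), of 1 j s] eq by simp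
  have "min 1 (kmin (\<lambda>t. \<eta> t j) t' - hmin \<eta> j) = min 1 (kmin (\<lambda>t. \<eta>' t j) t' - hmin \<eta>' j)"
    using cont_fun.pit_amount[OF cpath_cont[OF assms(1)], of 1 t' j]
      cont_fun.pit_amount[OF cpath_cont[OF assms(2)], of 1 t' j] t'(1) m pit by simp
  then show "\<eta> t i = \<eta>' t i" using fun_cong[OF fun_cong[OF eq, of t], of i] by (simp add: pitp_def t'(2))
qed

lemma phi_ge_one: assumes "cpath \<eta>" "\<eta> 1 j \<noteq> hmin \<eta> j" shows "1 \<le> \<eta> 1 j - hmin \<eta> j"
proof -
  interpret cont_fun "\<lambda>t. \<eta> t j" using cpath_cont[OF assms(1)] .
  show ?thesis using turning_points(9)[OF cpath_lmi[OF assms(1)] cpath_one[OF assms(1)] assms(2)] by simp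
qed

section \<open>Sets of paths closed under the root operators\<close>

definition lev0 :: "'i path \<Rightarrow> bool" where "lev0 \<eta> \<longleftrightarrow> (\<Sum>j\<in>UNIV. real_of_int (v j) * \<eta> 1 j) = 0"

definition fclosed :: "'i path set \<Rightarrow> bool" where
  "fclosed B \<longleftrightarrow> (\<forall>\<eta>\<in>B. cpath \<eta>) \<and> (\<forall>\<eta>\<in>B. \<forall>j. root_f A j \<eta> = None \<or> the (root_f A j \<eta>) \<in> B)"

lemma fclosed_fstep: assumes "fclosed B" "\<eta> \<in> B" "fstep \<eta> \<eta>'" shows "\<eta>' \<in> B"
proof -
  obtain j where j: "root_f A j \<eta> = Some \<eta>'" using assms(3) unfolding fstep_def by blast
  have "root_f A j \<eta> = None \<or> the (root_f A j \<eta>) \<in> B" using assms(1,2) unfolding fclosed_def by blast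
  then show ?thesis using j by simp
qed

lemma fclosed_rtranclp:
  assumes "fstep\<^sup>*\<^sup>* \<eta> \<eta>'" "fclosed B" "\<eta> \<in> B" shows "\<eta>' \<in> B"
  using assms(1)
proof (induction rule: rtranclp_induct)
  case (step x y)
  then show ?case using fclosed_fstep[OF assms(2)] by blast
qed (rule assms(3))

text \<open>Each further application of the root operator needs integral local minima of the path
  reached so far. Membership of that path in the closed set supplies them.\<close>

lemma fclosed_pitp:
  assumes "fclosed B" "\<eta> \<in> B" "real n \<le> \<eta> 1 j - hmin \<eta> j"
  shows "fstep\<^sup>*\<^sup>* \<eta> (pitp n j \<eta>)"
  using assms(3)
proof (induction n)
  case 0
  have c: "cpath \<eta>" using assms by (simp add: fclosed_def)
  have "pitp 0 j \<eta> = \<eta>"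
  proof (intro ext)
    fix t i
    obtain t' where t': "t' \<in> {0..1}" "\<And>H. kmin H t = kmin H t'" using kmin_clamp_obtain by blast
    have "kmin (\<lambda>t. \<eta> t j) t' - hmin \<eta> j \<ge> 0"
      using cont_fun.kmin_mono[OF cpath_cont[OF c], of 0 t' j] t'(1) by simp
    then show "pitp 0 j \<eta> t i = \<eta> t i" by (simp add: pitp_def t'(2))
  qed
  then show ?case by simp
next
  case (Suc n)
  have c: "cpath \<eta>" using assms by (simp add: fclosed_def)
  have IH: "fstep\<^sup>*\<^sup>* \<eta> (pitp n j \<eta>)" using Suc by simp
  then have c': "cpath (pitp n j \<eta>)" using fclosed_rtranclp[OF IH assms(1,2)] assms(1) by (simp add: fclosed_def)
  have n: "real n \<le> \<eta> 1 j - hmin \<eta> j" "real n + 1 \<le> \<eta> 1 j - hmin \<eta> j" using Suc.prems by auto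
  have "hmin (pitp n j \<eta>) j = hmin \<eta> j - n" by (rule hmin_pitp[OF c _ n(1)]) simp
  moreover have "pitp n j \<eta> 1 j = \<eta> 1 j - 2 * n" using pitp_one[of "real n" \<eta> j j, OF n(1)] by (simp add: clroot_def)
  ultimately have "pitp n j \<eta> 1 j \<noteq> hmin (pitp n j \<eta>) j" using n(2) by linarith
  then have "root_f A j (pitp n j \<eta>) = Some (pitp 1 j (pitp n j \<eta>))" by (rule root_f_eq[OF c'])
  also have "pitp 1 j (pitp n j \<eta>) = pitp (real n + 1) j \<eta>" by (rule pitp_Suc[OF c _ n(2)]) simp
  finally have "fstep (pitp n j \<eta>) (pitp (real (Suc n)) j \<eta>)" unfolding fstep_def by (auto simp: add.commute)
  with IH show ?case by (meson rtranclp.rtrancl_into_rtrancl)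
qed

text \<open>With \<open>\<phi> = H 1 - m\<close> and \<open>\<epsilon> = - m\<close>, the weight \<open>\<phi> (\<epsilon> + 1)\<close> of a path is the weight
  \<open>(\<phi> + 1) \<epsilon>\<close> of its image under \<open>f\<^sub>j\<close>, and their difference \<open>\<phi> - \<epsilon>\<close> at one path is its endpoint pairing.\<close>

lemma finite_fclosed_preimage:
  assumes "finite R" "fclosed R" "\<forall>\<eta>\<in>R. lev0 \<eta>"
    and "\<eta> \<in> R" "hmin \<eta> j < 0"
  shows "\<exists>\<eta>'\<in>R. 1 \<le> \<eta>' 1 j - hmin \<eta>' j \<and> pitp 1 j \<eta>' = \<eta>"
proof -
  define p e where "p j \<eta> = \<lfloor>\<eta> 1 j - hmin \<eta> j\<rfloor>" and "e j \<eta> = \<lfloor>- hmin \<eta> j\<rfloor>" for j \<eta>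
  have c: "cpath \<eta>" if "\<eta> \<in> R" for \<eta> using assms(2) that by (simp add: fclosed_def)
  have pr: "real_of_int (p j \<eta>) = \<eta> 1 j - hmin \<eta> j" "real_of_int (e j \<eta>) = - hmin \<eta> j" if "\<eta> \<in> R" for j \<eta>
    unfolding p_def e_def using cpath_one[OF c] hmin_int[OF c] that
    by (simp_all add: of_int_floor_cancel Ints_diff)
  have p0: "p j \<eta> \<ge> 0" "e j \<eta> \<ge> 0" if "\<eta> \<in> R" for j \<eta>
    unfolding p_def e_def using hmin_le[OF c[OF that], of 1 j] hmin_nonpos[OF c[OF that], of j] by simp_all
  have pos: "1 \<le> \<eta> 1 j - hmin \<eta> j" if "\<eta> \<in> R" "p j \<eta> * (e j \<eta> + 1) > 0" for j \<eta>
  proof -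
    have "p j \<eta> \<ge> 1" using that(2) p0[OF that(1), of j] by (cases "p j \<eta> = 0") auto
    then show ?thesis using pr(1)[OF that(1), of j] by linarith
  qed
  have F: "pitp 1 j \<eta> \<in> R \<and> p j (pitp 1 j \<eta>) = p j \<eta> - 1 \<and> e j (pitp 1 j \<eta>) = e j \<eta> + 1"
    if "\<eta> \<in> R" "p j \<eta> * (e j \<eta> + 1) > 0" for j \<eta>
  proof -
    note 1 = pos[OF that]
    have "root_f A j \<eta> = Some (pitp 1 j \<eta>)" using root_f_eq[OF c[OF that(1)]] 1 by auto
    then have in_R: "pitp 1 j \<eta> \<in> R"
      using fclosed_fstep[OF assms(2) that(1)] unfolding fstep_def by blast
    have "real_of_int (p j (pitp 1 j \<eta>)) = real_of_int (p j \<eta> - 1)"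
      "real_of_int (e j (pitp 1 j \<eta>)) = real_of_int (e j \<eta> + 1)"
      using pr[OF in_R, of j] pr[OF that(1), of j] pitp_one[of 1 \<eta> j j, OF 1] hmin_pitp[OF c[OF that(1)] _ 1]
      by (simp_all add: clroot_def)
    then show ?thesis using in_R by linarith
  qed
  have "\<exists>\<eta>'\<in>R. p j \<eta>' * (e j \<eta>' + 1) > 0 \<and> pitp 1 j \<eta>' = \<eta>"
  proof (rule balanced_closed_backward[where v=v and g="\<lambda>j \<eta>. p j \<eta> * (e j \<eta> + 1)"
        and h="\<lambda>j \<eta>. (p j \<eta> + 1) * e j \<eta>" and F="pitp 1" and R=R and j=j])
    show "pitp 1 j \<eta> \<in> R \<and> (p j (pitp 1 j \<eta>) + 1) * e j (pitp 1 j \<eta>) = p j \<eta> * (e j \<eta> + 1)"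
      if "\<eta> \<in> R" "p j \<eta> * (e j \<eta> + 1) > 0" for j \<eta> using F[OF that] by simp
    show "inj_on (pitp 1 j) {\<eta> \<in> R. p j \<eta> * (e j \<eta> + 1) > 0}" for j
      by (rule inj_onI) (use pitp_inject c pos in blast)
    show "(\<Sum>j\<in>UNIV. v j * (p j \<eta> * (e j \<eta> + 1) - (p j \<eta> + 1) * e j \<eta>)) = 0" if "\<eta> \<in> R" for \<eta>
    proof -
      have "real_of_int (\<Sum>j\<in>UNIV. v j * (p j \<eta> * (e j \<eta> + 1) - (p j \<eta> + 1) * e j \<eta>))
         = (\<Sum>j\<in>UNIV. real_of_int (v j) * \<eta> 1 j)"
        unfolding of_int_sum by (rule sum.cong) (auto simp: pr[OF that] algebra_simps)
      also have "\<dots> = 0" using assms(3) that unfolding lev0_def by blast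
      finally show ?thesis by (simp only: of_int_eq_0_iff)
    qed
    show "p j \<eta> * (e j \<eta> + 1) \<ge> 0" "(p j \<eta> + 1) * e j \<eta> \<ge> 0" if "\<eta> \<in> R" for j \<eta>
      using p0[OF that] by simp_all
    have "e j \<eta> > 0" using pr(2)[OF assms(4), of j] assms(5) by linarith
    then show "(p j \<eta> + 1) * e j \<eta> > 0" using p0(1)[OF assms(4), of j] by (simp add: zero_less_mult_iff)
    show "finite R" "\<eta> \<in> R" by fact+
    show "v j > 0" for j by (rule v_pos)
  qed
  then show ?thesis using pos by blast
qed

text \<open>Balancing yields some preimage inside \<open>R\<close>; injectivity shows that it is the
  given path.\<close>

lemma finite_fclosed_backward:
  assumes "finite R" "fclosed R" "\<forall>\<eta>\<in>R. lev0 \<eta>"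
    and "cpath \<eta>" "fstep \<eta> \<eta>'" "\<eta>' \<in> R"
  shows "\<eta> \<in> R"
proof -
  obtain j where j: "root_f A j \<eta> = Some \<eta>'" using assms(5) unfolding fstep_def by blast
  then have ne: "\<eta> 1 j \<noteq> hmin \<eta> j" using root_f_None_iff by (metis option.distinct(1))
  then have \<eta>': "\<eta>' = pitp 1 j \<eta>" using root_f_eq[OF assms(4)] j by simp
  have 1: "1 \<le> \<eta> 1 j - hmin \<eta> j" using assms(4) ne by (rule phi_ge_one)
  have "hmin \<eta>' j < 0" using hmin_pitp[OF assms(4) _ 1] hmin_nonpos[OF assms(4), of j] \<eta>' by simp
  from finite_fclosed_preimage[OF assms(1-3,6) this]
  obtain \<eta>'' where *: "\<eta>'' \<in> R" "1 \<le> \<eta>'' 1 j - hmin \<eta>'' j" "pitp 1 j \<eta>'' = \<eta>'" by blast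
  have "cpath \<eta>''" using assms(2) *(1) unfolding fclosed_def by blast
  then have "\<eta>'' = \<eta>" using assms(4) *(2) 1 *(3)[unfolded \<eta>'] by (rule pitp_inject)
  then show ?thesis using *(1) by simp
qed

text \<open>Walking back requires every intermediate path to be a \<open>cpath\<close>. The second
  closed set, followed forwards, provides this.\<close>

lemma finite_fclosed_backward_rtranclp:
  fixes R B :: "'i path set"
  assumes "finite R" "fclosed R" "\<forall>\<eta>\<in>R. lev0 \<eta>"
    and "fstep\<^sup>*\<^sup>* \<eta> \<eta>'" "\<eta>' \<in> R" "fclosed B" "\<eta> \<in> B"
  shows "\<eta> \<in> R"
proof -
  have "\<eta> \<in> B \<longrightarrow> \<eta> \<in> R" using assms(4)
  proof (rule converse_rtranclp_induct)
    show "\<eta>' \<in> B \<longrightarrow> \<eta>' \<in> R" using assms(5) by blast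
  next
    fix x y assume xy: "fstep x y" and IH: "y \<in> B \<longrightarrow> y \<in> R"
    show "x \<in> B \<longrightarrow> x \<in> R"
    proof
      assume x: "x \<in> B"
      have "y \<in> B" using assms(6) x xy by (rule fclosed_fstep)
      then have y: "y \<in> R" using IH by blast
      have "cpath x" using x assms(6) unfolding fclosed_def by blast
      then show "x \<in> R" using finite_fclosed_backward[OF assms(1-3) _ xy y] by blast
    qed
  qed
  then show ?thesis using assms(7) by blast
qed

end

section \<open>Paths on a uniform grid\<close>

text \<open>The first \<open>n\<close> pieces of a path with mesh \<open>1 / N\<close>; keeping
  \<open>n\<close> apart from \<open>N\<close> makes prefixes objects of the same kind. The
  differences of minima vanish before a piece and are constant after it, so the formula holds for
  all \<open>t\<close>.\<close>

definition gsum :: "nat \<Rightarrow> nat \<Rightarrow> (nat \<Rightarrow> 'i wt) \<Rightarrow> 'i path" where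
  "gsum n N \<nu> t i = (\<Sum>k<n. (min t (real (Suc k) / real N) - min t (real k / real N)) * real_of_int (fst (\<nu> k) i))"

lemma gsum_0 [simp]: "gsum 0 N \<nu> t i = 0"
  and gsum_Suc: "gsum (Suc n) N \<nu> t i = gsum n N \<nu> t i
    + (min t (real (Suc n) / real N) - min t (real n / real N)) * real_of_int (fst (\<nu> n) i)"
  by (simp_all add: gsum_def)

lemma gsum_cong: "(\<And>k. k < n \<Longrightarrow> \<nu> k = \<nu>' k) \<Longrightarrow> gsum n N \<nu> t i = gsum n N \<nu>' t i"
  unfolding gsum_def by (rule sum.cong) auto

lemma gsum_const_tail:
  assumes "m \<le> n" "\<And>k. m \<le> k \<Longrightarrow> k < n \<Longrightarrow> fst (\<nu> k) = fst x"
  shows "gsum n N \<nu> t i = gsum m N \<nu> t i + (min t (real n / real N) - min t (real m / real N)) * real_of_int (fst x i)"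
  using assms
proof (induction n rule: dec_induct)
  case (step n)
  then show ?case by (simp add: gsum_Suc algebra_simps)
qed simp

lemma gsum_ge: "(\<And>k. k < n \<Longrightarrow> t \<ge> real (Suc k) / real N) \<Longrightarrow> gsum n N \<nu> t i = (\<Sum>k<n. real_of_int (fst (\<nu> k) i)) / real N"
  unfolding gsum_def sum_divide_distrib
proof (rule sum.cong[OF HOL.refl])
  fix k assume k: "k \<in> {..<n}" "\<And>k. k < n \<Longrightarrow> t \<ge> real (Suc k) / real N"
  have "real k / real N \<le> real (Suc k) / real N" by (simp add: divide_right_mono)
  moreover have "real (Suc k) / real N \<le> t" using k by simp
  ultimately have "min t (real (Suc k) / real N) = real (Suc k) / real N" "min t (real k / real N) = real k / real N" by auto
  then show "(min t (real (Suc k) / real N) - min t (real k / real N)) * real_of_int (fst (\<nu> k) i) = real_of_int (fst (\<nu> k) i) / real N"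
    by (simp add: algebra_simps add_divide_distrib)
qed

lemma gsum_min: assumes "n \<le> m" shows "gsum n N \<nu> t i = gsum m N \<nu> (min t (real n / real N)) i"
  using assms
proof (induction m rule: dec_induct)
  case base
  show ?case unfolding gsum_def
  proof (rule sum.cong[OF HOL.refl])
    fix k assume "k \<in> {..<n}"
    then have "real (Suc k) / real N \<le> real n / real N" "real k / real N \<le> real n / real N"
      by (auto intro!: divide_right_mono)
    then show "(min t (real (Suc k) / real N) - min t (real k / real N)) * real_of_int (fst (\<nu> k) i) =
      (min (min t (real n / real N)) (real (Suc k) / real N) - min (min t (real n / real N)) (real k / real N)) * real_of_int (fst (\<nu> k) i)"
      by (simp add: min.assoc)
  qed
next
  case (step m)
  have "real n / real N \<le> real m / real N" "real n / real N \<le> real (Suc m) / real N"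
    using step(1) by (auto intro!: divide_right_mono)
  then have "min (min t (real n / real N)) (real (Suc m) / real N) = min (min t (real n / real N)) (real m / real N)" by auto
  then show ?case using step(3) by (simp add: gsum_Suc)
qed

lemma gsum_segment:
  assumes "N > 0" "k < n" "real k / real N \<le> t" "t \<le> real (Suc k) / real N"
  shows "gsum n N \<nu> t i = gsum n N \<nu> (real k / real N) i + (t - real k / real N) * real_of_int (fst (\<nu> k) i)"
proof -
  have 1: "gsum n N \<nu> t i = gsum (Suc k) N \<nu> t i"
    using gsum_min[of "Suc k" n N \<nu> t i] assms(2,4) by (simp add: min_absorb1)
  have le: "real k / real N \<le> real (Suc k) / real N" by (simp add: divide_right_mono)
  have 2: "gsum k N \<nu> t i = gsum n N \<nu> (real k / real N) i"
    using gsum_min[of k n N \<nu> t i] assms(2,3) by (simp add: min_absorb2)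
  show ?thesis unfolding 1 gsum_Suc 2 using assms(3,4) by (simp add: min_absorb1 min_absorb2)
qed

lemma gsum_nonpos: "t \<le> 0 \<Longrightarrow> gsum n N \<nu> t i = 0"
  unfolding gsum_def
proof (rule sum.neutral, rule ballI)
  fix k assume "t \<le> 0"
  then have "t \<le> real (Suc k) / real N" "t \<le> real k / real N" by (auto intro: order_trans)
  then show "(min t (real (Suc k) / real N) - min t (real k / real N)) * real_of_int (fst (\<nu> k) i) = 0"
    by (simp add: min_absorb1)
qed

lemma gsum_ge_one: assumes "N > 0" "t \<ge> 1" shows "gsum N N \<nu> t i = gsum N N \<nu> 1 i"
  using gsum_min[of N N N \<nu> t i] assms by (simp add: min_absorb2)

lemma gsum_grid: "N > 0 \<Longrightarrow> k \<le> n \<Longrightarrow> gsum n N \<nu> (real k / real N) i = (\<Sum>l<k. real_of_int (fst (\<nu> l) i)) / real N"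
proof -
  assume "N > 0" "k \<le> n"
  then have "gsum n N \<nu> (real k / real N) i = gsum k N \<nu> (real k / real N) i"
    using gsum_min[of k n N \<nu> "real k / real N" i] by simp
  also have "\<dots> = (\<Sum>l<k. real_of_int (fst (\<nu> l) i)) / real N"
    by (rule gsum_ge) (auto intro!: divide_right_mono)
  finally show ?thesis .
qed

lemma gsum_continuous: "continuous_on S (\<lambda>t. gsum n N \<nu> t i)"
  unfolding gsum_def by (intro continuous_intros)

lemma grid_segment:
  assumes "N > 0" "t \<in> {0..1}"
  shows "\<exists>k<N. real k / real N \<le> t \<and> t \<le> real (Suc k) / real N"
proof (cases "t = 1")
  case True
  then show ?thesis using assms by (intro exI[of _ "N - 1"]) (auto simp: field_simps of_nat_diff)
next
  case False
  define k where "k = nat \<lfloor>t * N\<rfloor>"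
  have k: "real k \<le> t * N" "t * N < real k + 1" using assms unfolding k_def by auto
  have "t * real N < 1 * real N" using False assms by (intro mult_strict_right_mono) auto
  then have "k < N" using k by linarith
  then show ?thesis using k assms(1) by (intro exI[of _ k]) (auto simp: field_simps)
qed

section \<open>Passing between lists of breaks and uniform grids\<close>

lemma lin_path_snoc:
  assumes "length mus = length ss"
  shows "lin_path (mus @ [x]) (ss @ [s]) t i
    = lin_path mus ss t i + max 0 (min t s - (if ss = [] then 0 else last ss)) * x i"
proof -
  have "lin_path (mus @ [x]) (ss @ [s]) t i
     = (\<Sum>k<length mus. max 0 (min t ((ss @ [s]) ! k) - (if k = 0 then 0 else (ss @ [s]) ! (k - 1))) * ((mus @ [x]) ! k) i)
       + max 0 (min t s - (if ss = [] then 0 else last ss)) * x i"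
    using assms by (auto simp: lin_path_def nth_append last_conv_nth)
  also have "(\<Sum>k<length mus. max 0 (min t ((ss @ [s]) ! k) - (if k = 0 then 0 else (ss @ [s]) ! (k - 1))) * ((mus @ [x]) ! k) i)
     = lin_path mus ss t i"
    unfolding lin_path_def by (rule sum.cong) (use assms in \<open>auto simp: nth_append\<close>)
  finally show ?thesis .
qed

lemma clip_eq: "p \<le> s \<Longrightarrow> max 0 (min t s - p) = min t s - min t (p::real)"
  by (auto simp: max_def min_def)

abbreviation pair_path :: "('i wt \<times> rat) list \<Rightarrow> 'i path" where
  "pair_path ps \<equiv> lin_path (map clw (map fst ps)) (map of_rat (map snd ps))"

lemma pair_path_snoc:
  assumes "ps \<noteq> [] \<Longrightarrow> snd (last ps) \<le> \<sigma>" "0 \<le> \<sigma>"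
  shows "pair_path (ps @ [(x, \<sigma>)]) t i = pair_path ps t i
    + (min t (of_rat \<sigma>) - min t (if ps = [] then 0 else of_rat (snd (last ps)))) * real_of_int (fst x i)"
proof -
  define b :: real where "b = (if ps = [] then 0 else of_rat (snd (last ps)))"
  have le: "b \<le> of_rat \<sigma>" using assms by (auto simp: b_def of_rat_less_eq)
  have b: "(if map of_rat (map snd ps) = [] then 0 else last (map of_rat (map snd ps))) = b"
    by (simp add: b_def last_map)
  have "pair_path (ps @ [(x, \<sigma>)]) t i = pair_path ps t i + (min t (of_rat \<sigma>) - min t b) * clw x i"
    using lin_path_snoc[of "map clw (map fst ps)" "map of_rat (map snd ps)" "clw x" "of_rat \<sigma>" t i]
    unfolding b clip_eq[OF le] by simp
  then show ?thesis by (simp add: b_def clw_def)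
qed

definition increasing :: "('i wt \<times> rat) list \<Rightarrow> bool" where
  "increasing ps \<longleftrightarrow> ps \<noteq> [] \<and> 0 < snd (ps ! 0) \<and> (\<forall>k. Suc k < length ps \<longrightarrow> snd (ps ! k) < snd (ps ! Suc k))"

lemma increasing_snoc: "increasing (ps @ [p]) \<longleftrightarrow>
    (if ps = [] then 0 < snd p else increasing ps \<and> snd (last ps) < snd p)"
proof (cases "ps = []")
  case False
  then have l: "length ps > 0" by simp
  have "(\<forall>k. Suc k < length (ps @ [p]) \<longrightarrow> snd ((ps @ [p]) ! k) < snd ((ps @ [p]) ! Suc k))
     \<longleftrightarrow> (\<forall>k. Suc k < length ps \<longrightarrow> snd (ps ! k) < snd (ps ! Suc k)) \<and> snd (last ps) < snd p" (is "?L \<longleftrightarrow> ?R")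
  proof
    assume L: ?L
    have "snd (last ps) < snd p" using L[rule_format, of "length ps - 1"] l by (simp add: nth_append last_conv_nth)
    moreover have "snd (ps ! k) < snd (ps ! Suc k)" if "Suc k < length ps" for k
      using L[rule_format, of k] that by (simp add: nth_append)
    ultimately show ?R by blast
  next
    assume R: ?R
    show ?L
    proof (intro allI impI)
      fix k assume "Suc k < length (ps @ [p])"
      then consider "Suc k < length ps" | "Suc k = length ps" by fastforce
      then show "snd ((ps @ [p]) ! k) < snd ((ps @ [p]) ! Suc k)"
        using R False by cases (auto simp: nth_append last_conv_nth dest: sym)
    qed
  qed
  then show ?thesis using False l by (simp add: increasing_def nth_append)
qed (simp add: increasing_def)

lemma increasing_last_pos: "increasing ps \<Longrightarrow> 0 < snd (last ps)"
proof (induction ps rule: rev_induct)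
  case (snoc p ps) then show ?case by (auto simp: increasing_snoc split: if_splits)
qed (simp add: increasing_def)

text \<open>Every entry is repeated over the grid cells up to its break. The last clause records
  that the direction can change only at a listed break, together with the position of that break,
  since the chain condition depends on it.\<close>

lemma grid_of_list:
  assumes "N > 0" "increasing ps" "\<forall>p\<in>set ps. \<exists>m::nat. snd p = of_nat m / of_nat N"
    and "snd (last ps) = of_nat n / of_nat N"
  shows "\<exists>\<nu>. (\<forall>t i. pair_path ps t i = gsum n N \<nu> t i) \<and> n > 0 \<and> \<nu> (n - 1) = fst (last ps) \<and>
     (\<forall>k<n. \<nu> k \<in> fst ` set ps) \<and>
     (\<forall>k. Suc k < n \<longrightarrow> \<nu> k = \<nu> (Suc k) \<or> (\<exists>l. Suc l < length ps \<and>
        snd (ps ! l) = of_nat (Suc k) / of_nat N \<and> \<nu> k = fst (ps ! l) \<and> \<nu> (Suc k) = fst (ps ! Suc l)))"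
  using assms(2-)
proof (induction ps arbitrary: n rule: rev_induct)
  case Nil then show ?case by (simp add: increasing_def)
next
  case (snoc p ps)
  obtain x \<sigma> where p: "p = (x, \<sigma>)" by (cases p)
  have \<sigma>: "\<sigma> = of_nat n / of_nat N" using snoc.prems p by simp
  have r\<sigma>: "of_rat \<sigma> = real n / real N" by (simp add: \<sigma> of_rat_divide)
  have "0 < \<sigma>" using increasing_last_pos[OF snoc.prems(1)] p by simp
  then have n0: "n > 0" using \<sigma> by (simp add: zero_less_divide_iff)
  show ?case
  proof (cases "ps = []")
    case True
    have "pair_path (ps @ [p]) t i = gsum n N (\<lambda>_. x) t i" for t i
      using pair_path_snoc[of ps \<sigma> x t i] gsum_const_tail[of 0 n "\<lambda>_. x" x N t i] True p r\<sigma> \<open>0 < \<sigma>\<close>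
      by (simp add: lin_path_def)
    then show ?thesis using n0 True p by (intro exI[of _ "\<lambda>_. x"]) auto
  next
    case False
    have inc: "increasing ps" "snd (last ps) < \<sigma>" using snoc.prems(1) False p by (auto simp: increasing_snoc)
    obtain m :: nat where m: "snd (last ps) = of_nat m / of_nat N" using snoc.prems(2) last_in_set[OF False] by (metis UnI1 set_append)
    obtain \<nu> where \<nu>: "\<And>t i. pair_path ps t i = gsum m N \<nu> t i" "m > 0" "\<nu> (m - 1) = fst (last ps)"
       "\<And>k. k < m \<Longrightarrow> \<nu> k \<in> fst ` set ps"
       "\<And>k. Suc k < m \<Longrightarrow> \<nu> k = \<nu> (Suc k) \<or> (\<exists>l. Suc l < length ps \<and>
        snd (ps ! l) = of_nat (Suc k) / of_nat N \<and> \<nu> k = fst (ps ! l) \<and> \<nu> (Suc k) = fst (ps ! Suc l))"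
      using snoc.IH[OF inc(1) _ m] snoc.prems(2) by auto
    have "m < n" using inc(2) assms(1) unfolding m \<sigma> by (simp add: divide_less_cancel)
    define \<nu>' where "\<nu>' k = (if k < m then \<nu> k else x)" for k
    have "pair_path (ps @ [p]) t i = gsum n N \<nu>' t i" for t i
    proof -
      have "gsum n N \<nu>' t i = gsum m N \<nu>' t i + (min t (real n / real N) - min t (real m / real N)) * real_of_int (fst x i)"
        using \<open>m < n\<close> by (intro gsum_const_tail) (auto simp: \<nu>'_def)
      moreover have "gsum m N \<nu>' t i = gsum m N \<nu> t i" by (rule gsum_cong) (simp add: \<nu>'_def)
      ultimately show ?thesis
        using pair_path_snoc[of ps \<sigma> x t i] False inc(2) \<open>0 < \<sigma>\<close> p r\<sigma> \<nu>(1) m by (simp add: of_rat_divide)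
    qed
    moreover have "\<nu>' (n - 1) = fst (last (ps @ [p]))" using \<open>m < n\<close> p by (auto simp: \<nu>'_def)
    moreover have "\<nu>' k \<in> fst ` set (ps @ [p])" if "k < n" for k using \<nu>(4)[of k] p by (auto simp: \<nu>'_def)
    moreover have "\<nu>' k = \<nu>' (Suc k) \<or> (\<exists>l. Suc l < length (ps @ [p]) \<and>
        snd ((ps @ [p]) ! l) = of_nat (Suc k) / of_nat N \<and> \<nu>' k = fst ((ps @ [p]) ! l) \<and> \<nu>' (Suc k) = fst ((ps @ [p]) ! Suc l))"
      if "Suc k < n" for k
    proof -
      consider "Suc k < m" | "Suc k = m" | "k \<ge> m" by linarith
      then show ?thesis
      proof cases
        case 1
        consider "\<nu> k = \<nu> (Suc k)" | l where "Suc l < length ps" "snd (ps ! l) = of_nat (Suc k) / of_nat N"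
          "\<nu> k = fst (ps ! l)" "\<nu> (Suc k) = fst (ps ! Suc l)" using \<nu>(5)[OF 1] by blast
        then show ?thesis
        proof cases
          case 2
          then show ?thesis using 1 by (intro disjI2 exI[of _ l]) (auto simp: nth_append \<nu>'_def)
        qed (use 1 in \<open>auto simp: \<nu>'_def\<close>)
      next
        case 2
        have "k = m - 1" using 2 by simp
        then show ?thesis using 2 False m \<nu>(3) p
          by (intro disjI2 exI[of _ "length ps - 1"]) (auto simp: nth_append \<nu>'_def last_conv_nth)
      qed (auto simp: \<nu>'_def)
    qed
    ultimately show ?thesis using n0 by blast
  qed
qed

text \<open>The converse passage has to merge equal neighbours, because consecutive directions of an
  LS path must be strictly decreasing.\<close>

lemma list_of_grid:
  assumes "N > 0" "n > 0" "\<And>k. Suc k < n \<Longrightarrow> \<nu> k = \<nu> (Suc k) \<or> R (Suc k) (\<nu> k) (\<nu> (Suc k))"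
  shows "\<exists>ps. increasing ps \<and> last ps = (\<nu> (n - 1), of_nat n / of_nat N) \<and> fst ` set ps \<subseteq> \<nu> ` {..<n} \<and>
     (\<forall>l. Suc l < length ps \<longrightarrow> (\<exists>q. snd (ps ! l) = of_nat q / of_nat N \<and> R q (fst (ps ! l)) (fst (ps ! Suc l)))) \<and>
     (\<forall>t i. pair_path ps t i = gsum n N \<nu> t i)"
  using assms(2,3)
proof (induction n rule: nat_induct_non_zero)
  case 1
  have "pair_path [(\<nu> 0, 1 / of_nat N)] t i = gsum 1 N \<nu> t i" for t i
    using pair_path_snoc[of "[]" "1 / of_nat N" "\<nu> 0" t i] by (simp add: lin_path_def gsum_def of_rat_divide)
  then show ?case using assms(1) by (intro exI[of _ "[(\<nu> 0, 1 / of_nat N)]"]) (simp add: increasing_def)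
next
  case (Suc n)
  then obtain ps where ps: "increasing ps" "last ps = (\<nu> (n - 1), of_nat n / of_nat N)" "fst ` set ps \<subseteq> \<nu> ` {..<n}"
     "\<And>l. Suc l < length ps \<Longrightarrow> (\<exists>q. snd (ps ! l) = of_nat q / of_nat N \<and> R q (fst (ps ! l)) (fst (ps ! Suc l)))"
     "\<And>t i. pair_path ps t i = gsum n N \<nu> t i" by force
  have ne: "ps \<noteq> []" using ps(1) by (simp add: increasing_def)
  let ?s = "of_nat (Suc n) / of_nat N :: rat"
  have s: "of_nat n / of_nat N < ?s" "of_rat ?s = real (Suc n) / real N" using assms(1)
    by (simp add: divide_strict_right_mono, simp only: of_rat_divide of_rat_of_nat_eq)
  show ?case
  proof (cases "\<nu> n = \<nu> (n - 1)")
    case True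
    \<comment> \<open>The new cell continues the last direction, so the last break is moved to the
      right instead of adding an entry.\<close>
    obtain qs where qs: "ps = qs @ [(\<nu> n, of_nat n / of_nat N)]"
      using ne ps(2) True by (metis append_butlast_last_id)
    have qn: "qs \<noteq> [] \<Longrightarrow> snd (last qs) < of_nat n / of_nat N" using ps(1) qs by (auto simp: increasing_snoc)
    let ?ps = "qs @ [(\<nu> n, ?s)]"
    have "increasing ?ps" using ps(1) s(1) qn assms(1) Suc(1) unfolding qs by (auto simp: increasing_snoc split: if_splits)
    moreover have "pair_path ?ps t i = gsum (Suc n) N \<nu> t i" for t i
    proof -
      have le: "qs \<noteq> [] \<Longrightarrow> snd (last qs) \<le> ?s" using qn s(1) by force
      have "pair_path ps t i = pair_path qs t i + (min t (real n / real N) - min t (if qs = [] then 0 else of_rat (snd (last qs)))) * real_of_int (fst (\<nu> n) i)"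
        unfolding qs using pair_path_snoc[of qs "of_nat n / of_nat N" "\<nu> n" t i] qn by (force simp: of_rat_divide)
      moreover have "pair_path ?ps t i = pair_path qs t i + (min t (real (Suc n) / real N) - min t (if qs = [] then 0 else of_rat (snd (last qs)))) * real_of_int (fst (\<nu> n) i)"
        using pair_path_snoc[of qs ?s "\<nu> n" t i] le s(2) by simp
      moreover have "P + (q - b) * y = P + (r - b) * y + (q - r) * y" for P q b r y :: real
        by (simp add: algebra_simps)
      ultimately show ?thesis unfolding gsum_Suc ps(5)[symmetric] by simp
    qed
    moreover have "\<exists>q. snd (?ps ! l) = of_nat q / of_nat N \<and> R q (fst (?ps ! l)) (fst (?ps ! Suc l))"
      if "Suc l < length ?ps" for l
    proof -
      have "Suc l < length ps" using that qs by simp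
      moreover have "snd (ps ! l) = snd (?ps ! l)" "fst (ps ! l) = fst (?ps ! l)" "fst (ps ! Suc l) = fst (?ps ! Suc l)"
        using that unfolding qs by (auto simp: nth_append)
      ultimately show ?thesis using ps(4)[of l] by simp
    qed
    moreover have "fst ` set ?ps \<subseteq> \<nu> ` {..<Suc n}" using ps(3) unfolding qs by fastforce
    ultimately show ?thesis by (intro exI[of _ ?ps]) auto
  next
    case False
    let ?ps = "ps @ [(\<nu> n, ?s)]"
    have R: "R n (\<nu> (n - 1)) (\<nu> n)" using Suc(3)[of "n - 1"] Suc(1) False by auto
    have "increasing ?ps" using ps(1,2) s(1) ne by (simp add: increasing_snoc)
    moreover have "pair_path ?ps t i = gsum (Suc n) N \<nu> t i" for t i
      using pair_path_snoc[of ps ?s "\<nu> n" t i] ps(2) s(1) ne unfolding gsum_Suc ps(5)[symmetric]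
      by (simp add: of_rat_divide of_rat_add)
    moreover have "\<exists>q. snd (?ps ! l) = of_nat q / of_nat N \<and> R q (fst (?ps ! l)) (fst (?ps ! Suc l))"
      if "Suc l < length ?ps" for l
    proof (cases "Suc l < length ps")
      case True
      then show ?thesis using ps(4)[of l] by (simp add: nth_append)
    next
      case False
      then have "l = length ps - 1" "Suc l = length ps" using that ne by auto
      then have "?ps ! l = (\<nu> (n - 1), of_nat n / of_nat N)" "?ps ! Suc l = (\<nu> n, ?s)"
        using ps(2) ne by (auto simp: nth_append last_conv_nth)
      then show ?thesis using R by auto
    qed
    moreover have "fst ` set ?ps \<subseteq> \<nu> ` {..<Suc n}" using ps(3) by fastforce
    ultimately show ?thesis by (intro exI[of _ ?ps]) auto
  qed
qed

section \<open>Lakshmibai-Seshadri paths\<close>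

lemma Ints_of_rat: "q \<in> \<int> \<Longrightarrow> (of_rat q :: real) \<in> \<int>"
  by (elim Ints_cases) simp

lemma Ints_mult_dvd:
  assumes "x * real_of_int s \<in> \<int>" "s dvd int N" shows "x * real N \<in> \<int>"
proof -
  obtain q where "int N = s * q" using assms(2) by (rule dvdE)
  then have "real_of_int (int N) = real_of_int (s * q)" by (rule arg_cong)
  then have "x * real N = (x * real_of_int s) * real_of_int q" by simp
  moreover have "x * real_of_int s * real_of_int q \<in> \<int>" using assms(1) by (rule Ints_mult) simp
  ultimately show ?thesis by (simp only:)
qed

lemma Ints_no_between: assumes "x \<in> \<int>" "real k < x" "x < real (Suc k)" shows False
proof -
  obtain z where z: "x = real_of_int z" using assms(1) by (rule Ints_cases)
  have "real_of_int (int k) < real_of_int z" "real_of_int z < real_of_int (int k + 1)" using assms(2,3) z by simp_all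
  then have "int k < z" "z < int k + 1" by (simp_all only: of_int_less_iff)
  then show False by simp
qed

text \<open>In a sigma-step \<open>\<sigma> * p\<close> is an integer for a nonzero pairing
  \<open>p\<close> of an orbit element. If all such pairings divide \<open>N\<close>, every turning
  point is a multiple of \<open>1 / N\<close>, and one grid serves all LS paths.\<close>

lemma (in level_zero_orbit) exists_grid_size:
  "\<exists>N>0. \<forall>f\<in>cO. \<forall>j. f j \<noteq> 0 \<longrightarrow> f j dvd int N"
proof -
  \<comment> \<open>Vanishing pairings are replaced by 1, to keep the product over the finite set
    positive.\<close>
  let ?g = "\<lambda>(f, j). if f j = 0 then 1 else \<bar>f j\<bar>"
  let ?S = "cO \<times> (UNIV :: 'i set)"
  let ?P = "\<Prod>s\<in>?S. ?g s"
  have fin: "finite ?S" using finite_cO by simp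
  have "?P > 0" by (rule prod_pos) auto
  moreover have "f j dvd ?P" if "f \<in> cO" "f j \<noteq> 0" for f j
  proof -
    have "?g (f, j) dvd ?P" by (rule dvd_prodI[OF fin]) (use that in auto)
    then show ?thesis using that(2) by simp
  qed
  ultimately show ?thesis by (intro exI[of _ "nat ?P"]) auto
qed

locale grid_orbit = level_zero_orbit A i0 a v lam
  for A :: "'i::finite \<Rightarrow> 'i \<Rightarrow> int" and i0 :: 'i and a v :: "'i \<Rightarrow> int" and lam :: "'i wt" +
  fixes N :: nat
  assumes N_pos: "N > 0" and N_dvd: "f \<in> cO \<Longrightarrow> f j \<noteq> 0 \<Longrightarrow> f j dvd int N"
begin

abbreviation gpath :: "(nat \<Rightarrow> 'i wt) \<Rightarrow> 'i path" where
  "gpath \<nu> \<equiv> gsum N N \<nu>"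

abbreviation sstep :: "nat \<Rightarrow> 'i wt \<Rightarrow> 'i wt \<Rightarrow> bool" where
  "sstep q \<equiv> sigma_step A i0 (of_nat q / of_nat N)"

text \<open>The reflexive closure allows no turn at a grid point, so that all LS paths of the given
  shape are described by sequences of the same length.\<close>

definition LSg :: "(nat \<Rightarrow> 'i wt) \<Rightarrow> bool" where
  "LSg \<nu> \<longleftrightarrow> (\<forall>k<N. \<nu> k \<in> Orb) \<and> (\<forall>k. Suc k < N \<longrightarrow> (sstep (Suc k))\<^sup>*\<^sup>* (\<nu> k) (\<nu> (Suc k)))"

lemma sstep_diff_int:
  assumes "(sstep q)\<^sup>*\<^sup>* x y"
  shows "real q / real N * real_of_int (fst x k) - real q / real N * real_of_int (fst y k) \<in> \<int>"
  using Ints_of_rat[OF sigma_step_diff_int[OF assms, of k]]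
  by (simp add: of_rat_diff of_rat_mult of_rat_divide)

lemma sigma_grid:
  assumes "x \<in> Orb" "sigma_step A i0 \<sigma> x y" "0 < \<sigma>"
  shows "\<exists>m::nat. \<sigma> = of_nat m / of_nat N"
proof -
  obtain p :: int and m :: int where p: "refl_data A i0 x y p" and m: "m < 0" "\<sigma> * of_int p = of_int m"
    using assms(2) unfolding sigma_step_iff by blast
  obtain ws j where "p = fst (wact A i0 (rev ws) x) j" using p unfolding refl_data_iff by blast
  moreover have "p \<noteq> 0" using m by auto
  ultimately have "p dvd int N" using N_dvd[OF imageI[OF wact_Orb[OF assms(1)]]] by blast
  then obtain q where q: "int N = p * q" by (rule dvdE)
  then have "rat_of_int (int N) = rat_of_int (p * q)" by (rule arg_cong)
  then have "\<sigma> * of_nat N = (\<sigma> * of_int p) * of_int q" by simp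
  then have eq: "\<sigma> * of_nat N = of_int (m * q)" using m(2) by simp
  have "0 < \<sigma> * of_nat N" using assms(3) N_pos by simp
  then have "m * q > 0" unfolding eq by (simp only: of_int_0_less_iff)
  then have "rat_of_nat (nat (m * q)) = of_int (m * q)" by (simp only: of_nat_nat less_imp_le)
  then have "\<sigma> * of_nat N = of_nat (nat (m * q))" using eq by (simp only:)
  then show ?thesis using N_pos by (intro exI[of _ "nat (m * q)"]) (simp add: field_simps)
qed

lemma LS_imp_grid:
  assumes "is_LS A i0 lam nus sigmas"
  shows "\<exists>\<nu>. LSg \<nu> \<and> lin_path (map clw nus) (map of_rat sigmas) = gpath \<nu>"
proof -
  define ps where "ps = zip nus sigmas"
  have LS: "nus \<noteq> []" "length sigmas = length nus" "set nus \<subseteq> Orb" "0 < sigmas ! 0" "last sigmas = 1"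
    "\<And>k. Suc k < length nus \<Longrightarrow> sigmas ! k < sigmas ! Suc k \<and> sigma_chain A i0 (sigmas ! k) (nus ! k) (nus ! Suc k)"
    using assms unfolding is_LS_def by auto
  have fs: "map fst ps = nus" "map snd ps = sigmas" and len: "length ps = length nus" using LS(2) by (simp_all add: ps_def)
  have fs': "fst (ps ! k) = nus ! k" "snd (ps ! k) = sigmas ! k" if "k < length ps" for k
    using that len LS(2) by (simp_all add: ps_def)
  have inc: "increasing ps" unfolding increasing_def using LS len fs' by (auto simp: length_greater_0_conv)
  have last: "snd (last ps) = of_nat N / of_nat N"
    using LS(1,5) fs(2) len N_pos by (metis divide_self last_map length_0_conv of_nat_eq_0_iff less_numeral_extra(3))
  have pos: "0 < sigmas ! k" if "k < length nus" for k
    using that by (induction k) (use LS(4,6) in \<open>force+\<close>)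
  have grid: "\<exists>m::nat. snd p = of_nat m / of_nat N" if mem: "p \<in> set ps" for p
  proof -
    obtain k where k: "k < length ps" "p = ps ! k" using mem by (auto simp: in_set_conv_nth)
    show ?thesis
    proof (cases "Suc k < length ps")
      case True
      then have "sigma_chain A i0 (sigmas ! k) (nus ! k) (nus ! Suc k)" using LS(6) len by simp
      then obtain y where y: "sigma_step A i0 (sigmas ! k) (nus ! k) y"
        unfolding sigma_chain_def by (blast dest: tranclpD)
      have "k < length nus" using k(1) len by simp
      then have "nus ! k \<in> Orb" using LS(3) nth_mem by blast
      from sigma_grid[OF this y pos[OF \<open>k < length nus\<close>]] show ?thesis using fs'(2)[OF k(1)] k(2) by simp
    next
      case False
      then have "length ps = Suc k" using k(1) by simp
      then have "p = last ps" using k(2) by (subst last_conv_nth) auto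
      then show ?thesis using last by blast
    qed
  qed
  obtain \<nu> where \<nu>: "\<And>t i. pair_path ps t i = gpath \<nu> t i" "\<And>k. k < N \<Longrightarrow> \<nu> k \<in> fst ` set ps"
     "\<And>k. Suc k < N \<Longrightarrow> \<nu> k = \<nu> (Suc k) \<or> (\<exists>l. Suc l < length ps \<and>
        snd (ps ! l) = of_nat (Suc k) / of_nat N \<and> \<nu> k = fst (ps ! l) \<and> \<nu> (Suc k) = fst (ps ! Suc l))"
    using grid_of_list[OF N_pos inc _ last] grid by blast
  have "(sstep (Suc k))\<^sup>*\<^sup>* (\<nu> k) (\<nu> (Suc k))" if "Suc k < N" for k
    using \<nu>(3)[OF that]
  proof (elim disjE exE conjE)
    fix l assume l: "Suc l < length ps" "snd (ps ! l) = of_nat (Suc k) / of_nat N" "\<nu> k = fst (ps ! l)" "\<nu> (Suc k) = fst (ps ! Suc l)"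
    have "sigma_chain A i0 (sigmas ! l) (nus ! l) (nus ! Suc l)" using LS(6) l(1) len by simp
    then have "sigma_chain A i0 (of_nat (Suc k) / of_nat N) (\<nu> k) (\<nu> (Suc k))"
      using l fs'[of l] fs'[of "Suc l"] by simp
    then show ?thesis unfolding sigma_chain_def by (rule tranclp_into_rtranclp)
  qed simp
  moreover have "\<nu> k \<in> Orb" if "k < N" for k
    using \<nu>(2)[OF that] LS(3) fs(1) by (metis list.set_map subsetD)
  ultimately have "LSg \<nu>" unfolding LSg_def by blast
  moreover have "lin_path (map clw nus) (map of_rat sigmas) = gpath \<nu>"
    using \<nu>(1) unfolding fs by (intro ext)
  ultimately show ?thesis by blast
qed

lemma sstep_rstep: "sstep q x y \<Longrightarrow> rstep x y"
  by (simp add: sigma_step_def dist_one_def)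

lemma grid_imp_LS:
  assumes "LSg \<nu>" shows "gpath \<nu> \<in> LS_cl A i0 lam"
proof -
  let ?R = "\<lambda>q x y. sigma_chain A i0 (of_nat q / of_nat N) x y"
  have "\<nu> k = \<nu> (Suc k) \<or> ?R (Suc k) (\<nu> k) (\<nu> (Suc k))" if "Suc k < N" for k
    using assms that unfolding LSg_def sigma_chain_def by (meson rtranclpD)
  then obtain ps where ps: "increasing ps" "last ps = (\<nu> (N - 1), of_nat N / of_nat N)" "fst ` set ps \<subseteq> \<nu> ` {..<N}"
     "\<And>l. Suc l < length ps \<Longrightarrow> (\<exists>q. snd (ps ! l) = of_nat q / of_nat N \<and> ?R q (fst (ps ! l)) (fst (ps ! Suc l)))"
     "\<And>t i. pair_path ps t i = gpath \<nu> t i"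
    using list_of_grid[OF N_pos N_pos, where R = ?R] by metis
  have ne: "ps \<noteq> []" using ps(1) by (simp add: increasing_def)
  have gt: "wt_gt A i0 x y" if "?R q x y" for q x y
  proof -
    have "rstep\<^sup>+\<^sup>+ x y" using that unfolding sigma_chain_def
      by (induction rule: tranclp_induct) (auto intro: sstep_rstep tranclp.intros)
    then show ?thesis unfolding wt_gt_def wt_ge_def using rstep_acyclic tranclp_into_rtranclp by metis
  qed
  have "is_LS A i0 lam (map fst ps) (map snd ps)"
    unfolding is_LS_def
  proof (intro conjI allI impI)
    show "set (map fst ps) \<subseteq> Orb" using ps(3) assms unfolding LSg_def by auto
    show "0 < map snd ps ! 0" using ps(1) ne by (simp add: increasing_def)
    show "last (map snd ps) = 1" using ps(2) ne N_pos by (simp add: last_map)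
  next
    fix k assume k: "Suc k < length (map fst ps)"
    obtain q where q: "snd (ps ! k) = of_nat q / of_nat N" "?R q (fst (ps ! k)) (fst (ps ! Suc k))"
      using ps(4)[of k] k by auto
    show "wt_gt A i0 (map fst ps ! k) (map fst ps ! Suc k)" using gt[OF q(2)] k by simp
    show "map snd ps ! k < map snd ps ! Suc k" using ps(1) k by (simp add: increasing_def)
    show "sigma_chain A i0 (map snd ps ! k) (map fst ps ! k) (map fst ps ! Suc k)" using q k by simp
  qed (use ne in auto)
  moreover have "gpath \<nu> = lin_path (map clw (map fst ps)) (map of_rat (map snd ps))"
    using ps(5) by (intro ext) simp
  ultimately show ?thesis unfolding LS_cl_def by blast
qed

lemma LS_cl_eq: "LS_cl A i0 lam = {gpath \<nu> | \<nu>. LSg \<nu>}"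
proof
  show "LS_cl A i0 lam \<subseteq> {gpath \<nu> | \<nu>. LSg \<nu>}"
    unfolding LS_cl_def using LS_imp_grid by blast
  show "{gpath \<nu> | \<nu>. LSg \<nu>} \<subseteq> LS_cl A i0 lam" using grid_imp_LS by blast
qed

text \<open>A path does not see \<delta>-coordinates, so a grid path is given by \<open>N\<close>
  members of the finite set \<open>cO\<close>.\<close>

lemma finite_LS_cl: "finite (LS_cl A i0 lam)"
proof -
  let ?F = "{f. \<forall>k. (k \<in> {..<N} \<longrightarrow> f k \<in> cO) \<and> (k \<notin> {..<N} \<longrightarrow> f k = (\<lambda>_. 0))}"
  let ?g = "\<lambda>f. gsum N N (\<lambda>k. (f k, 0 :: int))"
  have "LS_cl A i0 lam \<subseteq> ?g ` ?F"
  proof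
    fix \<eta> assume "\<eta> \<in> LS_cl A i0 lam"
    then obtain \<nu> where \<nu>: "\<eta> = gpath \<nu>" "LSg \<nu>" unfolding LS_cl_eq by blast
    let ?f = "\<lambda>k. if k < N then fst (\<nu> k) else (\<lambda>_. 0)"
    have f: "?f \<in> ?F" using \<nu>(2) unfolding LSg_def by simp
    have eq: "\<eta> = ?g ?f" unfolding \<nu>(1) by (intro ext) (simp add: gsum_def)
    show "\<eta> \<in> ?g ` ?F" unfolding eq by (rule imageI[of ?f ?F ?g, OF f])
  qed
  moreover have "finite ?F" by (rule finite_set_of_finite_funs) (use finite_cO in auto)
  ultimately show ?thesis by (rule finite_subset[OF _ finite_imageI])
qed

lemma lev0_gpath: assumes "\<And>k. k < M \<Longrightarrow> \<nu> k \<in> Orb" "M > 0" shows "lev0 (gsum M M \<nu>)"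
proof -
  have "gsum M M \<nu> 1 i = (\<Sum>k<M. real_of_int (fst (\<nu> k) i)) / real M" for i
    using gsum_grid[of M M M \<nu> i] assms(2) by simp
  then have "(\<Sum>j\<in>UNIV. real_of_int (v j) * gsum M M \<nu> 1 j)
     = (\<Sum>j\<in>UNIV. \<Sum>k<M. real_of_int (v j) * real_of_int (fst (\<nu> k) j)) / real M"
    by (simp add: sum_divide_distrib sum_distrib_left)
  also have "(\<Sum>j\<in>UNIV. \<Sum>k<M. real_of_int (v j) * real_of_int (fst (\<nu> k) j))
     = (\<Sum>k<M. \<Sum>j\<in>UNIV. real_of_int (v j) * real_of_int (fst (\<nu> k) j))" by (rule sum.swap)
  also have "\<dots> = 0"
  proof (rule sum.neutral, rule ballI)
    fix k assume "k \<in> {..<M}"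
    then have "(\<Sum>j\<in>UNIV. v j * fst (\<nu> k) j) = 0" using level_zero assms(1) by blast
    then have "real_of_int (\<Sum>j\<in>UNIV. v j * fst (\<nu> k) j) = 0" by simp
    then show "(\<Sum>j\<in>UNIV. real_of_int (v j) * real_of_int (fst (\<nu> k) j)) = 0" by simp
  qed
  finally show ?thesis unfolding lev0_def by simp
qed

section \<open>Heights of an LS path modulo integers\<close>

context
  fixes \<nu> assumes LS: "LSg \<nu>"
begin

lemma slope_dvd: "k < N \<Longrightarrow> fst (\<nu> k) j \<noteq> 0 \<Longrightarrow> fst (\<nu> k) j dvd int N"
  using LS N_dvd unfolding LSg_def by blast

text \<open>Modulo integers, a Lakshmibai-Seshadri path has the same height at \<open>t\<close> as the straight line in its
  current direction.\<close>

lemma height_cong: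
  assumes "k < N" "real k / real N \<le> t" "t \<le> real (Suc k) / real N"
  shows "gpath \<nu> t j - t * real_of_int (fst (\<nu> k) j) \<in> \<int>"
proof -
  have grid: "gpath \<nu> (real k / real N) j - real k / real N * real_of_int (fst (\<nu> k) j) \<in> \<int>" if "k < N" for k
    using that
  proof (induction k)
    case 0 then show ?case using gsum_nonpos[of 0 N N \<nu> j] by simp
  next
    case (Suc k)
    let ?s = "real (Suc k) / real N"
    have "(sstep (Suc k))\<^sup>*\<^sup>* (\<nu> k) (\<nu> (Suc k))" using LS Suc.prems unfolding LSg_def by blast
    then have 1: "?s * real_of_int (fst (\<nu> k) j) - ?s * real_of_int (fst (\<nu> (Suc k)) j) \<in> \<int>" by (rule sstep_diff_int)
    have "gpath \<nu> ?s j = gpath \<nu> (real k / real N) j + (?s - real k / real N) * real_of_int (fst (\<nu> k) j)"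
      using Suc.prems N_pos by (intro gsum_segment) (auto intro!: divide_right_mono)
    then have "gpath \<nu> ?s j - ?s * real_of_int (fst (\<nu> (Suc k)) j)
       = (gpath \<nu> (real k / real N) j - real k / real N * real_of_int (fst (\<nu> k) j))
         + (?s * real_of_int (fst (\<nu> k) j) - ?s * real_of_int (fst (\<nu> (Suc k)) j))"
      by (simp only: left_diff_distrib)
    also have "\<dots> \<in> \<int>" using Suc 1 by (intro Ints_add) simp_all
    finally show ?case .
  qed
  have "gpath \<nu> t j - t * real_of_int (fst (\<nu> k) j)
     = gpath \<nu> (real k / real N) j - real k / real N * real_of_int (fst (\<nu> k) j)"
    unfolding gsum_segment[OF N_pos assms, of \<nu> j] by (simp only: left_diff_distrib)
  then show ?thesis using grid[OF assms(1)] by simp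
qed

text \<open>An integral height makes \<open>t\<close> times the slope integral. A nonzero slope
  divides \<open>N\<close>, so \<open>t\<close> would lie on the grid.\<close>

lemma height_int_grid:
  assumes "k < N" "real k / real N < t" "t < real (Suc k) / real N" "gpath \<nu> t j \<in> \<int>"
  shows "fst (\<nu> k) j = 0"
proof (rule ccontr)
  assume nz: "fst (\<nu> k) j \<noteq> 0"
  have "t * real_of_int (fst (\<nu> k) j) \<in> \<int>"
    using Ints_diff[OF assms(4) height_cong[OF assms(1), of t j]] assms(2,3) by simp
  then have "t * real N \<in> \<int>" using slope_dvd[OF assms(1) nz] by (rule Ints_mult_dvd)
  moreover have "real k < t * real N" "t * real N < real (Suc k)" using assms(2,3) N_pos by (simp_all add: field_simps)
  ultimately show False by (rule Ints_no_between)
qed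

lemma grid_le: "real k / real N \<le> real (Suc k) / real N" "real k / real N < real (Suc k) / real N"
  using N_pos by (simp_all add: divide_right_mono divide_strict_right_mono)

lemma grid_mem: "k \<le> N \<Longrightarrow> real k / real N \<in> {0..1}"
  using N_pos by simp

lemma segment:
  assumes "k < N" "real k / real N \<le> t" "t \<le> real (Suc k) / real N"
  shows "gpath \<nu> t j = gpath \<nu> (real k / real N) j + (t - real k / real N) * real_of_int (fst (\<nu> k) j)"
  using N_pos assms by (rule gsum_segment)

lemma segment_right:
  assumes "k < N" "real k / real N \<le> t" "t \<le> real (Suc k) / real N"
  shows "gpath \<nu> t j = gpath \<nu> (real (Suc k) / real N) j - (real (Suc k) / real N - t) * real_of_int (fst (\<nu> k) j)"
  using segment[OF assms, of j] segment[OF assms(1) grid_le(1) order_refl, of j] by (simp only: left_diff_distrib)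

text \<open>A chain that starts with nonpositive pairing cannot be reflected as a whole, so the
  crossing alternative of \<open>sigma_chain_cross\<close> holds. Its integral pairing is carried
  back to \<open>\<nu> k\<close> by \<open>sstep_diff_int\<close>.\<close>

lemma crossing_int:
  assumes "Suc k < N" "fst (\<nu> k) j \<le> 0" "fst (\<nu> (Suc k)) j > 0"
  shows "gpath \<nu> (real (Suc k) / real N) j \<in> \<int>" "(sstep (Suc k))\<^sup>*\<^sup>* (\<nu> k) (sr j (\<nu> (Suc k)))"
proof -
  let ?s = "real (Suc k) / real N"
  have ch: "(sstep (Suc k))\<^sup>*\<^sup>* (\<nu> k) (\<nu> (Suc k))" using LS assms(1) unfolding LSg_def by blast
  from sigma_chain_cross[OF ch assms(3)] assms(2) obtain z where
    z: "(sstep (Suc k))\<^sup>*\<^sup>* (\<nu> k) z" "of_nat (Suc k) / of_nat N * rat_of_int (fst z j) \<in> \<int>"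
    and sr: "(sstep (Suc k))\<^sup>*\<^sup>* (\<nu> k) (sr j (\<nu> (Suc k)))" by auto
  show "(sstep (Suc k))\<^sup>*\<^sup>* (\<nu> k) (sr j (\<nu> (Suc k)))" by (rule sr)
  have "?s * real_of_int (fst z j) \<in> \<int>" using Ints_of_rat[OF z(2)] by (simp add: of_rat_mult of_rat_divide of_rat_add)
  then have "?s * real_of_int (fst (\<nu> k) j) \<in> \<int>" using Ints_add[OF sstep_diff_int[OF z(1), of j]] by fastforce
  then show "gpath \<nu> ?s j \<in> \<int>" using Ints_add[OF height_cong[of k ?s j]] grid_le assms(1) by fastforce
qed

end

end

declare of_nat_Suc [simp del]

context grid_orbit
begin

lemma grid_less_iff: "real k / real N < real l / real N \<longleftrightarrow> k < l"
  and grid_le_iff: "real k / real N \<le> real l / real N \<longleftrightarrow> k \<le> l"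
  using N_pos by (simp_all add: divide_less_cancel divide_le_cancel)

section \<open>Integral local minima and stability under \<open>f_j\<close>\<close>

context
  fixes \<nu> assumes LS: "LSg \<nu>"
begin

lemma height_one_int: "gpath \<nu> 1 j \<in> \<int>"
proof -
  obtain M where M: "Suc M = N" using N_pos gr0_implies_Suc by metis
  have 1: "1 \<le> real (Suc M) / real N" "real M / real N \<le> 1" using grid_mem[OF LS, of M] N_pos M by auto
  have "M < N" using M by simp
  have "gpath \<nu> 1 j - 1 * real_of_int (fst (\<nu> M) j) \<in> \<int>" using \<open>M < N\<close> 1(2,1) by (rule height_cong[OF LS])
  from Ints_add[OF this Ints_of_int[of "fst (\<nu> M) j"]] show ?thesis by simp
qed

lemma slope_of_local_min:
  assumes "k < N" "\<epsilon> > 0" "t \<in> {0..1}" "\<forall>s\<in>{0..1}. \<bar>s - t\<bar> < \<epsilon> \<longrightarrow> gpath \<nu> t j \<le> gpath \<nu> s j"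
  shows "real k / real N \<le> t \<Longrightarrow> t < real (Suc k) / real N \<Longrightarrow> fst (\<nu> k) j \<ge> 0"
    and "real k / real N < t \<Longrightarrow> t \<le> real (Suc k) / real N \<Longrightarrow> fst (\<nu> k) j \<le> 0"
proof -
  have m: "real k / real N \<in> {0..1}" "real (Suc k) / real N \<in> {0..1}"
    using grid_mem[OF LS, of k] grid_mem[OF LS, of "Suc k"] assms(1) by auto
  let ?s = "real_of_int (fst (\<nu> k) j)"
  {
    assume t: "real k / real N \<le> t" "t < real (Suc k) / real N"
    define \<delta> where "\<delta> = min (\<epsilon> / 2) (real (Suc k) / real N - t)"
    have "\<delta> \<le> \<epsilon> / 2" "\<delta> \<le> real (Suc k) / real N - t" "\<delta> > 0"
      unfolding \<delta>_def by (rule min.cobounded1, rule min.cobounded2) (use t assms(2) in simp)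
    then have \<delta>: "\<delta> > 0" "\<delta> < \<epsilon>" "t + \<delta> \<le> real (Suc k) / real N" using assms(2) by linarith+
    have "gpath \<nu> t j \<le> gpath \<nu> (t + \<delta>) j" using \<delta> assms(3) m by (intro assms(4)[rule_format]) auto
    then have "(t - real k / real N) * ?s \<le> (t + \<delta> - real k / real N) * ?s"
      using segment[OF LS assms(1), of t j] segment[OF LS assms(1), of "t + \<delta>" j] t \<delta> by simp
    then have "0 \<le> \<delta> * ?s" by (simp add: algebra_simps)
    then show "fst (\<nu> k) j \<ge> 0" using \<delta>(1) by (simp add: zero_le_mult_iff)
  }
  {
    assume t: "real k / real N < t" "t \<le> real (Suc k) / real N"
    define \<delta> where "\<delta> = min (\<epsilon> / 2) (t - real k / real N)"
    have "\<delta> \<le> \<epsilon> / 2" "\<delta> \<le> t - real k / real N" "\<delta> > 0"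
      unfolding \<delta>_def by (rule min.cobounded1, rule min.cobounded2) (use t assms(2) in simp)
    then have \<delta>: "\<delta> > 0" "\<delta> < \<epsilon>" "real k / real N \<le> t - \<delta>" using assms(2) by linarith+
    have "0 \<le> real k / real N" by simp
    then have "0 \<le> t - \<delta>" using \<delta>(3) by linarith
    then have "gpath \<nu> t j \<le> gpath \<nu> (t - \<delta>) j" using \<delta> assms(3) by (intro assms(4)[rule_format]) auto
    then have "(t - real k / real N) * ?s \<le> (t - \<delta> - real k / real N) * ?s"
      using segment[OF LS assms(1), of t j] segment[OF LS assms(1), of "t - \<delta>" j] t \<delta> by simp
    then have "\<delta> * ?s \<le> 0" by (simp add: algebra_simps)
    then show "fst (\<nu> k) j \<le> 0" using \<delta>(1) by (simp add: mult_le_0_iff)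
  }
qed

text \<open>A local minimum lies at an end of the path, on a flat segment, or at a grid point where
  the slope becomes positive. On a flat segment \<open>height_cong\<close> gives integrality; at an
  upward turn \<open>crossing_int\<close> does.\<close>

lemma local_min_int:
  assumes "t \<in> {0..1}" "\<epsilon> > 0" "\<forall>s\<in>{0..1}. \<bar>s - t\<bar> < \<epsilon> \<longrightarrow> gpath \<nu> t j \<le> gpath \<nu> s j"
  shows "gpath \<nu> t j \<in> \<int>"
proof -
  note slope = slope_of_local_min[OF _ assms(2,1) assms(3)]
  obtain k where k: "k < N" "real k / real N \<le> t" "t \<le> real (Suc k) / real N"
    using grid_segment[OF N_pos assms(1)] by blast
  show ?thesis
  proof (cases "fst (\<nu> k) j = 0")
    case True
    then show ?thesis using height_cong[OF LS k, of j] by simp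
  next
    case nz: False
    consider "t = 0" | "t = 1" | "t = real k / real N" "t \<noteq> 0" | "t = real (Suc k) / real N" "t \<noteq> 1"
      using slope(1)[OF k(1,2)] slope(2)[OF k(1) _ k(3)] k nz by force
    then show ?thesis
    proof cases
      case 1 then show ?thesis by (simp add: gsum_nonpos)
    next
      case 2 then show ?thesis using height_one_int by simp
    next
      case 3
      then obtain l where l: "k = Suc l" by (cases k) auto
      have "fst (\<nu> k) j > 0" using slope(1)[OF k(1,2)] 3 grid_le(2)[OF LS, of k] nz by simp
      moreover have "fst (\<nu> l) j \<le> 0" using slope(2)[of l] k(1) 3(1) l grid_le(2)[OF LS, of l] by simp
      ultimately show ?thesis using crossing_int(1)[OF LS, of l j] k(1) 3(1) l by simp
    next
      case 4
      have "Suc k < N" using 4 k(1) N_pos by (cases "Suc k = N") auto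
      have "fst (\<nu> k) j \<le> 0" using slope(2)[OF k(1) _ k(3)] 4 grid_le(2)[OF LS, of k] by simp
      have "fst (\<nu> (Suc k)) j \<ge> 0" using slope(1)[OF \<open>Suc k < N\<close>] 4(1) grid_le(2)[OF LS, of "Suc k"] by simp
      then consider "fst (\<nu> (Suc k)) j = 0" | "fst (\<nu> (Suc k)) j > 0" by linarith
      then show ?thesis
      proof cases
        case 1
        then show ?thesis using height_cong[OF LS \<open>Suc k < N\<close>, of t j] 4(1) grid_le(1)[OF LS, of "Suc k"] by simp
      next
        case 2
        then show ?thesis using crossing_int(1)[OF LS \<open>Suc k < N\<close> \<open>fst (\<nu> k) j \<le> 0\<close>] 4(1) by simp
      qed
    qed
  qed
qed

lemma cpath_gpath: "cpath (gpath \<nu>)"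
proof -
  have "\<exists>m (ts::nat \<Rightarrow> real). ts 0 = 0 \<and> ts m = 1 \<and>
      (\<forall>k<m. ts k < ts (Suc k) \<and>
         (\<exists>a b :: 'i \<Rightarrow> real. \<forall>s\<in>{ts k..ts (Suc k)}. \<forall>i. gpath \<nu> s i = a i + s * b i))"
  proof (intro exI conjI allI impI)
    show "real 0 / real N = 0" by simp
    show "real N / real N = 1" using N_pos by simp
    fix k assume "k < N"
    show "real k / real N < real (Suc k) / real N" by (rule grid_le(2)[OF LS])
    show "\<forall>s\<in>{real k / real N..real (Suc k) / real N}. \<forall>i. gpath \<nu> s i
       = (gpath \<nu> (real k / real N) i - real k / real N * real_of_int (fst (\<nu> k) i)) + s * real_of_int (fst (\<nu> k) i)"
      using segment[OF LS \<open>k < N\<close>] by (simp add: algebra_simps)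
  qed
  then have pw: "pw_linear (gpath \<nu>)" unfolding pw_linear_def .
  have nonpos: "gpath \<nu> t = (\<lambda>i. 0)" if "t \<le> 0" for t using gsum_nonpos[OF that] by (intro ext)
  have left: "\<forall>t\<le>0. gpath \<nu> t = gpath \<nu> 0" using nonpos nonpos[OF order_refl] by presburger
  have right: "\<forall>t\<ge>1. gpath \<nu> t = gpath \<nu> 1" using gsum_ge_one[OF N_pos] by (intro allI impI ext)
  have "gpath \<nu> \<in> P_cl"
    unfolding P_cl_def mem_Collect_eq
    by (intro conjI pw left right nonpos[OF order_refl] allI height_one_int)
  moreover have "loc_min_int (gpath \<nu>) j" for j
    unfolding loc_min_int_def using local_min_int by blast
  ultimately have "gpath \<nu> \<in> P_cl_int" unfolding P_cl_int_def by blast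
  then show ?thesis unfolding cpath_def by (intro conjI allI gsum_continuous)
qed

text \<open>The operator reflects exactly the cells between \<open>t0\<close> and \<open>t1\<close>,
  both of which are grid points. The chains then need attention at \<open>t0\<close>, strictly
  between the two points, and at \<open>t1\<close>.\<close>

lemma root_op_grid:
  assumes "gpath \<nu> 1 j \<noteq> hmin (gpath \<nu>) j"
  shows "\<exists>\<nu>'. LSg \<nu>' \<and> pitp 1 j (gpath \<nu>) = gpath \<nu>'"
proof -
  let ?H = "\<lambda>t. gpath \<nu> t j"
  let ?m = "hmin (gpath \<nu>) j"
  interpret cont_fun ?H using cpath_cont[OF cpath_gpath] .
  note tp = turning_points[OF cpath_lmi[OF cpath_gpath] height_one_int assms]
  note amt = amount_eq[OF cpath_lmi[OF cpath_gpath] height_one_int assms]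
  have mZ: "?m \<in> \<int>" by (rule hmin_int[OF cpath_gpath])
  have m1Z: "?m + 1 \<in> \<int>" using mZ by simp
  obtain k0 where k0: "t0 = real k0 / real N" "k0 < N"
  proof -
    obtain k where k: "k < N" "real k / real N \<le> t0" "t0 \<le> real (Suc k) / real N"
      using grid_segment[OF N_pos, of t0] tp(1-3) by auto
    consider "t0 = real k / real N" | "t0 = real (Suc k) / real N"
      | "real k / real N < t0" "t0 < real (Suc k) / real N" using k by linarith
    then show ?thesis
    proof cases
      case 1 then show ?thesis using that k(1) by blast
    next
      case 2
      have "t0 < 1" using tp(2,3) by linarith
      then have "Suc k \<noteq> N" using 2 N_pos by auto
      then show ?thesis using that 2 k(1) by (meson Suc_lessI)
    next
      case 3
      \<comment> \<open>An integral height off the grid occurs only on a flat segment, and its right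
        end would be a minimum later than \<open>t0\<close>. For \<open>t1\<close> below, the left
        end of a flat segment would reach the height too early.\<close>
      then have "fst (\<nu> k) j = 0" using height_int_grid[OF LS k(1) 3] tp(4) mZ by simp
      then have "?H (real (Suc k) / real N) = ?m"
        using segment_right[OF LS k, of j] tp(4) by simp
      moreover have "real (Suc k) / real N \<le> 1" using grid_mem[OF LS, of "Suc k"] k(1) by simp
      ultimately show ?thesis using tp(6)[OF 3(2)] by simp
    qed
  qed
  obtain k1 where k1: "t1 = real k1 / real N" "k1 \<le> N"
  proof -
    obtain k where k: "k < N" "real k / real N \<le> t1" "t1 \<le> real (Suc k) / real N"
      using grid_segment[OF N_pos, of t1] tp(1-3) by auto
    consider "t1 = real k / real N" | "t1 = real (Suc k) / real N"
      | "real k / real N < t1" "t1 < real (Suc k) / real N" using k by linarith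
    then show ?thesis
    proof cases
      case 1 then show ?thesis using that k(1) by auto
    next
      case 2 then show ?thesis using that k(1) by auto
    next
      case 3
      then have "fst (\<nu> k) j = 0" using height_int_grid[OF LS k(1) 3] tp(5) m1Z by simp
      then have "?H (real k / real N) = ?m + 1" using segment[OF LS k, of j] tp(5) by simp
      moreover have "t0 \<le> real k / real N"
      proof (rule ccontr)
        assume "\<not> t0 \<le> real k / real N"
        then have "Suc k \<le> k0" unfolding k0(1) not_le grid_less_iff by simp
        then have "real (Suc k) / real N \<le> t0" unfolding k0(1) grid_le_iff .
        then show False using 3(2) tp(2) by linarith
      qed
      ultimately show ?thesis using tp(7)[OF _ 3(1)] by simp
    qed
  qed
  have k01: "k0 < k1" using tp(2) unfolding k0(1) k1(1) grid_less_iff .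
  have inside: "t0 \<le> real k / real N" if "k0 \<le> k" for k
    unfolding k0(1) grid_le_iff using that .
  have inside': "real k / real N \<le> t1" if "k \<le> k1" for k
    unfolding k1(1) grid_le_iff using that .
  have not_int: "?H t \<notin> \<int>" if "t0 < t" "t < t1" for t
  proof
    assume "?H t \<in> \<int>"
    moreover have "?m < ?H t" "?H t < ?m + 1" using tp(3) tp(6)[of t] tp(7)[of t] that by auto
    ultimately show False using int_gt[OF mZ, of "?H t"] by simp
  qed
  \<comment> \<open>Slope zero would make the height integral on the whole cell, which is impossible
    strictly between two consecutive integers; negative slope contradicts monotonicity between the
    turning points.\<close>
  have slope: "fst (\<nu> k) j > 0" if k: "k0 \<le> k" "k < k1" for k
  proof -
    have kN: "k < N" using k(2) k1(2) by simp
    define t where "t = (real k / real N + real (Suc k) / real N) / 2"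
    have t: "real k / real N < t" "t < real (Suc k) / real N" using grid_le(2)[OF LS, of k] by (auto simp: t_def)
    have "t0 < t" "t < t1" using t inside[OF k(1)] inside'[of "Suc k"] k(2) by auto
    then have "?H t \<notin> \<int>" by (rule not_int)
    then have "fst (\<nu> k) j \<noteq> 0" using height_cong[OF LS kN, of t j] t by auto
    moreover have "?H (real k / real N) \<le> ?H t"
      using tp(8)[of "real k / real N" t] inside[OF k(1)] t \<open>t < t1\<close> tp(3) by simp
    then have "0 \<le> (t - real k / real N) * real_of_int (fst (\<nu> k) j)"
      using segment[OF LS kN, of t j] t by simp
    then have "0 \<le> real_of_int (fst (\<nu> k) j)" using t(1) by (simp add: zero_le_mult_iff)
    ultimately show ?thesis by simp
  qed
  define \<nu>' where "\<nu>' k = (if k0 \<le> k \<and> k < k1 then sr j (\<nu> k) else \<nu> k)" for k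
  have "pitp 1 j (gpath \<nu>) t i = gpath \<nu>' t i" for t i
  proof -
    let ?w = "\<lambda>k. min t (real (Suc k) / real N) - min t (real k / real N)"
    let ?D = "\<Sum>k=k0..<k1. ?w k * real_of_int (fst (\<nu> k) j)"
    have "gpath \<nu>' t i = (\<Sum>k<N. ?w k * real_of_int (fst (\<nu> k) i)
        - (if k0 \<le> k \<and> k < k1 then ?w k * real_of_int (fst (\<nu> k) j) * clroot A j i else 0))"
      unfolding gsum_def by (rule sum.cong) (auto simp: \<nu>'_def fst_sr clroot_def algebra_simps)
    also have "\<dots> = gpath \<nu> t i - (\<Sum>k<N. if k0 \<le> k \<and> k < k1 then ?w k * real_of_int (fst (\<nu> k) j) * clroot A j i else 0)"
      by (simp add: sum_subtractf gsum_def)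
    also have "(\<Sum>k<N. if k0 \<le> k \<and> k < k1 then ?w k * real_of_int (fst (\<nu> k) j) * clroot A j i else 0)
       = (\<Sum>k=k0..<k1. ?w k * real_of_int (fst (\<nu> k) j) * clroot A j i)"
      by (rule sum.mono_neutral_cong_right) (use k1(2) in auto)
    finally have 1: "gpath \<nu>' t i = gpath \<nu> t i - ?D * clroot A j i" by (simp add: sum_distrib_right)
    \<comment> \<open>The coefficient of the simple root that the reflected cells accumulate is the
      rise of the height within \<open>{t0..t1}\<close> up to time \<open>t\<close>, which is the
      amount in the Pitman form.\<close>
    have "?D = gsum k1 N \<nu> t j - gsum k0 N \<nu> t j"
      unfolding gsum_def using k01 by (simp add: sum_diff_nat_ivl flip: atLeast0LessThan)
    also have "\<dots> = ?H (min t t1) - ?H (min t t0)"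
      using gsum_min[of k1 N N \<nu> t j] gsum_min[of k0 N N \<nu> t j] k0 k1 by simp
    also have "\<dots> = (if t \<le> t0 then 0 else if t \<le> t1 then ?H t - ?m else 1)"
      using tp(2,4,5) by (auto simp: min_def)
    finally have "?D = min 1 (kmin ?H t - ?m)" by (simp only: amt)
    then show ?thesis using 1 by (simp add: pitp_def)
  qed
  then have "pitp 1 j (gpath \<nu>) = gpath \<nu>'" by (intro ext)
  moreover have "LSg \<nu>'"
    unfolding LSg_def
  proof (intro conjI allI impI)
    fix k assume "k < N"
    then have "\<nu> k \<in> Orb" using LS unfolding LSg_def by blast
    then show "\<nu>' k \<in> Orb" unfolding \<nu>'_def using sr_Orb by simp
  next
    fix k assume kN: "Suc k < N"
    let ?s = "real (Suc k) / real N"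
    have ch: "(sstep (Suc k))\<^sup>*\<^sup>* (\<nu> k) (\<nu> (Suc k))" using LS kN unfolding LSg_def by blast
    have cong: "?H ?s - ?s * real_of_int (fst (\<nu> k) j) \<in> \<int>"
      using height_cong[OF LS, of k ?s j] kN grid_le(1)[OF LS, of k] by simp
    consider "Suc k < k0 \<or> k1 \<le> k" | "Suc k = k0" | "k0 \<le> k" "Suc k < k1" | "k0 \<le> k" "Suc k = k1" by linarith
    then show "(sstep (Suc k))\<^sup>*\<^sup>* (\<nu>' k) (\<nu>' (Suc k))"
    proof cases
      case 1
      then show ?thesis using ch k01 by (auto simp: \<nu>'_def)
    next
      case 2
      \<comment> \<open>At \<open>t0\<close> the path arrives at its minimum, so the slope before is
        not positive and \<open>crossing_int\<close> ends the chain at the reflected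
        direction.\<close>
      have "fst (\<nu> k) j \<le> 0"
      proof -
        have "?m \<le> ?H (real k / real N)" using kmin_le[of 0 "real k / real N"] grid_mem[OF LS, of k] kN by simp
        moreover have "?H ?s = ?m" using tp(4) k0(1) 2 by simp
        ultimately have "(?s - real k / real N) * real_of_int (fst (\<nu> k) j) \<le> 0"
          using segment[OF LS, of k ?s j] kN grid_le(1)[OF LS, of k] by simp
        then show ?thesis using grid_le(2)[OF LS, of k] by (simp add: mult_le_0_iff)
      qed
      then show ?thesis using crossing_int(2)[OF LS kN] slope[of "Suc k"] 2 k01 by (simp add: \<nu>'_def)
    next
      case 3
      have pos: "fst (\<nu> (Suc k)) j > 0" using slope[of "Suc k"] 3 by simp
      have "t0 < ?s" using inside[OF 3(1)] grid_le(2)[OF LS, of k] by linarith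
      moreover have "?s < t1" using 3(2) unfolding k1(1) grid_less_iff .
      ultimately have ni: "?H ?s \<notin> \<int>" by (rule not_int)
      \<comment> \<open>Strictly inside, the height is not integral. This rules out a crossing, so
        the whole chain is reflected.\<close>
      have False if z: "(sstep (Suc k))\<^sup>*\<^sup>* (\<nu> k) z" "of_nat (Suc k) / of_nat N * rat_of_int (fst z j) \<in> \<int>" for z
      proof -
        have "?s * real_of_int (fst z j) \<in> \<int>" using Ints_of_rat[OF z(2)] by (simp add: of_rat_mult of_rat_divide of_rat_add)
        from Ints_add[OF sstep_diff_int[OF z(1), of j] this] have "?s * real_of_int (fst (\<nu> k) j) \<in> \<int>" by simp
        from Ints_add[OF cong this] show False using ni by simp
      qed
      then have "(sstep (Suc k))\<^sup>*\<^sup>* (sr j (\<nu> k)) (sr j (\<nu> (Suc k)))" using sigma_chain_cross[OF ch pos] by blast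
      then show ?thesis using 3 by (simp add: \<nu>'_def)
    next
      case 4
      have pos: "fst (\<nu> k) j > 0" using slope[of k] 4 by simp
      have "?H ?s \<in> \<int>" using tp(5) m1Z k1(1) 4 by simp
      \<comment> \<open>At \<open>t1\<close> the height is integral again, which makes the
        reflection back from \<open>sr j (\<nu> k)\<close> to \<open>\<nu> k\<close> an admissible
        step; it is put in front of the old chain.\<close>
      from Ints_diff[OF this cong] have "?s * real_of_int (fst (\<nu> k) j) \<in> \<int>" by simp
      then obtain z where "?s * real_of_int (fst (\<nu> k) j) = real_of_int z" by (rule Ints_cases)
      then have "real (Suc k) * real_of_int (fst (\<nu> k) j) = real_of_int z * real N" using N_pos by (simp add: field_simps)
      then have "real_of_int (int (Suc k) * fst (\<nu> k) j) = real_of_int (z * int N)" by simp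
      then have zz: "int (Suc k) * fst (\<nu> k) j = z * int N" by (simp only: of_int_eq_iff)
      have "rat_of_int (int (Suc k) * fst (\<nu> k) j) = rat_of_int (z * int N)" unfolding zz ..
      then have "of_nat (Suc k) / of_nat N * rat_of_int (fst (\<nu> k) j) = rat_of_int z" using N_pos by (simp add: field_simps)
      then have "of_nat (Suc k) / of_nat N * rat_of_int (fst (sr j (\<nu> k)) j) \<in> \<int>" by simp
      then have "sstep (Suc k) (sr j (\<nu> k)) (sr j (sr j (\<nu> k)))"
        using pos N_pos by (intro sigma_step_simple) (auto simp: zero_less_divide_iff)
      then have "sstep (Suc k) (sr j (\<nu> k)) (\<nu> k)" by simp
      then show ?thesis using ch 4 by (simp add: \<nu>'_def converse_rtranclp_into_rtranclp)
    qed
  qed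
  ultimately show ?thesis by blast
qed

end

lemma fclosed_LS_cl: "fclosed (LS_cl A i0 lam)"
  unfolding fclosed_def
proof (intro conjI ballI allI)
  fix \<eta> assume "\<eta> \<in> LS_cl A i0 lam"
  then obtain \<nu> where \<nu>: "\<eta> = gpath \<nu>" "LSg \<nu>" unfolding LS_cl_eq by blast
  show c: "cpath \<eta>" unfolding \<nu>(1) by (rule cpath_gpath[OF \<nu>(2)])
  fix j
  show "root_f A j \<eta> = None \<or> the (root_f A j \<eta>) \<in> LS_cl A i0 lam"
  proof (cases "\<eta> 1 j = hmin \<eta> j")
    case True then show ?thesis using root_f_None_iff by blast
  next
    case False
    then have "root_f A j \<eta> = Some (pitp 1 j \<eta>)" by (rule root_f_eq[OF c])
    moreover have "pitp 1 j \<eta> \<in> LS_cl A i0 lam"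
      using root_op_grid[OF \<nu>(2), of j] False unfolding LS_cl_eq \<nu>(1) by auto
    ultimately show ?thesis by simp
  qed
qed

lemma lev0_LS_cl: "\<forall>\<eta>\<in>LS_cl A i0 lam. lev0 \<eta>"
  unfolding LS_cl_eq LSg_def using lev0_gpath[OF _ N_pos] by blast

end

section \<open>Flow to straight lines\<close>

text \<open>The base point \<open>\<tau>\<close> is independent of the interval. Taken at a break,
  it anchors the pieces on both sides at the same value, so they can be glued.\<close>

definition slope_on :: "'i path \<Rightarrow> real \<Rightarrow> real \<Rightarrow> real \<Rightarrow> ('i \<Rightarrow> int) \<Rightarrow> bool" where
  "slope_on \<eta> \<tau> p q f \<longleftrightarrow> (\<forall>t\<in>{p..q}. \<forall>i. \<eta> t i = \<eta> \<tau> i + (t - \<tau>) * real_of_int (f i))"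

lemma slope_onD: "slope_on \<eta> \<tau> p q f \<Longrightarrow> p \<le> t \<Longrightarrow> t \<le> q \<Longrightarrow> \<eta> t i = \<eta> \<tau> i + (t - \<tau>) * real_of_int (f i)"
  by (simp add: slope_on_def)

lemma slope_on_unique:
  assumes "slope_on \<eta> \<tau> p q f" "slope_on \<eta> \<tau>' p' q' f'" "max p p' < min q q'"
  shows "f = f'"
proof
  fix i
  let ?s = "max p p'" and ?t = "min q q'"
  have "(?t - ?s) * real_of_int (f i) = \<eta> ?t i - \<eta> ?s i"
    using slope_onD[OF assms(1), of ?s i] slope_onD[OF assms(1), of ?t i] assms(3) by (simp add: algebra_simps)
  also have "\<dots> = (?t - ?s) * real_of_int (f' i)"
    using slope_onD[OF assms(2), of ?s i] slope_onD[OF assms(2), of ?t i] assms(3) by (simp add: algebra_simps)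
  finally show "f i = f' i" using assms(3) by simp
qed

lemma slope_on_join:
  assumes "slope_on \<eta> \<tau> p \<tau> f" "slope_on \<eta> \<tau> \<tau> q f" shows "slope_on \<eta> \<tau> p q f"
  unfolding slope_on_def
proof (intro ballI allI)
  fix t i assume t: "t \<in> {p..q}"
  show "\<eta> t i = \<eta> \<tau> i + (t - \<tau>) * real_of_int (f i)"
  proof (cases "t \<le> \<tau>")
    case True show ?thesis by (rule slope_onD[OF assms(1)]) (use t True in simp_all)
  next
    case False show ?thesis by (rule slope_onD[OF assms(2)]) (use t False in simp_all)
  qed
qed

lemma common_denominator:
  fixes ss :: "rat list"
  assumes "\<forall>\<sigma>\<in>set ss. 0 \<le> \<sigma>"
  shows "\<exists>M>0. \<forall>\<sigma>\<in>set ss. \<exists>m::nat. \<sigma> = of_nat m / of_nat M"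
  using assms
proof (induction ss)
  case Nil then show ?case by auto
next
  case (Cons \<rho> ss)
  then obtain M :: nat where M: "M > 0" "\<And>\<sigma>. \<sigma> \<in> set ss \<Longrightarrow> \<exists>m::nat. \<sigma> = of_nat m / of_nat M" by auto
  obtain n d where "quotient_of \<rho> = (n, d)" by (cases "quotient_of \<rho>")
  then have \<rho>: "\<rho> = of_int n / of_int d" and d: "d > 0"
    using quotient_of_div quotient_of_denom_pos by blast+
  have "n \<ge> 0" using Cons.prems d unfolding \<rho> by (simp add: zero_le_divide_iff)
  then have \<rho>': "\<rho> = of_nat (nat n) / of_nat (nat d)" using \<rho> d by simp
  have "\<exists>m::nat. \<sigma> = of_nat m / of_nat (M * nat d)" if mem: "\<sigma> \<in> set (\<rho> # ss)" for \<sigma>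
  proof (cases "\<sigma> = \<rho>")
    case True
    then show ?thesis using \<rho>' M(1) d by (intro exI[of _ "nat n * M"]) simp
  next
    case False
    then obtain m :: nat where "\<sigma> = of_nat m / of_nat M" using M(2) mem by auto
    then show ?thesis using M(1) d by (intro exI[of _ "m * nat d"]) simp
  qed
  then show ?case using M(1) d by (intro exI[of _ "M * nat d"]) auto
qed

section \<open>The dual labels, the level, and one move of the flow\<close>

context affine
begin

text \<open>Dividing by \<open>d\<close> turns left null vectors into right ones, where
  \<open>kernel_A\<close> applies. The product \<open>V\<close> of all \<open>v i\<close> clears the
  denominators.\<close>

lemma left_kernel_unique:
  assumes "v' i0 = 1" "\<And>j. (\<Sum>i\<in>UNIV. v' i * A i j) = 0"
  shows "v' = v"
proof
  fix k
  define V where "V = (\<Prod>i\<in>UNIV. v i)"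
  have V: "V > 0" unfolding V_def using v_pos by (intro prod_pos) auto
  have "\<forall>i. \<exists>u. V = v i * u" unfolding V_def by (intro allI) (metis dvdE dvd_prodI finite iso_tuple_UNIV_I)
  then obtain u where u: "\<And>i. V = v i * u i" by metis
  let ?c = "\<lambda>i. v' i * a i * u i"
  have cr: "real_of_int (?c i) = V * (v' i / d i)" for i
    using u[of i] v_pos[of i] a_pos[of i] by (simp add: d_def)
  have "(\<Sum>i\<in>UNIV. A j i * ?c i) = 0" for j
  proof -
    have "real_of_int (A j i * ?c i) = V / d j * real_of_int (v' i * A i j)" for i
    proof -
      have "real_of_int (A j i * ?c i) = V * (d j * A j i) * v' i / (d i * d j)"
        using d_pos[of i] d_pos[of j] by (simp only: of_int_mult[of "A j i"] cr) simp
      also have "\<dots> = V / d j * real_of_int (v' i * A i j)" unfolding d_sym[of j i] using d_pos[of i] by simp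
      finally show ?thesis .
    qed
    then have "real_of_int (\<Sum>i\<in>UNIV. A j i * ?c i) = V / d j * real_of_int (\<Sum>i\<in>UNIV. v' i * A i j)"
      unfolding of_int_sum sum_distrib_left by (intro sum.cong HOL.refl)
    then have "real_of_int (\<Sum>i\<in>UNIV. A j i * ?c i) = 0" unfolding assms(2) by simp
    then show ?thesis by (simp only: of_int_eq_0_iff)
  qed
  then have "?c k = ?c i0 * a k" by (rule kernel_A)
  also have "?c i0 = V" using u[of i0] assms(1) a_i0 v_i0 by simp
  finally have "v' k * u k = V" using a_pos[of k] by simp
  then show "v' k = v k" using u[of k] V by auto
qed

lemma avee_eq: "avee A i0 = v"
  unfolding avee_def
proof (rule the_equality)
  show "v i0 = 1 \<and> (\<forall>j. (\<Sum>i\<in>UNIV. v i * A i j) = 0)" using v_i0 v_A by (intro conjI allI)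
  show "v' = v" if "v' i0 = 1 \<and> (\<forall>j. (\<Sum>i\<in>UNIV. v' i * A i j) = 0)" for v'
    using that by (intro left_kernel_unique) (elim conjE, assumption, elim conjE allE)
qed

lemma level_zero_dominant_level:
  assumes "lam \<in> level_zero_dominant A i0"
  shows "(\<Sum>k\<in>UNIV. v k * fst lam k) = 0"
proof -
  obtain c :: "'i \<Rightarrow> nat" where lam: "\<And>k. fst lam k = (\<Sum>i\<in>{i. i \<noteq> i0}. int (c i) * fst (varpi A i0 i) k)"
    using assms unfolding level_zero_dominant_def by auto
  have "(\<Sum>k\<in>UNIV. v k * fst lam k) = (\<Sum>i\<in>{i. i \<noteq> i0}. int (c i) * (\<Sum>k\<in>UNIV. v k * fst (varpi A i0 i) k))"
    unfolding lam sum_distrib_left by (subst sum.swap) (simp add: mult.left_commute)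
  also have "\<dots> = 0"
  proof (rule sum.neutral, rule ballI)
    fix i
    have "(\<Sum>k\<in>UNIV. v k * fst (varpi A i0 i) k)
      = (\<Sum>k\<in>UNIV. v k * unit_vec i k) - (\<Sum>k\<in>UNIV. (v k * v i) * unit_vec i0 k)"
      unfolding varpi_def avee_eq sum_subtractf[symmetric] by (rule sum.cong) (auto simp: algebra_simps)
    also have "\<dots> = 0" by (simp only: sum_unit_vec v_i0 mult_1 diff_self)
    finally show "int (c i) * (\<Sum>k\<in>UNIV. v k * fst (varpi A i0 i) k) = 0" by simp
  qed
  finally show ?thesis .
qed

text \<open>The maximal power of \<open>f_j\<close> subtracts the full rise of the future minimum.
  Where the height increases towards the end, this minimum is the height itself and the direction is
  reflected. On a descending or flat piece before \<open>\<tau>\<close> it is constant and the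
  direction stays.\<close>

lemma flow_step:
  assumes "fclosed B" "\<eta> \<in> B" "0 \<le> p" "p \<le> \<tau>" "\<tau> < 1"
    and g: "slope_on \<eta> \<tau> \<tau> 1 g" and f: "slope_on \<eta> \<tau> p \<tau> f" and j: "g j > 0"
  shows "\<exists>\<eta>'. fstep\<^sup>*\<^sup>* \<eta> \<eta>' \<and> slope_on \<eta>' \<tau> \<tau> 1 (cs j g) \<and> slope_on \<eta>' \<tau> p \<tau> (ucs j f)"
proof -
  have c: "cpath \<eta>" using assms(1,2) unfolding fclosed_def by blast
  interpret cont_fun "\<lambda>t. \<eta> t j" using cpath_cont[OF c] .
  have "\<eta> 1 j - hmin \<eta> j \<in> \<int>" using cpath_one[OF c] hmin_int[OF c] by (rule Ints_diff)
  moreover have "0 \<le> \<eta> 1 j - hmin \<eta> j" using hmin_le[OF c, of 1 j] by simp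
  ultimately obtain n :: nat where n: "\<eta> 1 j - hmin \<eta> j = real n" by (metis Ints_cases of_int_0_le_iff of_int_of_nat_eq zero_le_imp_eq_int)
  let ?\<eta>' = "pitp (real n) j \<eta>"
  have step: "fstep\<^sup>*\<^sup>* \<eta> ?\<eta>'" using assms(1,2) by (rule fclosed_pitp) (simp add: n)
  \<comment> \<open>With the maximal exponent the truncation by \<open>n\<close> is inactive,
    because the future minimum never exceeds the final height.\<close>
  have \<eta>': "?\<eta>' t i = \<eta> t i - (kmin (\<lambda>t. \<eta> t j) t - hmin \<eta> j) * A i j" if "0 \<le> t" "t \<le> 1" for t i
    using kmin_le[OF that order_refl] kmin_le[of t 1] that n by (simp add: pitp_def clroot_def min_absorb2)
  have up: "\<eta> \<tau> j \<le> \<eta> u j" if "\<tau> \<le> u" "u \<le> 1" for u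
    using slope_onD[OF g that, of j] that(1) j by simp
  have kr: "kmin (\<lambda>t. \<eta> t j) t = \<eta> t j" if t: "\<tau> \<le> t" "t \<le> 1" for t
  proof (rule kmin_eqI)
    fix u assume u: "u \<in> {t..1}"
    then have "(t - \<tau>) * real_of_int (g j) \<le> (u - \<tau>) * real_of_int (g j)" using j by (intro mult_right_mono) auto
    then show "\<eta> t j \<le> \<eta> u j" using slope_onD[OF g t, of j] slope_onD[OF g, of u j] t u by simp
  qed (use t assms(3,4) in auto)
  have "slope_on ?\<eta>' \<tau> \<tau> 1 (cs j g)"
    unfolding slope_on_def
  proof (intro ballI allI)
    fix t i assume "t \<in> {\<tau>..1}"
    then have t: "\<tau> \<le> t" "t \<le> 1" by auto
    show "?\<eta>' t i = ?\<eta>' \<tau> i + (t - \<tau>) * real_of_int (cs j g i)"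
      using \<eta>'[of t i] \<eta>'[of \<tau> i] kr[OF t] kr[of \<tau>] slope_onD[OF g t, of i] slope_onD[OF g t, of j] t assms(3-5)
      by (simp add: cs_def algebra_simps)
  qed
  moreover have "slope_on ?\<eta>' \<tau> p \<tau> (ucs j f)"
    unfolding slope_on_def
  proof (intro ballI allI)
    fix t i assume "t \<in> {p..\<tau>}"
    then have t: "p \<le> t" "t \<le> \<tau>" by auto
    have t01: "t \<in> {0..1}" using t assms(3-5) by auto
    show "?\<eta>' t i = ?\<eta>' \<tau> i + (t - \<tau>) * real_of_int (ucs j f i)"
    proof (cases "f j > 0")
      case True
      have "kmin (\<lambda>t. \<eta> t j) t = \<eta> t j"
      proof (rule kmin_eqI[OF t01])
        fix u assume u: "u \<in> {t..1}"
        have le: "\<eta> t j \<le> \<eta> s j" if "t \<le> s" "s \<le> \<tau>" for s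
        proof -
          have "(t - \<tau>) * real_of_int (f j) \<le> (s - \<tau>) * real_of_int (f j)" using that True by (intro mult_right_mono) auto
          then show ?thesis using slope_onD[OF f t, of j] slope_onD[OF f _ that(2), of j] t(1) that(1) by simp
        qed
        show "\<eta> t j \<le> \<eta> u j"
          using le[of u] le[of \<tau>] up[of u] u t by (cases "u \<le> \<tau>") auto
      qed (use t01 in auto)
      then have "?\<eta>' t i = \<eta> t i - (\<eta> t j - hmin \<eta> j) * A i j" using \<eta>'[of t i] t01 by simp
      moreover have "?\<eta>' \<tau> i = \<eta> \<tau> i - (\<eta> \<tau> j - hmin \<eta> j) * A i j" using \<eta>'[of \<tau> i] kr[of \<tau>] assms(3-5) by simp
      ultimately show ?thesis
        unfolding slope_onD[OF f t, of i] slope_onD[OF f t, of j] using True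
        by (simp add: cs_def ucs_def algebra_simps)
    next
      case False
      have "kmin (\<lambda>t. \<eta> t j) t = \<eta> \<tau> j"
      proof (rule kmin_eqI[OF t01])
        fix u assume u: "u \<in> {t..1}"
        show "\<eta> \<tau> j \<le> \<eta> u j"
        proof (cases "u \<le> \<tau>")
          case True
          have "0 \<le> (u - \<tau>) * real_of_int (f j)" using True False by (intro mult_nonpos_nonpos) auto
          then show ?thesis using slope_onD[OF f _ True, of j] u t(1) by simp
        qed (use up u in auto)
      qed (use t assms(5) in auto)
      then show ?thesis
        using \<eta>'[of t i] \<eta>'[of \<tau> i] kr[of \<tau>] slope_onD[OF f t, of i] t01 assms(3-5) False
        by (simp add: ucs_def)
    qed
  qed
  ultimately show ?thesis using step by blast
qed

end

section \<open>Merging the last two directions\<close>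

context grid_orbit
begin

text \<open>All moves keep \<open>\<tau>\<close> in place, so integrality of
  \<open>\<tau> * real N\<close> found at the move where the directions become equal holds from the
  start. It is therefore proved along with the merging.\<close>

lemma flow_merge:
  assumes "fclosed B" "0 \<le> p" "p < \<tau>" "\<tau> < 1" "mv\<^sup>*\<^sup>* s (h, h)"
  shows "\<forall>\<eta>\<in>B. fst s \<in> cO \<longrightarrow> snd s \<in> cO \<longrightarrow> slope_on \<eta> \<tau> \<tau> 1 (snd s) \<longrightarrow> slope_on \<eta> \<tau> p \<tau> (fst s) \<longrightarrow>
     (\<exists>\<eta>'. fstep\<^sup>*\<^sup>* \<eta> \<eta>' \<and> slope_on \<eta>' \<tau> \<tau> 1 h \<and> slope_on \<eta>' \<tau> p \<tau> h) \<and>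
     (fst s \<noteq> snd s \<longrightarrow> \<tau> * real N \<in> \<int>)"
  using assms(5)
proof (induction rule: converse_rtranclp_induct)
  case base
  show ?case by auto
next
  case (step s s')
  show ?case
  proof (intro ballI impI)
    fix \<eta> assume \<eta>: "\<eta> \<in> B" "fst s \<in> cO" "snd s \<in> cO" "slope_on \<eta> \<tau> \<tau> 1 (snd s)" "slope_on \<eta> \<tau> p \<tau> (fst s)"
    let ?f = "fst s" and ?g = "snd s"
    have c: "cpath \<eta>" using assms(1) \<eta>(1) unfolding fclosed_def by blast
    obtain j where j: "?g j > 0" and s': "s' = (ucs j ?f, cs j ?g)" using step(1) unfolding mv_def by blast
    obtain \<eta>1 where \<eta>1: "fstep\<^sup>*\<^sup>* \<eta> \<eta>1" "slope_on \<eta>1 \<tau> \<tau> 1 (snd s')" "slope_on \<eta>1 \<tau> p \<tau> (fst s')"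
      using flow_step[OF assms(1) \<eta>(1) assms(2) _ assms(4) \<eta>(4,5) j] assms(3) s' by auto
    have in_B: "\<eta>1 \<in> B" using fclosed_rtranclp[OF \<eta>1(1) assms(1) \<eta>(1)] .
    have in_cO: "fst s' \<in> cO" "snd s' \<in> cO" unfolding s' using ucs_cO[OF \<eta>(2)] cs_cO[OF \<eta>(3)] by simp_all
    have IH: "(\<exists>\<eta>'. fstep\<^sup>*\<^sup>* \<eta>1 \<eta>' \<and> slope_on \<eta>' \<tau> \<tau> 1 h \<and> slope_on \<eta>' \<tau> p \<tau> h) \<and>
     (fst s' \<noteq> snd s' \<longrightarrow> \<tau> * real N \<in> \<int>)" using step(3) in_B in_cO \<eta>1(2,3) by blast
    have "\<tau> * real N \<in> \<int>" if ne: "?f \<noteq> ?g"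
    proof (cases "fst s' = snd s'")
      case False then show ?thesis using IH by blast
    next
      case True
      then have eq: "ucs j ?f = cs j ?g" by (simp add: s')
      \<comment> \<open>If both directions paired positively with \<open>j\<close>, both would be
        reflected and stay different. So at the merging move the height does not increase before
        \<open>\<tau>\<close> and increases after it: a local minimum.\<close>
      have nonpos: "\<not> ?f j > 0"
      proof
        assume "?f j > 0"
        then have "cs j (cs j ?f) = cs j (cs j ?g)" using eq by (simp add: ucs_def)
        then show False using ne by simp
      qed
      have "loc_min_int \<eta> j" using c unfolding cpath_def P_cl_int_def by blast
      moreover have "\<exists>\<epsilon>>0. \<forall>u\<in>{0..1}. \<bar>u - \<tau>\<bar> < \<epsilon> \<longrightarrow> \<eta> \<tau> j \<le> \<eta> u j"
      proof (intro exI[of _ "\<tau> - p"] conjI ballI impI)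
        fix u :: real assume u: "u \<in> {0..1}" "\<bar>u - \<tau>\<bar> < \<tau> - p"
        show "\<eta> \<tau> j \<le> \<eta> u j"
        proof (cases "u \<le> \<tau>")
          case True
          have "0 \<le> (u - \<tau>) * real_of_int (?f j)" using True nonpos by (intro mult_nonpos_nonpos) auto
          moreover have "\<eta> u j = \<eta> \<tau> j + (u - \<tau>) * real_of_int (?f j)" by (rule slope_onD[OF \<eta>(5)]) (use u True in auto)
          ultimately show ?thesis by simp
        next
          case False
          have "0 \<le> (u - \<tau>) * real_of_int (?g j)" using False j by (intro mult_nonneg_nonneg) auto
          moreover have "\<eta> u j = \<eta> \<tau> j + (u - \<tau>) * real_of_int (?g j)" by (rule slope_onD[OF \<eta>(4)]) (use u False in auto)
          ultimately show ?thesis by simp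
        qed
      qed (use assms(3) in simp)
      moreover have "\<tau> \<in> {0..1}" using assms(2-4) by simp
      ultimately have "\<eta> \<tau> j \<in> \<int>" unfolding loc_min_int_def by blast
      moreover have "\<eta> 1 j \<in> \<int>" by (rule cpath_one[OF c])
      moreover have "\<eta> 1 j = \<eta> \<tau> j + (1 - \<tau>) * real_of_int (?g j)" by (rule slope_onD[OF \<eta>(4)]) (use assms(4) in auto)
      ultimately have "(1 - \<tau>) * real_of_int (?g j) \<in> \<int>" using Ints_diff[of "\<eta> 1 j" "\<eta> \<tau> j"] by simp
      \<comment> \<open>The slope between the integral heights at \<open>\<tau>\<close> and at 1
        divides \<open>N\<close>. This bound on the denominator does not depend on the path.\<close>
      then have "(1 - \<tau>) * real N \<in> \<int>" by (rule Ints_mult_dvd) (use N_dvd[OF \<eta>(3)] j in auto)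
      then have "real N - (1 - \<tau>) * real N \<in> \<int>" by (intro Ints_diff) auto
      then show ?thesis by (simp add: algebra_simps)
    qed
    moreover have "\<exists>\<eta>'. fstep\<^sup>*\<^sup>* \<eta> \<eta>' \<and> slope_on \<eta>' \<tau> \<tau> 1 h \<and> slope_on \<eta>' \<tau> p \<tau> h"
      using IH \<eta>1(1) rtranclp_trans[of fstep \<eta> \<eta>1] by blast
    ultimately show "(\<exists>\<eta>'. fstep\<^sup>*\<^sup>* \<eta> \<eta>' \<and> slope_on \<eta>' \<tau> \<tau> 1 h \<and> slope_on \<eta>' \<tau> p \<tau> h) \<and>
       (?f \<noteq> ?g \<longrightarrow> \<tau> * real N \<in> \<int>)" by blast
  qed
qed

text \<open>Condition (b) with its breaks put on a common grid. In contrast to \<open>N\<close>, the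
  number \<open>M\<close> varies with the path and is not bounded beforehand.\<close>

definition chain_of_lines :: "'i path \<Rightarrow> bool" where
  "chain_of_lines \<eta> \<longleftrightarrow> (\<exists>M \<nu>. M > 0 \<and> (\<forall>k<M. \<nu> k \<in> Orb) \<and> (\<forall>t\<in>{0..1}. \<forall>i. \<eta> t i = gsum M M \<nu> t i))"

definition break :: "'i path \<Rightarrow> real \<Rightarrow> real \<Rightarrow> ('i \<Rightarrow> int) \<Rightarrow> ('i \<Rightarrow> int) \<Rightarrow> bool" where
  "break \<eta> p \<tau> f g \<longleftrightarrow> 0 \<le> p \<and> p < \<tau> \<and> \<tau> < 1 \<and> f \<in> cO \<and> g \<in> cO \<and> f \<noteq> g \<and>
     slope_on \<eta> \<tau> \<tau> 1 g \<and> slope_on \<eta> \<tau> p \<tau> f"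

lemma last_break:
  assumes "chain_of_lines \<eta>"
  shows "(\<exists>f\<in>cO. slope_on \<eta> 0 0 1 f) \<or> (\<exists>p \<tau> f g. break \<eta> p \<tau> f g)"
proof -
  obtain M \<nu> where M: "M > 0" and \<nu>: "\<And>k. k < M \<Longrightarrow> \<nu> k \<in> Orb"
    and \<eta>: "\<And>t i. t \<in> {0..1} \<Longrightarrow> \<eta> t i = gsum M M \<nu> t i"
    using assms unfolding chain_of_lines_def by blast
  have tail: "slope_on \<eta> (real m / real M) (real m / real M) 1 (fst x)"
    if m: "m \<le> M" "\<And>k. m \<le> k \<Longrightarrow> k < M \<Longrightarrow> fst (\<nu> k) = fst x" for m x
    unfolding slope_on_def
  proof (intro ballI allI)
    fix t i assume t: "t \<in> {real m / real M..1}"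
    have m01: "real m / real M \<in> {0..1}" using m(1) M by simp
    have "gsum M M \<nu> t i = gsum m M \<nu> t i + (min t (real M / real M) - min t (real m / real M)) * real_of_int (fst x i)"
      by (rule gsum_const_tail[OF m])
    also have "gsum m M \<nu> t i = gsum M M \<nu> (real m / real M) i"
      using gsum_min[OF m(1), of M \<nu> t i] t by (simp add: min_absorb2)
    finally show "\<eta> t i = \<eta> (real m / real M) i + (t - real m / real M) * real_of_int (fst x i)"
      using \<eta>[of t i] \<eta>[OF m01, of i] t m01 M order_trans[of 0 "real m / real M" t] by (simp add: min_absorb1 min_absorb2)
  qed
  define S where "S = {k. Suc k < M \<and> fst (\<nu> k) \<noteq> fst (\<nu> (Suc k))}"
  have fin: "finite S" unfolding S_def by (rule finite_subset[of _ "{..<M}"]) auto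
  have const: "fst (\<nu> k) = fst (\<nu> m)" if mk: "m \<le> k" "k < M" and notin: "\<And>l. m \<le> l \<Longrightarrow> l \<notin> S" for k m
    using mk
  proof (induction k rule: dec_induct)
    case (step k)
    have "k \<notin> S" using step.hyps(1) by (rule notin)
    then have "fst (\<nu> k) = fst (\<nu> (Suc k))" using step.prems unfolding S_def by blast
    then show ?case using step.IH step.prems by simp
  qed (rule HOL.refl)
  show ?thesis
  proof (cases "S = {}")
    case True
    have "slope_on \<eta> (real 0 / real M) (real 0 / real M) 1 (fst (\<nu> 0))"
      by (rule tail, simp, rule const) (simp_all add: True)
    then have "slope_on \<eta> 0 0 1 (fst (\<nu> 0))" by simp
    then show ?thesis using \<nu>[OF M] by blast
  next
    case False
    define k where "k = Max S"
    have k: "k \<in> S" unfolding k_def using fin False by (rule Max_in)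
    have above: "l \<notin> S" if "Suc k \<le> l" for l
      using Max_ge[OF fin, of l] that unfolding k_def by auto
    have kM: "Suc k < M" "k < M" and ne: "fst (\<nu> k) \<noteq> fst (\<nu> (Suc k))" using k unfolding S_def by auto
    let ?p = "real k / real M" and ?t = "real (Suc k) / real M"
    have pt: "0 \<le> ?p" "?p < ?t" "?t < 1" using kM M by (simp_all add: divide_strict_right_mono)
    have "slope_on \<eta> ?t ?t 1 (fst (\<nu> (Suc k)))"
      by (rule tail, use kM in simp, rule const) (simp_all add: above)
    moreover have "slope_on \<eta> ?t ?p ?t (fst (\<nu> k))"
      unfolding slope_on_def
    proof (intro ballI allI)
      fix t i assume t: "t \<in> {?p..?t}"
      have "gsum M M \<nu> t i = gsum M M \<nu> ?p i + (t - ?p) * real_of_int (fst (\<nu> k) i)"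
        "gsum M M \<nu> ?t i = gsum M M \<nu> ?p i + (?t - ?p) * real_of_int (fst (\<nu> k) i)"
        using t pt by (auto intro!: gsum_segment[OF M kM(2)])
      then show "\<eta> t i = \<eta> ?t i + (t - ?t) * real_of_int (fst (\<nu> k) i)"
        using \<eta>[of t i] \<eta>[of ?t i] t pt by (simp only: atLeastAtMost_iff left_diff_distrib) simp
    qed
    ultimately have "break \<eta> ?p ?t (fst (\<nu> k)) (fst (\<nu> (Suc k)))"
      unfolding break_def using pt ne \<nu> kM by blast
    then show ?thesis by blast
  qed
qed

lemma break_int:
  assumes "fclosed B" "\<eta> \<in> B" "break \<eta> p \<tau> f g"
  shows "\<tau> * real N \<in> \<int>" "\<exists>h \<eta>'. fstep\<^sup>*\<^sup>* \<eta> \<eta>' \<and> slope_on \<eta>' \<tau> p 1 h"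
proof -
  have b: "0 \<le> p" "p < \<tau>" "\<tau> < 1" "f \<in> cO" "g \<in> cO" "f \<noteq> g" "slope_on \<eta> \<tau> \<tau> 1 g" "slope_on \<eta> \<tau> p \<tau> f"
    using assms(3) unfolding break_def by auto
  obtain h where h: "mv\<^sup>*\<^sup>* (f, g) (h, h)" using mv_merge[OF b(4,5)] by blast
  have *: "(\<exists>\<eta>'. fstep\<^sup>*\<^sup>* \<eta> \<eta>' \<and> slope_on \<eta>' \<tau> \<tau> 1 h \<and> slope_on \<eta>' \<tau> p \<tau> h) \<and> \<tau> * real N \<in> \<int>"
    using flow_merge[OF assms(1) b(1-3) h] assms(2) b(4-8) by simp
  then show "\<tau> * real N \<in> \<int>" by blast
  show "\<exists>h \<eta>'. fstep\<^sup>*\<^sup>* \<eta> \<eta>' \<and> slope_on \<eta>' \<tau> p 1 h" using * slope_on_join by blast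
qed

text \<open>Each merging moves the last break to the left, and its position is an integer multiple of \<open>1 / N\<close>.\<close>

lemma flow_straight:
  assumes "fclosed B" "\<forall>\<eta>\<in>B. chain_of_lines \<eta>" "\<eta> \<in> B"
  shows "\<exists>f\<in>cO. \<exists>\<eta>'. fstep\<^sup>*\<^sup>* \<eta> \<eta>' \<and> slope_on \<eta>' 0 0 1 f"
proof -
  have "\<exists>f\<in>cO. \<exists>\<eta>'. fstep\<^sup>*\<^sup>* \<eta> \<eta>' \<and> slope_on \<eta>' 0 0 1 f"
    if "\<eta> \<in> B" "break \<eta> p \<tau> f g" "n = nat \<lfloor>\<tau> * real N\<rfloor>" for n \<eta> p \<tau> f g
    using that
  proof (induction n arbitrary: \<eta> p \<tau> f g rule: less_induct)
    case (less n)
    obtain h \<eta>' where \<eta>': "fstep\<^sup>*\<^sup>* \<eta> \<eta>'" "slope_on \<eta>' \<tau> p 1 h"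
      using break_int(2)[OF assms(1) less.prems(1,2)] by blast
    have in_B: "\<eta>' \<in> B" using \<eta>'(1) assms(1) less.prems(1) by (rule fclosed_rtranclp)
    then have "chain_of_lines \<eta>'" using assms(2) by blast
    from last_break[OF this] show ?case
    proof
      assume "\<exists>f\<in>cO. slope_on \<eta>' 0 0 1 f"
      then show ?thesis using \<eta>'(1) by blast
    next
      assume "\<exists>p \<tau> f g. break \<eta>' p \<tau> f g"
      then obtain p' \<tau>' f' g' where b: "break \<eta>' p' \<tau>' f' g'" by blast
      then have b': "0 \<le> p'" "p' < \<tau>'" "\<tau>' < 1" "f' \<noteq> g'" "slope_on \<eta>' \<tau>' \<tau>' 1 g'" "slope_on \<eta>' \<tau>' p' \<tau>' f'"
        unfolding break_def by auto
      have p: "p < \<tau>" "\<tau> < 1" using less.prems(2) unfolding break_def by auto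
      \<comment> \<open>The new path is straight on \<open>{p..1}\<close>. A break beyond
        \<open>p\<close> would have the direction \<open>h\<close> on both sides.\<close>
      have "\<tau>' \<le> p"
      proof (rule ccontr)
        assume "\<not> \<tau>' \<le> p"
        then have "f' = h" "g' = h"
          using slope_on_unique[OF b'(6) \<eta>'(2)] slope_on_unique[OF b'(5) \<eta>'(2)] b'(2,3) p by auto
        then show False using b'(4) by simp
      qed
      have i1: "\<tau>' * real N \<in> \<int>" by (rule break_int(1)[OF assms(1) in_B b])
      have i2: "\<tau> * real N \<in> \<int>" by (rule break_int(1)[OF assms(1) less.prems(1,2)])
      have "\<tau>' * real N < \<tau> * real N" using \<open>\<tau>' \<le> p\<close> p N_pos by simp
      moreover have "real_of_int \<lfloor>\<tau>' * real N\<rfloor> = \<tau>' * real N" "real_of_int \<lfloor>\<tau> * real N\<rfloor> = \<tau> * real N"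
        using i1 i2 by (auto elim!: Ints_cases)
      ultimately have "real_of_int \<lfloor>\<tau>' * real N\<rfloor> < real_of_int \<lfloor>\<tau> * real N\<rfloor>" by (simp only:)
      then have "\<lfloor>\<tau>' * real N\<rfloor> < \<lfloor>\<tau> * real N\<rfloor>" by (simp only: of_int_less_iff)
      moreover have "0 \<le> \<lfloor>\<tau>' * real N\<rfloor>" using b'(1,2) by simp
      ultimately have "nat \<lfloor>\<tau>' * real N\<rfloor> < n" unfolding less.prems(3) by linarith
      from less.IH[OF this in_B b HOL.refl] show ?thesis using rtranclp_trans[OF \<eta>'(1)] by blast
    qed
  qed
  moreover have "chain_of_lines \<eta>" using assms(2,3) by blast
  ultimately show ?thesis using last_break[of \<eta>] assms(3) by blast
qed

section \<open>Straight lines and the two inclusions\<close>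

lemma straight_eq:
  assumes "cpath \<eta>" "slope_on \<eta> 0 0 1 (fst x)" shows "\<eta> = gpath (\<lambda>_. x)"
proof (intro ext)
  fix t i
  have g: "gpath (\<lambda>_. x) t i = (min t 1 - min t 0) * real_of_int (fst x i)" for t
    using gsum_const_tail[of 0 N "\<lambda>_. x" x N t i] N_pos by simp
  have s: "\<eta> t i = t * real_of_int (fst x i)" if "0 \<le> t" "t \<le> 1" for t
    using slope_onD[OF assms(2) that, of i] cpath_zero[OF assms(1), of i] by simp
  have "\<eta> \<in> P_cl" using assms(1) unfolding cpath_def P_cl_int_def by blast
  then have out: "t \<le> 0 \<Longrightarrow> \<eta> t = \<eta> 0" "t \<ge> 1 \<Longrightarrow> \<eta> t = \<eta> 1" unfolding P_cl_def by blast+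
  consider "t \<le> 0" | "0 \<le> t" "t \<le> 1" | "t \<ge> 1" by linarith
  then show "\<eta> t i = gpath (\<lambda>_. x) t i"
  proof cases
    case 1 then show ?thesis using out(1)[OF 1] s[of 0] g[of t] by simp
  next
    case 2 then show ?thesis using s[OF 2] g[of t] by simp
  next
    case 3 then show ?thesis using out(2)[OF 3] s[of 1] g[of t] by simp
  qed
qed

lemma straight_LS: "x \<in> Orb \<Longrightarrow> gpath (\<lambda>_. x) \<in> LS_cl A i0 lam"
  by (rule grid_imp_LS) (simp add: LSg_def)

lemma flow_to_LS:
  assumes "fclosed B" "\<forall>\<eta>\<in>B. chain_of_lines \<eta>" "\<eta> \<in> B"
  shows "\<exists>x\<in>Orb. fstep\<^sup>*\<^sup>* \<eta> (gpath (\<lambda>_. x))"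
proof -
  obtain f \<eta>' where f: "f \<in> cO" "fstep\<^sup>*\<^sup>* \<eta> \<eta>'" "slope_on \<eta>' 0 0 1 f" using flow_straight[OF assms] by blast
  obtain x where x: "x \<in> Orb" "f = fst x" using f(1) by blast
  have "cpath \<eta>'" using fclosed_rtranclp[OF f(2) assms(1,3)] assms(1) unfolding fclosed_def by blast
  then have "\<eta>' = gpath (\<lambda>_. x)" using f(3) unfolding x(2) by (rule straight_eq)
  then show ?thesis using f(2) x(1) by blast
qed

lemma straight_reach:
  assumes "fclosed B" "gpath (\<lambda>_. x) \<in> B" "x \<in> Orb" "y \<in> Orb"
  shows "gpath (\<lambda>_. y) \<in> B"
proof -
  have start: "slope_on (gpath (\<lambda>_. x)) 0 0 1 (fst x)"
    unfolding slope_on_def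
  proof (intro ballI allI)
    fix t :: real and i assume "t \<in> {0..1}"
    then show "gpath (\<lambda>_. x) t i = gpath (\<lambda>_. x) 0 i + (t - 0) * real_of_int (fst x i)"
      using gsum_const_tail[of 0 N "\<lambda>_. x" x N t i] gsum_nonpos[of 0 N N "\<lambda>_. x" i] N_pos by simp
  qed
  have "pmv\<^sup>*\<^sup>* (fst x) (fst y)" using pmv_connected assms(3,4) by blast
  then have "\<exists>\<eta>\<in>B. slope_on \<eta> 0 0 1 (fst y)"
  proof (induction rule: rtranclp_induct)
    case base then show ?case using start assms(2) by blast
  next
    case (step g g')
    then obtain \<eta> j where \<eta>: "\<eta> \<in> B" "slope_on \<eta> 0 0 1 g" and j: "g j > 0" "g' = cs j g" unfolding pmv_def by blast
    \<comment> \<open>A straight line has no break; \<open>flow_step\<close> is used at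
      \<open>\<tau> = 0\<close> with a left piece reduced to a point.\<close>
    have "slope_on \<eta> 0 0 0 g" by (simp add: slope_on_def)
    from flow_step[OF assms(1) \<eta>(1) order_refl order_refl zero_less_one \<eta>(2) this j(1)]
    obtain \<eta>' where "fstep\<^sup>*\<^sup>* \<eta> \<eta>'" "slope_on \<eta>' 0 0 1 g'" unfolding j(2) by blast
    then show ?case using fclosed_rtranclp[OF _ assms(1) \<eta>(1)] by blast
  qed
  then obtain \<eta> where \<eta>: "\<eta> \<in> B" "slope_on \<eta> 0 0 1 (fst y)" by blast
  have "cpath \<eta>" using assms(1) \<eta>(1) unfolding fclosed_def by blast
  then show ?thesis using straight_eq[OF _ \<eta>(2)] \<eta>(1) by simp
qed

theorem fclosed_eq_LS_cl:
  assumes "fclosed B" "\<forall>\<eta>\<in>B. chain_of_lines \<eta>" "B \<noteq> {}"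
  shows "B = LS_cl A i0 lam"
proof
  let ?L = "LS_cl A i0 lam"
  show sub: "B \<subseteq> ?L"
  proof
    fix \<eta> assume \<eta>: "\<eta> \<in> B"
    obtain x where "x \<in> Orb" "fstep\<^sup>*\<^sup>* \<eta> (gpath (\<lambda>_. x))" using flow_to_LS[OF assms(1,2) \<eta>] by blast
    then show "\<eta> \<in> ?L"
      using finite_fclosed_backward_rtranclp[OF finite_LS_cl fclosed_LS_cl lev0_LS_cl _ straight_LS assms(1) \<eta>] by blast
  qed
  have finB: "finite B" using sub finite_LS_cl by (rule finite_subset)
  have levB: "\<forall>\<eta>\<in>B. lev0 \<eta>" using sub lev0_LS_cl by blast
  have chL: "\<forall>\<eta>\<in>?L. chain_of_lines \<eta>"
    unfolding LS_cl_eq chain_of_lines_def using N_pos unfolding LSg_def by blast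
  obtain \<eta>0 where "\<eta>0 \<in> B" using assms(3) by blast
  then obtain x0 where x0: "x0 \<in> Orb" "gpath (\<lambda>_. x0) \<in> B"
    using flow_to_LS[OF assms(1,2)] fclosed_rtranclp[OF _ assms(1)] by blast
  show "?L \<subseteq> B"
  proof
    fix \<eta> assume \<eta>: "\<eta> \<in> ?L"
    obtain x where x: "x \<in> Orb" "fstep\<^sup>*\<^sup>* \<eta> (gpath (\<lambda>_. x))" using flow_to_LS[OF fclosed_LS_cl chL \<eta>] by blast
    have "gpath (\<lambda>_. x) \<in> B" using straight_reach[OF assms(1) x0(2,1) x(1)] .
    then show "\<eta> \<in> B"
      using finite_fclosed_backward_rtranclp[OF finB assms(1) levB x(2) _ fclosed_LS_cl \<eta>] by blast
  qed
qed

lemma chain_of_linesI: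
  assumes "mus \<noteq> []" "length sigmas = length mus" "set mus \<subseteq> clw ` Orb" "0 < sigmas ! 0"
    "\<forall>k. Suc k < length sigmas \<longrightarrow> sigmas ! k < sigmas ! Suc k" "last sigmas = 1"
    "\<forall>t\<in>{0..1}. \<eta> t = lin_path mus (map of_rat sigmas) t"
  shows "chain_of_lines \<eta>" "continuous_on {0..1} (\<lambda>t. \<eta> t j)"
proof -
  have "mus \<in> map clw ` lists Orb" using assms(3) unfolding lists_image[symmetric] by (simp add: subset_iff in_lists_conv_set)
  then obtain xs where xs: "mus = map clw xs" "set xs \<subseteq> Orb" by (auto simp: in_lists_conv_set)
  define ps where "ps = zip xs sigmas"
  have len: "length ps = length xs" "length sigmas = length xs" using assms(2) xs(1) by (simp_all add: ps_def)
  have fs: "map fst ps = xs" "map snd ps = sigmas" using len by (simp_all add: ps_def)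
  have ne: "ps \<noteq> []" using assms(1) xs(1) len by auto
  have sn: "snd (ps ! k) = sigmas ! k" if "k < length ps" for k using that len by (simp add: ps_def)
  have inc: "increasing ps" unfolding increasing_def using ne assms(4,5) sn[of 0] sn len by (simp flip: length_greater_0_conv)
  have "0 < sigmas ! k" if "k < length sigmas" for k
    using that by (induction k) (use assms(4,5) in \<open>force+\<close>)
  then have "\<forall>\<sigma>\<in>set sigmas. 0 \<le> \<sigma>" by (auto simp: in_set_conv_nth less_imp_le)
  then obtain M :: nat where M: "M > 0" "\<forall>\<sigma>\<in>set sigmas. \<exists>m::nat. \<sigma> = of_nat m / of_nat M" using common_denominator by blast
  have g: "\<forall>p\<in>set ps. \<exists>m::nat. snd p = of_nat m / of_nat M"
    using M(2) unfolding fs(2)[symmetric] by simp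
  have "snd (last ps) = of_nat M / of_nat M" using assms(6) ne M(1) unfolding fs(2)[symmetric] by (simp add: last_map)
  from grid_of_list[OF M(1) inc g this] obtain \<nu> where \<nu>: "\<forall>t i. pair_path ps t i = gsum M M \<nu> t i" "\<forall>k<M. \<nu> k \<in> fst ` set ps" by blast
  have eq: "\<eta> t i = gsum M M \<nu> t i" if "t \<in> {0..1}" for t i
    using assms(7) that \<nu>(1) unfolding fs xs(1) by simp
  have "\<nu> k \<in> Orb" if "k < M" for k
    using \<nu>(2) that xs(2) unfolding fs(1)[symmetric] by auto
  then show "chain_of_lines \<eta>" unfolding chain_of_lines_def using M(1) eq by blast
  show "continuous_on {0..1} (\<lambda>t. \<eta> t j)"
    by (rule continuous_on_cong[THEN iffD2, OF HOL.refl eq gsum_continuous])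
qed

end

theorem theorem2p19:
  fixes A :: "'i::finite \<Rightarrow> 'i \<Rightarrow> int" and i0 :: 'i
    and lam :: "'i wt" and B :: "'i path set"
  assumes "untwisted_affine A i0"
    and "lam \<in> level_zero_dominant A i0"
    and "B \<subseteq> P_cl_int"
    and "B \<noteq> {}"
    and "\<forall>\<eta>\<in>B. \<forall>j. root_f A j \<eta> = None \<or> the (root_f A j \<eta>) \<in> B"
    and "\<forall>\<eta>\<in>B. \<exists>mus (sigmas :: rat list).
           mus \<noteq> [] \<and> length sigmas = length mus \<and>
           set mus \<subseteq> clw ` Worbit A i0 lam \<and>
           0 < sigmas ! 0 \<and> (\<forall>k. Suc k < length sigmas \<longrightarrow> sigmas ! k < sigmas ! Suc k) \<and>
           last sigmas = 1 \<and>
           (\<forall>t\<in>{0..1}. \<eta> t = lin_path mus (map of_rat sigmas) t)"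
  shows "B = LS_cl A i0 lam"
proof -
  have gi: "GCM A" "indecomposable A" using assms(1) unfolding untwisted_affine_def by blast+
  obtain a :: "'i \<Rightarrow> int" where a: "\<forall>i. a i > 0" "a i0 = 1" "\<forall>i. (\<Sum>j\<in>UNIV. A i j * a j) = 0"
    "(\<lambda>k. if k = i0 then 0 else a k) \<in> fin_roots A i0"
    using assms(1) unfolding untwisted_affine_def by blast
  obtain v :: "'i \<Rightarrow> int" where v: "\<forall>i. v i > 0" "v i0 = 1" "\<forall>j. (\<Sum>i\<in>UNIV. v i * A i j) = 0"
    using assms(1) unfolding untwisted_affine_def by blast
  interpret affine A i0 a v by unfold_locales (use gi a v in auto)
  interpret level_zero_orbit A i0 a v lam
    by unfold_locales (rule level_zero_dominant_level[OF assms(2)])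
  obtain N where N: "N > 0" "\<forall>f\<in>cO. \<forall>j. f j \<noteq> 0 \<longrightarrow> f j dvd int N" using exists_grid_size by blast
  interpret grid_orbit A i0 a v lam N by unfold_locales (use N in auto)
  have ch: "chain_of_lines \<eta> \<and> (\<forall>j. continuous_on {0..1} (\<lambda>t. \<eta> t j))" if mem: "\<eta> \<in> B" for \<eta>
  proof -
    obtain mus and sigmas :: "rat list" where *: "mus \<noteq> []" "length sigmas = length mus"
           "set mus \<subseteq> clw ` Worbit A i0 lam"
           "0 < sigmas ! 0" "\<forall>k. Suc k < length sigmas \<longrightarrow> sigmas ! k < sigmas ! Suc k"
           "last sigmas = 1" "\<forall>t\<in>{0..1}. \<eta> t = lin_path mus (map of_rat sigmas) t"
      using bspec[OF assms(6) mem] by blast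
    show ?thesis using chain_of_linesI[OF *] by blast
  qed
  have "fclosed B" unfolding fclosed_def cpath_def using assms(3,5) ch by blast
  then show ?thesis using ch assms(4) by (intro fclosed_eq_LS_cl) auto
qed

end
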